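(* Let $(Z_n)_{n\ge 0}$ be a supercritical branching process in an i.i.d. random environment satisfying the standing assumptions given in the context. Suppose that there exists a constant $\delta\in(0,1)$ such that $\mathbb{E}X^{2+\delta}=\mathbb{E}(\log m_0)^{2+\delta}<\infty$. Then $$\limsup_{n\rightarrow\infty}\frac{\log Z_n-n\mu}{\sqrt{n\log\log n}}=+\sqrt{2}\,\sigma\quad\text{a.s.}$$ and $$\liminf_{n\rightarrow\infty}\frac{\log Z_n-n\mu}{\sqrt{n\log\log n}}=-\sqrt{2}\,\sigma\quad\text{a.s.}$$
   Context: Branching process in random environment: $\xi=(\xi_0,\xi_1,\ldots)$ is a sequence of i.i.d. random variables (the environment). To each $\xi_n$ is associated an offspring distribution $p(\xi_n)=\{p_k(\xi_n):k\in\mathbb{N}\}$ on $\mathbb{N}=\{0,1,2,\dots\}$. The process is defined by $Z_0=1$ and $Z_{n+1}=\sum_{i=1}^{Z_n}X_{n,i}$ for $n\ge 0$, where, given $\xi$, for each $n$ the variables $(X_{n,i})_{i\ge1}$ are i.i.d. with law $p(\xi_n)$, i.e. $\mathbb{P}(X_{n,i}=k\mid\xi_n)=p_k(\xi_n)$, and are independent of $(Z_1,\ldots,Z_n)$. $\mathbb{P}_\xi$ denotes the conditional probability given $\xi$ (quenched law), and $\mathbb{P}(dx,d\xi)=\mathbb{P}_\xi(dx)\,\tau(d\xi)$ the total (annealed) probability, where $\tau$ is the law of $\xi$; $\mathbb{E}_\xi$ and $\mathbb{E}$ are the corresponding expectations. "a.s." refers to $\mathbb{P}$. Notation: $m_n=\sum_{i\ge0}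 i\,p_i(\xi_n)$, $X=\log m_0$, $\mu=\mathbb{E}X$, $\sigma^2=\mathbb{E}(X-\mu)^2$. The process is called supercritical if $\mu>0$. Standing assumptions: $\mu>0$; $p_0(\xi_0)=0$ a.s. (so $X\ge0$ and $Z_n\ge1$ a.s.); $\sigma\in(0,\infty)$; and $\mathbb{E}\left[\frac{Z_1}{m_0}\log Z_1\right]<\infty$. *)

theory Defs
  imports "HOL-Probability.Probability"
begin

definition env_algebra :: "'w measure \<Rightarrow> 'e measure \<Rightarrow> (nat \<Rightarrow> 'w \<Rightarrow> 'e) \<Rightarrow> 'w measure" where
  "env_algebra M E \<xi> = vimage_algebra (space M) (\<lambda>\<omega> n. \<xi> n \<omega>) (Pi\<^sub>M UNIV (\<lambda>_. E))"

text \<open>The quenched probability of an event, as a version of its conditional probability given the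
  whole environment sequence. It is determined only almost surely.\<close>

definition quenched_prob ::
  "'w measure \<Rightarrow> 'e measure \<Rightarrow> (nat \<Rightarrow> 'w \<Rightarrow> 'e) \<Rightarrow> 'w set \<Rightarrow> 'w \<Rightarrow> real" where
  "quenched_prob M E \<xi> A = real_cond_exp M (env_algebra M E \<xi>) (indicat_real A)"

definition offspring_mean :: "nat pmf \<Rightarrow> real" where
  "offspring_mean q = (\<Sum>k. real k * pmf q k)"

text \<open>Branching process in an i.i.d. random environment. The offspring variables \<open>X n i\<close> are
  indexed by \<open>i \<ge> 1\<close>; \<open>X n 0\<close> is never used. All the variables in the last two assumptions are
  discrete, so conditional laws and conditional independence are stated on point events; the family
  \<open>(X n i)\<close>, \<open>i \<ge> 1\<close>, enters through its finite subfamilies.\<close>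

locale branching_process_iid_env = prob_space M
  for M :: "'w measure" +
  fixes E :: "'e measure"
    and \<xi> :: "nat \<Rightarrow> 'w \<Rightarrow> 'e"
    and p :: "'e \<Rightarrow> nat pmf"
    and X :: "nat \<Rightarrow> nat \<Rightarrow> 'w \<Rightarrow> nat"
    and Z :: "nat \<Rightarrow> 'w \<Rightarrow> nat"
  assumes env_indep: "indep_vars (\<lambda>_. E) \<xi> UNIV"
    and env_ident: "\<And>n. distr M E (\<xi> n) = distr M E (\<xi> 0)"
    and offspring_law_measurable: "\<And>k. (\<lambda>e. pmf (p e) k) \<in> borel_measurable E"
    and offspring_measurable: "\<And>n i. i \<ge> 1 \<Longrightarrow> X n i \<in> measurable M (count_space UNIV)"
    and Z_0: "\<And>\<omega>. \<omega> \<in> space M \<Longrightarrow> Z 0 \<omega> = 1"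
    and Z_Suc: "\<And>n \<omega>. \<omega> \<in> space M \<Longrightarrow> Z (Suc n) \<omega> = (\<Sum>i\<in>{1..Z n \<omega>}. X n i \<omega>)"
    and quenched_iid: "\<And>n I k. finite I \<Longrightarrow> I \<subseteq> {1..} \<Longrightarrow>
      AE \<omega> in M. quenched_prob M E \<xi> {\<omega>' \<in> space M. \<forall>i\<in>I. X n i \<omega>' = k i} \<omega>
        = (\<Prod>i\<in>I. pmf (p (\<xi> n \<omega>)) (k i))"
    and quenched_indep: "\<And>n I k z. finite I \<Longrightarrow> I \<subseteq> {1..} \<Longrightarrow>
      AE \<omega> in M. quenched_prob M E \<xi>
          {\<omega>' \<in> space M. (\<forall>j\<in>{1..n}. Z j \<omega>' = z j) \<and> (\<forall>i\<in>I. X n i \<omega>' = k i)} \<omega>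
        = quenched_prob M E \<xi> {\<omega>' \<in> space M. \<forall>j\<in>{1..n}. Z j \<omega>' = z j} \<omega>
          * quenched_prob M E \<xi> {\<omega>' \<in> space M. \<forall>i\<in>I. X n i \<omega>' = k i} \<omega>"

end

theory Submission
  imports Defs "HOL-Real_Asymp.Real_Asymp"
begin

text \<open>
  Write \<open>ln (Z n) = S n + ln (W n)\<close> with \<open>S n\<close> the sum of \<open>ln (m j)\<close> over \<open>j < n\<close>. The random
  walk \<open>S\<close> obeys the law of the iterated logarithm and \<open>ln (W n)\<close> is negligible.

  For the random walk, Lindeberg's replacement with a \<open>C\<^sup>2\<close> step function whose second derivative is
  Lipschitz compares the tail of \<open>S n / sqrt n\<close> with the normal tail, up to a bounded shift of the
  argument and an error \<open>O (n powr (- \<delta> / 2))\<close>. Along geometric subsequences this error is summable,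
  so the classical arguments (Ottaviani's inequality and the two Borel-Cantelli lemmas) apply without
  any truncation.

  For \<open>W\<close>, the mean of \<open>W n\<close> is at most 1, which bounds it above by \<open>(n + 1)\<^sup>2\<close> eventually. For
  the lower bound, \<open>Z n\<close> grows exponentially because the AM-HM inequality makes \<open>E (1 / Z n)\<close> decay
  geometrically. Truncating the offspring in generation \<open>n\<close> at \<open>b ^ n\<close>, with \<open>Z n\<close> at least
  \<open>b ^ (2 * n)\<close>, loses summable proportions of the means by the \<open>Z log Z\<close> condition, and an exponential
  Chebyshev bound controls the truncated sums. Hence \<open>ln (W n)\<close> stays bounded below.
\<close>

section \<open>Normal approximation with a rate\<close>

text \<open>A bare central limit theorem is too weak: along a geometric sequence the relevant events
  have probability about \<open>k powr (- c\<^sup>2 / 2)\<close> with \<open>c\<close> near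
  \<open>sqrt 2\<close>, hence about \<open>1 / k\<close>, so the approximation error must itself be
  summable. The moment of order \<open>2 + \<delta>\<close> serves this purpose. The bounded shifts
  left by smoothing and by Ottaviani's inequality do no harm, because the level
  \<open>c * sqrt (ln (ln n))\<close> tends to infinity and \<open>c\<close> stays strictly away
  from \<open>sqrt 2\<close>. On the branching side the conditional laws are given on point events.
  Every quenched computation is therefore an ordinary integral against an arbitrary
  environment-measurable weight, and the environment factor produced by one generation is moved into
  the weight before the next. No positive limit of \<open>W n\<close> is established: an error of
  order \<open>ln n\<close> is invisible on the scale \<open>sqrt (n * ln (ln n))\<close>, so a
  polynomial upper bound and a pathwise recursion
  \<open>Z (Suc n) \<ge> (1 - e n) * (1 - d n) * m n * Z n\<close> with summable \<open>e\<close>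
  and \<open>d\<close> are enough.\<close>

lemma DERIV_max0_power:
  "((\<lambda>x::real. (max 0 x) ^ (n+2)) has_real_derivative (n+2) * (max 0 x) ^ (n+1)) (at x)"
proof -
  consider "x < 0" | "x > 0" | "x = 0" by linarith
  then show ?thesis
  proof cases
    case 1
    have "((\<lambda>x::real. 0) has_real_derivative 0) (at x)" by simp
    then have "((\<lambda>x::real. (max 0 x) ^ (n+2)) has_real_derivative 0) (at x)"
      by (rule has_field_derivative_transform_within_open[where S = "{..<0}"]) (use 1 in auto)
    then show ?thesis using 1 by simp
  next
    case 2
    have "((\<lambda>x::real. x ^ (n+2)) has_real_derivative (n+2) * x ^ (n+1)) (at x)"
      using DERIV_pow[of "n+2" x] by simp
    then have "((\<lambda>x::real. (max 0 x) ^ (n+2)) has_real_derivative (n+2) * x ^ (n+1)) (at x)"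
      by (rule has_field_derivative_transform_within_open[where S = "{0<..}"]) (use 2 in auto)
    then show ?thesis by (rule DERIV_cong) (use 2 in simp)
  next
    case 3
    \<comment> \<open>At the kink the difference quotient is at most
      \<open>\<bar>h\<bar> ^ (n+1)\<close>, which vanishes because the exponent is at least
      1.\<close>
    have "(\<lambda>h::real. (max 0 h) ^ (n+2) / h) \<midarrow>0\<rightarrow> 0"
    proof (rule Lim_null_comparison[where g = "\<lambda>h. \<bar>h\<bar> ^ (n+1)"])
      show "\<forall>\<^sub>F h in at (0::real). norm ((max 0 h) ^ (n+2) / h) \<le> \<bar>h\<bar> ^ (n+1)"
        by (intro always_eventually allI) (auto simp: max_def abs_mult field_simps intro!: mult_nonpos_nonneg)
      show "((\<lambda>h::real. \<bar>h\<bar> ^ (n+1)) \<longlongrightarrow> 0) (at 0)"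
        by (rule tendsto_eq_intros | simp)+
    qed
    then show ?thesis using 3 by (simp add: DERIV_def)
  qed
qed

text \<open>A substitute for the indicator of the positive half line that is smooth enough for a
  second-order expansion. The ramp has width 4, and this width is the shift by 4 in the later tail
  comparison.\<close>

lemma smooth_step_exists:
  obtains f g h :: "real \<Rightarrow> real"
  where "\<And>x. (f has_real_derivative g x) (at x)" "\<And>x. (g has_real_derivative h x) (at x)"
    "\<And>x y. \<bar>h x - h y\<bar> \<le> 3 * \<bar>x - y\<bar>" "\<And>x. \<bar>h x\<bar> \<le> 1"
    "\<And>x. 0 \<le> f x" "\<And>x. f x \<le> 1" "\<And>x. x \<le> 0 \<Longrightarrow> f x = 0" "\<And>x. x \<ge> 4 \<Longrightarrow> f x = 1"
proof -
  \<comment> \<open>\<open>h\<close> is piecewise linear with slopes 1, -1, 1 on [0,1], [1,3], [3,4], and \<open>f\<close> integrates it twice.\<close>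
  define f :: "real \<Rightarrow> real" where
    "f x = ((max 0 x)^3 - 2 * (max 0 (x-1))^3 + 2 * (max 0 (x-3))^3 - (max 0 (x-4))^3) / 12" for x
  define g :: "real \<Rightarrow> real" where
    "g x = ((max 0 x)^2 - 2 * (max 0 (x-1))^2 + 2 * (max 0 (x-3))^2 - (max 0 (x-4))^2) / 4" for x
  \<comment> \<open>With the divisor 2 the slopes of \<open>h\<close> are 1/2, -1/2 and 1/2, and its
    values lie between -1/2 and 1/2; the constants 3 and 1 in the statement are generous.\<close>
  define h :: "real \<Rightarrow> real" where
    "h x = (max 0 x - 2 * max 0 (x-1) + 2 * max 0 (x-3) - max 0 (x-4)) / 2" for x
  have d3: "((\<lambda>x. (max 0 (x-c))^3) has_real_derivative 3 * (max 0 (x-c))^2) (at x)" for x c :: real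
    using DERIV_shift[of "\<lambda>x. (max 0 x)^3" "3 * (max 0 (x-c))^2" x "-c"] DERIV_max0_power[of 1 "x-c"]
    by (simp add: numeral_3_eq_3 eval_nat_numeral)
  have d2: "((\<lambda>x. (max 0 (x-c))^2) has_real_derivative 2 * max 0 (x-c)) (at x)" for x c :: real
    using DERIV_shift[of "\<lambda>x. (max 0 x)^2" "2 * (max 0 (x-c))" x "-c"] DERIV_max0_power[of 0 "x-c"]
    by (simp add: eval_nat_numeral)
  have Df: "(f has_real_derivative g x) (at x)" for x
  proof -
    have "(f has_real_derivative (3 * (max 0 x)^2 - 2 * (3 * (max 0 (x-1))^2) + 2 * (3 * (max 0 (x-3))^2)
        - 3 * (max 0 (x-4))^2) / 12) (at x)"
      unfolding f_def[abs_def]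
      by (intro DERIV_cdivide DERIV_diff DERIV_add DERIV_cmult d3 d3[of 0, simplified])
    then show ?thesis by (rule DERIV_cong) (simp add: g_def)
  qed
  have Dg: "(g has_real_derivative h x) (at x)" for x
  proof -
    have "(g has_real_derivative (2 * (max 0 x) - 2 * (2 * (max 0 (x-1))) + 2 * (2 * (max 0 (x-3)))
        - 2 * (max 0 (x-4))) / 4) (at x)"
      unfolding g_def[abs_def]
      by (intro DERIV_cdivide DERIV_diff DERIV_add DERIV_cmult d2 d2[of 0, simplified])
    then show ?thesis by (rule DERIV_cong) (simp add: h_def)
  qed
  \<comment> \<open>Monotonicity of \<open>f\<close> confines it between its end values 0 and 1. On
    [1,3] one has \<open>4 * g x = 2 - (x - 2)\<^sup>2\<close>, hence the bound on the square in
    that case.\<close>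
  have g0: "0 \<le> g x" for x
  proof -
    consider "x \<le> 0" | "0 \<le> x" "x \<le> 1" | "1 \<le> x" "x \<le> 3" | "3 \<le> x" "x \<le> 4" | "4 \<le> x" by linarith
    then show ?thesis
    proof cases
      case 3
      then have "(x-2)^2 \<le> 1" by (simp add: abs_le_square_iff[of "x-2" 1, simplified, symmetric] abs_le_iff)
      then show ?thesis using 3 by (simp add: g_def power2_eq_square algebra_simps)
    next
      case 4
      have "4 * g x = (4 - x)^2" using 4 by (simp add: g_def power2_eq_square field_simps)
      then show ?thesis using zero_le_power2[of "4-x"] by linarith
    next
      case 5
      then show ?thesis by (simp add: g_def power2_eq_square algebra_simps)
    qed (auto simp: g_def)
  qed
  have mono: "f x \<le> f y" if "x \<le> y" for x y
    by (rule DERIV_nonneg_imp_nondecreasing[OF that]) (use Df g0 in blast)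
  have f0: "f x = 0" if "x \<le> 0" for x using that by (simp add: f_def)
  \<comment> \<open>Beyond 4 all powers of \<open>x\<close> cancel and the numerator is the constant
    4^3 - 2 * 3^3 + 2 * 1^3 = 12, which explains the divisor in \<open>f\<close>.\<close>
  have f1: "f x = 1" if "x \<ge> 4" for x
    using that by (simp add: f_def power3_eq_cube algebra_simps)
  have "f x \<ge> 0" for x using mono[of "min x 0" x] f0[of "min x 0"] by simp
  moreover have "f x \<le> 1" for x using mono[of x "max x 4"] f1[of "max x 4"] by simp
  moreover have "\<bar>h x - h y\<bar> \<le> 3 * \<bar>x - y\<bar>" for x y unfolding h_def by argo
  moreover have "\<bar>h x\<bar> \<le> 1" for x unfolding h_def by argo
  ultimately show thesis using that[of f g h] Df Dg f0 f1 by blast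
qed

text \<open>The variation of \<open>h\<close> is at most \<open>3 * \<bar>t\<bar>\<close> by the
  Lipschitz bound and at most 2 by boundedness. Using the first for small \<open>t\<close> and the
  second for large \<open>t\<close> gives \<open>3 * \<bar>t\<bar> powr \<delta>\<close>, so the
  remainder is integrable with a moment of order \<open>2 + \<delta>\<close> in place of a third
  moment.\<close>

lemma second_order_taylor_bound:
  fixes f g h :: "real \<Rightarrow> real"
  assumes "\<And>x. (f has_real_derivative g x) (at x)" "\<And>x. (g has_real_derivative h x) (at x)"
    and lip: "\<And>x y. \<bar>h x - h y\<bar> \<le> 3 * \<bar>x - y\<bar>" and bd: "\<And>x. \<bar>h x\<bar> \<le> 1"
    and \<delta>: "0 < \<delta>" "\<delta> \<le> 1"
  shows "\<bar>f (x + t) - f x - g x * t - h x * t\<^sup>2 / 2\<bar> \<le> 3 * \<bar>t\<bar> powr (2 + \<delta>)"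
proof (cases "t = 0")
  case False
  define d where "d = (\<lambda>m::nat. if m = 0 then f else if m = 1 then g else h)"
  have "\<exists>s. (if x + t < x then x + t < s \<and> s < x else x < s \<and> s < x + t) \<and>
     f (x+t) = (\<Sum>m<2. d m x / fact m * (x + t - x) ^ m) + d 2 s / fact 2 * (x + t - x)^2"
    by (rule Taylor[where a = "min x (x+t)" and b = "max x (x+t)"])
       (use False assms in \<open>auto simp: d_def less_2_cases_iff\<close>)
  then obtain s where s0: "if x + t < x then x + t < s \<and> s < x else x < s \<and> s < x + t"
    and s: "f (x+t) = f x + g x * t + h s * t^2/2"
    by (auto simp: d_def eval_nat_numeral)
  from s0 have s1: "\<bar>s - x\<bar> \<le> \<bar>t\<bar>" by (auto split: if_splits)
  have "\<bar>h s - h x\<bar> \<le> 3 * \<bar>t\<bar> powr \<delta>"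
  proof (cases "\<bar>t\<bar> \<le> 1")
    case True
    have "\<bar>h s - h x\<bar> \<le> 3 * \<bar>t\<bar> powr 1" using lip[of s x] s1 False by simp
    also have "\<bar>t\<bar> powr 1 \<le> \<bar>t\<bar> powr \<delta>" using \<delta> True by (intro powr_mono') auto
    finally show ?thesis by simp
  next
    case f: False
    have "\<bar>h s - h x\<bar> \<le> 2" using bd[of s] bd[of x] by linarith
    moreover have "1 \<le> \<bar>t\<bar> powr \<delta>" using f \<delta> by (intro ge_one_powr_ge_zero) auto
    ultimately show ?thesis by linarith
  qed
  then have "\<bar>h s - h x\<bar> * t^2/2 \<le> 3 * \<bar>t\<bar> powr \<delta> * t^2 / 2"
    by (intro divide_right_mono mult_right_mono) auto
  also have "\<dots> = 3/2 * \<bar>t\<bar> powr (2+\<delta>)"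
    using False by (simp add: powr_add)
  also have "\<dots> \<le> 3 * \<bar>t\<bar> powr (2+\<delta>)" by simp
  also have "\<bar>h s - h x\<bar> * t^2/2 = \<bar>(h s - h x) * t^2/2\<bar>" by (simp add: abs_mult)
  also have "(h s - h x) * t^2/2 = f (x + t) - f x - g x * t - h x * t\<^sup>2 / 2"
    using s by (simp add: algebra_simps diff_divide_distrib)
  finally show ?thesis .
qed auto

section \<open>Lindeberg replacement for convolution powers\<close>

locale prob_borel = prob_space \<nu> for \<nu> :: "real measure" +
  assumes sets_eq [measurable_cong, simp]: "sets \<nu> = sets borel"
begin

lemma space_eq [simp]: "space \<nu> = UNIV"
  using sets_eq_imp_space_eq[OF sets_eq] by simp

lemma integrable_bounded:
  assumes [measurable]: "F \<in> borel_measurable borel" and "\<And>x. \<bar>F x\<bar> \<le> (B::real)"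
  shows "integrable \<nu> F"
  by (rule integrable_const_bound[of _ B]) (use assms in auto)

lemma shift_measurable [measurable]:
  assumes [measurable]: "F \<in> borel_measurable borel"
  shows "(\<lambda>x. \<integral>y. F (x + y) \<partial>\<nu>) \<in> (borel_measurable borel :: (real \<Rightarrow> real) set)"
  by measurable

lemma integral_abs_le:
  assumes [measurable]: "F \<in> borel_measurable borel" and F: "\<And>x. \<bar>F x\<bar> \<le> (B::real)"
  shows "\<bar>\<integral>y. F y \<partial>\<nu>\<bar> \<le> B"
proof -
  have i: "integrable \<nu> F" by (rule integrable_bounded[OF _ F]) simp
  have "\<bar>\<integral>y. F y \<partial>\<nu>\<bar> \<le> (\<integral>y. \<bar>F y\<bar> \<partial>\<nu>)" by (rule integral_abs_bound)
  also have "\<dots> \<le> (\<integral>y. B \<partial>\<nu>)" using i F by (intro integral_mono) auto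
  finally show ?thesis using prob_space by simp
qed

end

lemma integral_shift_commute:
  assumes "prob_borel \<alpha>" "prob_borel \<beta>"
    and [measurable]: "F \<in> borel_measurable borel" and F: "\<And>x. \<bar>F x\<bar> \<le> (B::real)"
  shows "(\<integral>x. \<integral>y. F (x + y) \<partial>\<beta> \<partial>\<alpha>) = (\<integral>y. \<integral>x. F (y + x) \<partial>\<alpha> \<partial>\<beta>)"
    and "(\<integral>z. F z \<partial>(\<alpha> \<star> \<beta>)) = (\<integral>x. \<integral>y. F (x + y) \<partial>\<beta> \<partial>\<alpha>)"
proof -
  interpret a: prob_borel \<alpha> by fact
  interpret b: prob_borel \<beta> by fact
  interpret ab: pair_prob_space \<alpha> \<beta> ..
  have i: "integrable (\<alpha> \<Otimes>\<^sub>M \<beta>) (\<lambda>(x,y). F (x + y))"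
    by (rule ab.P.integrable_const_bound[of _ B]) (use F in auto)
  show "(\<integral>x. \<integral>y. F (x + y) \<partial>\<beta> \<partial>\<alpha>) = (\<integral>y. \<integral>x. F (y + x) \<partial>\<alpha> \<partial>\<beta>)"
    using ab.Fubini_integral[OF i] by (simp add: add.commute)
  have "(\<integral>z. F z \<partial>(\<alpha> \<star> \<beta>)) = (\<integral>p. (case p of (x,y) \<Rightarrow> F (x + y)) \<partial>(\<alpha> \<Otimes>\<^sub>M \<beta>))"
    unfolding convolution_def by (subst integral_distr) (auto simp: case_prod_unfold)
  then show "(\<integral>z. F z \<partial>(\<alpha> \<star> \<beta>)) = (\<integral>x. \<integral>y. F (x + y) \<partial>\<beta> \<partial>\<alpha>)"
    using ab.integral_fst[OF i] by simp
qed

text \<open>Trotter's form of Lindeberg's method: the shift operators commute, so the two convolution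
  powers can be exchanged one factor at a time.\<close>

lemma trotter_comparison:
  fixes a b :: "nat \<Rightarrow> real measure"
  assumes \<alpha>: "prob_borel \<alpha>" and \<beta>: "prob_borel \<beta>"
    and a: "\<And>n. prob_borel (a n)" and b: "\<And>n. prob_borel (b n)"
    and aS: "\<And>n. a (Suc n) = (\<alpha> \<star> a n)" and bS: "\<And>n. b (Suc n) = (\<beta> \<star> b n)" and ab0: "a 0 = b 0"
    and [measurable]: "F \<in> borel_measurable borel" and F: "\<And>x. \<bar>F x\<bar> \<le> (B::real)"
    and eps: "\<And>x. \<bar>(\<integral>y. F (x + y) \<partial>\<alpha>) - (\<integral>y. F (x + y) \<partial>\<beta>)\<bar> \<le> (\<epsilon> :: real)"
  shows "\<bar>(\<integral>y. F (x + y) \<partial>a n) - (\<integral>y. F (x + y) \<partial>b n)\<bar> \<le> n * \<epsilon>"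
proof (induction n arbitrary: x)
  case (Suc n)
  interpret \<alpha>: prob_borel \<alpha> by fact
  interpret \<beta>: prob_borel \<beta> by fact
  interpret a: prob_borel "a n" by fact
  interpret b: prob_borel "b n" by fact
  define D where "D z = (\<integral>y. F (z + y) \<partial>\<alpha>) - (\<integral>y. F (z + y) \<partial>\<beta>)" for z
  define G where "G z = (\<integral>y. F (z + y) \<partial>a n) - (\<integral>y. F (z + y) \<partial>b n)" for z
  have [measurable]: "D \<in> borel_measurable borel" "G \<in> borel_measurable borel"
    unfolding D_def G_def by measurable
  have Fx: "(\<lambda>y. F (x + y)) \<in> borel_measurable borel" by measurable
  have Fb: "\<And>y. \<bar>F (x + y)\<bar> \<le> B" using F by auto
  have bd: "integrable \<nu> (\<lambda>z. \<integral>y. F (x + z + y) \<partial>\<kappa>)" if "prob_borel \<nu>" "prob_borel \<kappa>" for \<nu> \<kappa>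
  proof -
    interpret n: prob_borel \<nu> by fact
    interpret k: prob_borel \<kappa> by fact
    show ?thesis
      by (rule n.integrable_bounded[of _ B]) (auto intro!: k.integral_abs_le F)
  qed
  have 1: "(\<integral>y. F (x + y) \<partial>a (Suc n)) = (\<integral>z. \<integral>y. F (x + z + y) \<partial>a n \<partial>\<alpha>)"
    unfolding aS by (subst integral_shift_commute(2)[OF \<alpha> a Fx Fb]) (simp add: add.assoc)
  have 2: "(\<integral>y. F (x + y) \<partial>b (Suc n)) = (\<integral>z. \<integral>y. F (x + z + y) \<partial>b n \<partial>\<beta>)"
    unfolding bS by (subst integral_shift_commute(2)[OF \<beta> b Fx Fb]) (simp add: add.assoc)
  have 3: "(\<integral>z. \<integral>y. F (x + z + y) \<partial>a n \<partial>\<nu>) = (\<integral>z. \<integral>y. F (x + z + y) \<partial>\<nu> \<partial>a n)" if "prob_borel \<nu>" for \<nu>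
    using integral_shift_commute(1)[OF that a Fx Fb] by (simp add: add.assoc)
  \<comment> \<open>Telescoping: first \<alpha> is exchanged for \<beta> while the remaining factors
    are \<open>a n\<close>, then \<open>a n\<close> is exchanged for \<open>b n\<close> under a
    fixed \<beta>. Each shift is an average of bounded functions, so the sup bounds
    \<open>\<epsilon>\<close> and \<open>n * \<epsilon>\<close> survive.\<close>
  have "(\<integral>y. F (x + y) \<partial>a (Suc n)) - (\<integral>y. F (x + y) \<partial>b (Suc n))
    = ((\<integral>z. \<integral>y. F (x + z + y) \<partial>\<alpha> \<partial>a n) - (\<integral>z. \<integral>y. F (x + z + y) \<partial>\<beta> \<partial>a n))
      + ((\<integral>z. \<integral>y. F (x + z + y) \<partial>a n \<partial>\<beta>) - (\<integral>z. \<integral>y. F (x + z + y) \<partial>b n \<partial>\<beta>))"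
    unfolding 1 2 3[OF \<alpha>] 3[OF \<beta>] by simp
  also have "\<dots> = (\<integral>z. D (x + z) \<partial>a n) + (\<integral>z. G (x + z) \<partial>\<beta>)"
    unfolding D_def G_def
    by (subst (1 2) Bochner_Integration.integral_diff) (auto intro!: bd \<alpha> \<beta> a b)
  finally have "\<bar>(\<integral>y. F (x + y) \<partial>a (Suc n)) - (\<integral>y. F (x + y) \<partial>b (Suc n))\<bar>
      \<le> \<bar>\<integral>z. D (x + z) \<partial>a n\<bar> + \<bar>\<integral>z. G (x + z) \<partial>\<beta>\<bar>" by simp
  also have "\<dots> \<le> \<epsilon> + n * \<epsilon>"
    by (intro add_mono a.integral_abs_le \<beta>.integral_abs_le)
       (use eps Suc.IH in \<open>auto simp: D_def G_def\<close>)
  finally show ?case by (simp add: algebra_simps)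
qed (simp add: ab0)

text \<open>Three kinds of sequences are placed in this locale: the standardized logarithms of the
  means, their negatives (which turn limsup into liminf), and the Gaussian sequence used for
  comparison.\<close>

locale standardized_iid = prob_space M for M :: "'a measure" +
  fixes Y :: "nat \<Rightarrow> 'a \<Rightarrow> real" and \<delta> :: real
  assumes indep: "indep_vars (\<lambda>_. borel) Y UNIV"
    and ident: "\<And>n. distr M borel (Y n) = distr M borel (Y 0)"
    and mean_zero: "expectation (Y 0) = 0"
    and square_integrable: "integrable M (\<lambda>\<omega>. (Y 0 \<omega>)\<^sup>2)"
    and variance_one: "expectation (\<lambda>\<omega>. (Y 0 \<omega>)\<^sup>2) = 1"
    and moment: "integrable M (\<lambda>\<omega>. \<bar>Y 0 \<omega>\<bar> powr (2 + \<delta>))"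
    and \<delta>: "0 < \<delta>" "\<delta> \<le> 1"
begin

lemma rv [measurable]: "Y n \<in> borel_measurable M"
  using indep by (auto simp: indep_vars_def)

lemma integrable_Y: "integrable M (Y 0)"
  using square_integrable by (rule square_integrable_imp_integrable[rotated]) simp

definition S :: "nat \<Rightarrow> 'a \<Rightarrow> real" where "S n \<omega> = (\<Sum>i<n. Y i \<omega>)"

lemma S_measurable [measurable]: "S n \<in> borel_measurable M"
  unfolding S_def by measurable

lemma prob_borel_distr: "f \<in> borel_measurable M \<Longrightarrow> prob_borel (distr M borel f)"
  by (auto simp: prob_borel_def prob_borel_axioms_def intro!: prob_space_distr)

lemma distr_S_Suc: "distr M borel (S (Suc n)) = (distr M borel (Y 0) \<star> distr M borel (S n))"
proof -
  have "indep_var borel (Y n) borel (\<lambda>\<omega>. \<Sum>i<n. Y i \<omega>)"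
    by (rule indep_vars_sum) (auto intro: indep_vars_subset[OF indep])
  then have "distr M borel (\<lambda>x. Y n x + (\<Sum>i<n. Y i x))
    = (distr M borel (Y n) \<star> distr M borel (\<lambda>\<omega>. \<Sum>i<n. Y i \<omega>))"
    by (rule sum_indep_random_variable) auto
  then show ?thesis by (simp add: S_def[abs_def] ident[of n] add.commute)
qed

text \<open>Mean 0 and variance 1 make the expansion up to second order the same for every law in
  the locale. In a comparison of two such laws \<open>f u + h u / (2 * s\<^sup>2)\<close> cancels
  and only the remainders are left.\<close>

lemma taylor_expectation:
  fixes f g h :: "real \<Rightarrow> real"
  assumes "\<And>x. (f has_real_derivative g x) (at x)" "\<And>x. (g has_real_derivative h x) (at x)"
    and "\<And>x y. \<bar>h x - h y\<bar> \<le> 3 * \<bar>x - y\<bar>" "\<And>x. \<bar>h x\<bar> \<le> 1"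
    and f: "\<And>x. 0 \<le> f x" "\<And>x. f x \<le> 1" and s: "s > 0"
  shows "\<bar>(\<integral>y. f (u + y / s) \<partial>distr M borel (Y 0)) - f u - h u / (2 * s\<^sup>2)\<bar>
     \<le> 3 * expectation (\<lambda>\<omega>. \<bar>Y 0 \<omega>\<bar> powr (2 + \<delta>)) * s powr - (2 + \<delta>)"
proof -
  have [measurable]: "f \<in> borel_measurable borel"
    by (intro borel_measurable_continuous_onI DERIV_continuous_on[where D = g])
       (auto intro: assms(1) DERIV_subset)
  have I: "integrable M (\<lambda>\<omega>. f (u + Y 0 \<omega> / s))"
    by (rule integrable_const_bound[of _ 1]) (use f in auto)
  have E: "(\<integral>y. f (u + y / s) \<partial>distr M borel (Y 0)) = expectation (\<lambda>\<omega>. f (u + Y 0 \<omega> / s))"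
    by (subst integral_distr) auto
  let ?R = "\<lambda>\<omega>. f (u + Y 0 \<omega> / s) - f u - g u / s * Y 0 \<omega> - h u / (2 * s\<^sup>2) * (Y 0 \<omega>)\<^sup>2"
  have R: "integrable M ?R" using I integrable_Y square_integrable by auto
  have "expectation ?R = expectation (\<lambda>\<omega>. f (u + Y 0 \<omega> / s)) - f u - h u / (2 * s\<^sup>2)"
    using I integrable_Y square_integrable by (simp add: mean_zero variance_one prob_space)
  moreover have "\<bar>expectation ?R\<bar> \<le> expectation (\<lambda>\<omega>. 3 * s powr - (2 + \<delta>) * \<bar>Y 0 \<omega>\<bar> powr (2 + \<delta>))"
  proof (rule order_trans[OF integral_abs_bound integral_mono])
    fix \<omega>
    have "\<bar>?R \<omega>\<bar> \<le> 3 * \<bar>Y 0 \<omega> / s\<bar> powr (2 + \<delta>)"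
      using second_order_taylor_bound[OF assms(1-4) \<delta>, of u "Y 0 \<omega> / s"] by (simp add: power_divide)
    also have "\<dots> = 3 * s powr - (2 + \<delta>) * \<bar>Y 0 \<omega>\<bar> powr (2 + \<delta>)"
      unfolding powr_minus using s by (simp add: abs_divide powr_divide field_simps)
    finally show "\<bar>?R \<omega>\<bar> \<le> 3 * s powr - (2 + \<delta>) * \<bar>Y 0 \<omega>\<bar> powr (2 + \<delta>)" .
  qed (use R moment in auto)
  ultimately show ?thesis unfolding E by (simp add: ac_simps)
qed

end

text \<open>One replacement costs \<open>K * sqrt n powr - (2 + \<delta>)\<close> and there are
  \<open>n\<close> of them, which gives the rate. The constant depends on the two moments alone;
  uniformity in \<open>u\<close> is what later admits levels that grow with
  \<open>n\<close>.\<close>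

lemma standardized_iid_comparison:
  assumes "standardized_iid M Y \<delta>" "standardized_iid M' Y' \<delta>"
  obtains C where "\<And>f g h u n. (\<And>x. (f has_real_derivative g x) (at x)) \<Longrightarrow>
    (\<And>x. (g has_real_derivative h x) (at x)) \<Longrightarrow> (\<And>x y. \<bar>h x - h y\<bar> \<le> 3 * \<bar>x - y\<bar>) \<Longrightarrow> (\<And>x. \<bar>h x\<bar> \<le> 1)
    \<Longrightarrow> (\<And>x. 0 \<le> f x) \<Longrightarrow> (\<And>x. f x \<le> 1) \<Longrightarrow> n \<ge> 1 \<Longrightarrow>
    \<bar>(\<integral>\<omega>. f (u + standardized_iid.S Y n \<omega> / sqrt n) \<partial>M) - (\<integral>\<omega>. f (u + standardized_iid.S Y' n \<omega> / sqrt n) \<partial>M')\<bar>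
    \<le> C * real n powr (- \<delta> / 2)"
proof -
  interpret Y: standardized_iid M Y \<delta> by fact
  interpret Y': standardized_iid M' Y' \<delta> by fact
  define K where "K = 3 * (Y.expectation (\<lambda>\<omega>. \<bar>Y 0 \<omega>\<bar> powr (2 + \<delta>)) + Y'.expectation (\<lambda>\<omega>. \<bar>Y' 0 \<omega>\<bar> powr (2 + \<delta>)))"
  have "\<bar>(\<integral>\<omega>. f (u + Y.S n \<omega> / sqrt n) \<partial>M) - (\<integral>\<omega>. f (u + Y'.S n \<omega> / sqrt n) \<partial>M')\<bar>
      \<le> K * real n powr (- \<delta> / 2)"
    if H: "\<And>x. (f has_real_derivative g x) (at x)"
      "\<And>x. (g has_real_derivative h x) (at x)" "\<And>x y. \<bar>h x - h y\<bar> \<le> 3 * \<bar>x - y\<bar>" "\<And>x. \<bar>h x\<bar> \<le> 1"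
      "\<And>x. 0 \<le> f x" "\<And>x. f x \<le> 1" and n: "n \<ge> 1" for f g h :: "real \<Rightarrow> real" and u and n :: nat
  proof -
    have [measurable]: "f \<in> borel_measurable borel"
      by (intro borel_measurable_continuous_onI DERIV_continuous_on[where D = g])
         (auto intro: H(1) DERIV_subset)
    define F where "F y = f (u + y / sqrt n)" for y
    have [measurable]: "F \<in> borel_measurable borel" unfolding F_def by measurable
    have s: "sqrt n > 0" using n by simp
    have "\<bar>(\<integral>y. F (x + y) \<partial>distr M borel (Y 0)) - (\<integral>y. F (x + y) \<partial>distr M' borel (Y' 0))\<bar>
        \<le> K * sqrt n powr - (2 + \<delta>)" for x
      using Y.taylor_expectation[OF H s, of "u + x / sqrt n"] Y'.taylor_expectation[OF H s, of "u + x / sqrt n"]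
      unfolding K_def F_def by (simp add: add_divide_distrib add.assoc algebra_simps)
    then have "\<bar>(\<integral>y. F (0 + y) \<partial>distr M borel (Y.S n)) - (\<integral>y. F (0 + y) \<partial>distr M' borel (Y'.S n))\<bar>
        \<le> n * (K * sqrt n powr - (2 + \<delta>))"
      by (intro trotter_comparison[where \<alpha> = "distr M borel (Y 0)" and \<beta> = "distr M' borel (Y' 0)" and B = 1]
            Y.prob_borel_distr Y'.prob_borel_distr Y.distr_S_Suc Y'.distr_S_Suc)
         (use H(5,6) in \<open>auto simp: F_def Y.S_def[abs_def] Y'.S_def[abs_def] Y.distr_const Y'.distr_const\<close>)
    also have "n * (K * sqrt n powr - (2 + \<delta>)) = K * (real n powr 1 * real n powr (- (2 + \<delta>) / 2))"
      using n by (simp add: powr_half_sqrt[symmetric] powr_powr)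
    also have "\<dots> = K * real n powr (- \<delta> / 2)"
      using n unfolding powr_add[symmetric] by (simp add: field_simps)
    finally show ?thesis
      by (subst (asm) (1 2) integral_distr) (auto simp: F_def)
  qed
  then show thesis using that by blast
qed

section \<open>Normal tails and the Gaussian comparison sequence\<close>

abbreviation std_normal :: "real measure" where "std_normal \<equiv> density lborel std_normal_density"

lemma prob_space_std_normal: "prob_space std_normal"
  by (rule prob_space_normal_density) simp

text \<open>After a shift of the variable by \<open>x\<close>, the inequality
  \<open>(x + t)\<^sup>2 \<ge> x\<^sup>2 + t\<^sup>2\<close> for nonnegative \<open>x\<close> and
  \<open>t\<close> splits off the exponential factor and leaves at most the total mass of the
  density.\<close>

lemma std_normal_tail_le:
  assumes "x \<ge> 0"
  shows "measure std_normal {x..} \<le> exp (- x\<^sup>2 / 2)"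
proof -
  have "emeasure std_normal {x..} = (\<integral>\<^sup>+t. ennreal (std_normal_density t) * indicator {x..} t \<partial>lborel)"
    by (simp add: emeasure_density)
  also have "\<dots> = (\<integral>\<^sup>+t. ennreal (std_normal_density (x + t)) * indicator {x..} (x + t) \<partial>lborel)"
    by (subst nn_integral_real_affine[where c = 1 and t = x]) auto
  also have "\<dots> \<le> (\<integral>\<^sup>+t. ennreal (exp (- x\<^sup>2 / 2)) * ennreal (std_normal_density t) \<partial>lborel)"
  proof (rule nn_integral_mono)
    fix t :: real
    have "std_normal_density (x + t) \<le> exp (- x\<^sup>2 / 2) * std_normal_density t" if "t \<ge> 0"
    proof -
      have "exp (- (x + t)\<^sup>2 / 2) \<le> exp (- x\<^sup>2 / 2) * exp (- t\<^sup>2 / 2)"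
        unfolding exp_add[symmetric] using assms that by (simp add: power2_eq_square field_simps)
      then have "1 / sqrt (2 * pi) * exp (- (x + t)\<^sup>2 / 2) \<le> 1 / sqrt (2 * pi) * (exp (- x\<^sup>2 / 2) * exp (- t\<^sup>2 / 2))"
        by (rule mult_left_mono) auto
      then show ?thesis by (simp add: std_normal_density_def ac_simps)
    qed
    then show "ennreal (std_normal_density (x + t)) * indicator {x..} (x + t)
        \<le> ennreal (exp (- x\<^sup>2 / 2)) * ennreal (std_normal_density t)"
      by (auto simp: indicator_def ennreal_mult'[symmetric])
  qed
  also have "\<dots> = ennreal (exp (- x\<^sup>2 / 2))"
    by (subst nn_integral_cmult) (auto simp: nn_integral_eq_integral)
  finally show ?thesis
    unfolding measure_def by (simp add: enn2real_leI)
qed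

text \<open>The mass of the unit interval starting at \<open>x\<close>, with the density bounded
  below by its value at the right end. The loss \<open>x + 1\<close> for \<open>x\<close> is one
  more bounded shift.\<close>

lemma std_normal_tail_ge:
  assumes "x \<ge> 0"
  shows "exp (- (x + 1)\<^sup>2 / 2) / sqrt (2 * pi) \<le> measure std_normal {x..}"
proof -
  interpret N: prob_space std_normal by (rule prob_space_std_normal)
  have "ennreal (exp (- (x + 1)\<^sup>2 / 2) / sqrt (2 * pi))
      = (\<integral>\<^sup>+t. ennreal (exp (- (x + 1)\<^sup>2 / 2) / sqrt (2 * pi)) * indicator {x..x+1} t \<partial>lborel)"
    by (subst nn_integral_cmult_indicator) auto
  also have "\<dots> \<le> (\<integral>\<^sup>+t. ennreal (std_normal_density t) * indicator {x..} t \<partial>lborel)"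
  proof (rule nn_integral_mono)
    fix t :: real
    have "exp (- (x + 1)\<^sup>2 / 2) / sqrt (2 * pi) \<le> std_normal_density t" if "x \<le> t" "t \<le> x + 1"
    proof -
      have "t\<^sup>2 \<le> (x+1)\<^sup>2" using assms that by (intro power_mono) auto
      then show ?thesis by (simp add: std_normal_density_def divide_right_mono)
    qed
    then show "ennreal (exp (- (x + 1)\<^sup>2 / 2) / sqrt (2 * pi)) * indicator {x..x+1} t
        \<le> ennreal (std_normal_density t) * indicator {x..} t"
      by (auto simp: indicator_def)
  qed
  also have "\<dots> = emeasure std_normal {x..}"
    by (simp add: emeasure_density)
  also have "\<dots> = ennreal (measure std_normal {x..})"
    by (rule N.emeasure_eq_measure)
  finally show ?thesis by simp
qed

definition normal_seq :: "(nat \<Rightarrow> real) measure" where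
  "normal_seq = (\<Pi>\<^sub>M i\<in>UNIV. std_normal)"

lemma standardized_iid_normal_seq:
  assumes \<delta>: "0 < \<delta>" "\<delta> \<le> 1"
  shows "standardized_iid normal_seq (\<lambda>n \<omega>. \<omega> n) \<delta>"
    and "distr normal_seq borel (\<lambda>\<omega>. \<omega> n) = std_normal"
proof -
  interpret N: prob_space std_normal by (rule prob_space_std_normal)
  interpret P: product_prob_space "\<lambda>_. std_normal" "UNIV :: nat set"
    by unfold_locales
  have powr_measurable: "(\<lambda>x::real. \<bar>x\<bar> powr (2 + \<delta>)) \<in> borel_measurable borel" by measurable
  have ps: "prob_space normal_seq" unfolding normal_seq_def by (rule P.P.prob_space_axioms)
  interpret prob_space normal_seq by (rule ps)
  have rv [measurable]: "(\<lambda>\<omega>. \<omega> n) \<in> borel_measurable normal_seq" for n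
    unfolding normal_seq_def by (rule measurable_component_singleton[where M = "\<lambda>_. std_normal", simplified]) auto
  have d: "distr normal_seq borel (\<lambda>\<omega>. \<omega> n) = std_normal" for n
    using P.PiM_component[of n] unfolding normal_seq_def
    by (metis (no_types, lifting) UNIV_I distr_cong sets_density sets_lborel)
  then show "distr normal_seq borel (\<lambda>\<omega>. \<omega> n) = std_normal" for n .
  have ex: "expectation (\<lambda>\<omega>. F (\<omega> 0)) = (\<integral>x. std_normal_density x * F x \<partial>lborel)"
    and it: "integrable normal_seq (\<lambda>\<omega>. F (\<omega> 0)) \<longleftrightarrow> integrable lborel (\<lambda>x. std_normal_density x * F x)"
    if [measurable]: "F \<in> borel_measurable borel" for F :: "real \<Rightarrow> real"
  proof -
    have "expectation (\<lambda>\<omega>. F (\<omega> 0)) = (\<integral>x. F x \<partial>distr normal_seq borel (\<lambda>\<omega>. \<omega> 0))"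
      by (subst integral_distr) auto
    then show "expectation (\<lambda>\<omega>. F (\<omega> 0)) = (\<integral>x. std_normal_density x * F x \<partial>lborel)"
      unfolding d by (simp add: integral_real_density)
    have "integrable normal_seq (\<lambda>\<omega>. F (\<omega> 0)) \<longleftrightarrow> integrable (distr normal_seq borel (\<lambda>\<omega>. \<omega> 0)) F"
      by (subst integrable_distr_eq) auto
    then show "integrable normal_seq (\<lambda>\<omega>. F (\<omega> 0)) \<longleftrightarrow> integrable lborel (\<lambda>x. std_normal_density x * F x)"
      unfolding d by (simp add: integrable_real_density)
  qed
  show "standardized_iid normal_seq (\<lambda>n \<omega>. \<omega> n) \<delta>"
  proof
    have "distr normal_seq (\<Pi>\<^sub>M i\<in>UNIV. borel) (\<lambda>x. \<lambda>i\<in>UNIV. x i) = normal_seq"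
      unfolding restrict_UNIV by (rule distr_id2) (auto simp: normal_seq_def intro!: sets_PiM_cong)
    also have "normal_seq = (\<Pi>\<^sub>M i\<in>UNIV. distr normal_seq borel (\<lambda>\<omega>. \<omega> i))"
      unfolding d by (rule normal_seq_def)
    finally show "indep_vars (\<lambda>_. borel) (\<lambda>n \<omega>. \<omega> n) UNIV"
      by (subst indep_vars_iff_distr_eq_PiM) (simp_all add: rv)
    show "expectation (\<lambda>\<omega>. \<omega> 0) = 0"
      using ex[of "\<lambda>x. x"] integral_std_normal_moment_odd[of 0] by simp
    show "expectation (\<lambda>\<omega>. (\<omega> 0)\<^sup>2) = 1"
      using ex[of "\<lambda>x. x^2"] integral_std_normal_moment_even[of 1] by simp
    show "integrable normal_seq (\<lambda>\<omega>. (\<omega> 0)\<^sup>2)"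
      using it[of "\<lambda>x. x^2"] integrable_std_normal_moment[of 2] by simp
    have "integrable lborel (\<lambda>x. std_normal_density x * \<bar>x\<bar> powr (2 + \<delta>))"
    proof (rule Bochner_Integration.integrable_bound)
      show "integrable lborel (\<lambda>x. std_normal_density x * \<bar>x\<bar>^2 + std_normal_density x * \<bar>x\<bar>^3)"
        by (intro Bochner_Integration.integrable_add integrable_std_normal_moment_abs)
      have "\<bar>x\<bar> powr (2 + \<delta>) \<le> \<bar>x\<bar>^2 + \<bar>x\<bar>^3" for x :: real
      proof (cases "x = 0")
        case False
        have "\<bar>x\<bar> powr (2 + \<delta>) \<le> \<bar>x\<bar> powr 2 + \<bar>x\<bar> powr 3"
        proof (cases "\<bar>x\<bar> \<le> 1")
          case True
          then have "\<bar>x\<bar> powr (2 + \<delta>) \<le> \<bar>x\<bar> powr 2" using \<delta> by (intro powr_mono') auto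
          then show ?thesis by (simp add: add_increasing2)
        next
          case False
          then have "\<bar>x\<bar> powr (2 + \<delta>) \<le> \<bar>x\<bar> powr 3" using \<delta> by (intro powr_mono) auto
          then show ?thesis by (simp add: add_increasing)
        qed
        then show ?thesis using False by simp
      qed simp
      then have "std_normal_density x * \<bar>x\<bar> powr (2 + \<delta>) \<le> std_normal_density x * (\<bar>x\<bar>^2 + \<bar>x\<bar>^3)" for x
        by (intro mult_left_mono) auto
      then show "AE x in lborel. norm (std_normal_density x * \<bar>x\<bar> powr (2 + \<delta>))
          \<le> norm (std_normal_density x * \<bar>x\<bar>^2 + std_normal_density x * \<bar>x\<bar>^3)"
        by (simp add: distrib_left abs_mult)
    qed (use powr_measurable in simp)
    then show "integrable normal_seq (\<lambda>\<omega>. \<bar>\<omega> 0\<bar> powr (2 + \<delta>))"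
      using it[OF powr_measurable] by simp
  qed (use \<delta> d in auto)
qed

lemma normal_seq_tail:
  assumes n: "n \<ge> 1"
  shows "measure normal_seq {\<omega> \<in> space normal_seq. x * sqrt n \<le> (\<Sum>i<n. \<omega> i)} = measure std_normal {x..}"
proof -
  \<comment> \<open>The exponent 1 is an arbitrary admissible choice; it only gives access to
    independence and measurability of the coordinates.\<close>
  interpret standardized_iid normal_seq "\<lambda>n \<omega>. \<omega> n" 1
    by (rule standardized_iid_normal_seq) auto
  note d = standardized_iid_normal_seq(2)[of 1, simplified]
  have "distributed normal_seq lborel (\<lambda>\<omega>. \<omega> i) std_normal_density" for i
    unfolding distributed_def using d[of i] rv[of i] by (auto cong: distr_cong)
  then have "distributed normal_seq lborel (\<lambda>\<omega>. \<Sum>i<n. \<omega> i) (normal_density (\<Sum>i<n. 0) (sqrt (\<Sum>i<n. 1\<^sup>2)))"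
    using n by (intro sum_indep_normal indep_vars_subset[OF indep]) (auto simp: lessThan_empty_iff)
  then have "distributed normal_seq lborel (\<lambda>\<omega>. \<Sum>i<n. \<omega> i) (normal_density 0 (sqrt n))"
    by simp
  from normal_density_affine[OF this, of "1 / sqrt n" 0]
  have D: "distributed normal_seq lborel (\<lambda>\<omega>. (\<Sum>i<n. \<omega> i) / sqrt n) std_normal_density"
    using n by simp
  then have "measure std_normal {x..} = measure (distr normal_seq lborel (\<lambda>\<omega>. (\<Sum>i<n. \<omega> i) / sqrt n)) {x..}"
    by (simp add: distributed_distr_eq_density)
  also have "\<dots> = prob {\<omega> \<in> space normal_seq. x * sqrt n \<le> (\<Sum>i<n. \<omega> i)}"
    using n distributed_measurable[OF D]
    by (subst measure_distr) (auto intro!: arg_cong[where f = prob] simp: pos_le_divide_eq)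
  finally show ?thesis by simp
qed

section \<open>Tails of normalized sums against normal tails\<close>

context standardized_iid
begin

text \<open>The step function \<open>f\<close> sandwiches the indicator: \<open>f (y - x)\<close> is
  at most the indicator of \<open>x \<le> y\<close>, which is at most \<open>f (y - x + 4)\<close>.
  Passing from indicator to \<open>f\<close>, from \<open>S\<close> to the Gaussian sum, and back to
  an indicator moves the level by 4 in all.\<close>

lemma tail_normal_comparison:
  shows "\<exists>C. \<forall>n\<ge>1. \<forall>x. prob {\<omega> \<in> space M. x * sqrt n \<le> S n \<omega>}
      \<le> measure std_normal {x - 4..} + C * real n powr (- \<delta> / 2)
    \<and> measure std_normal {x + 4..} - C * real n powr (- \<delta> / 2)
      \<le> prob {\<omega> \<in> space M. x * sqrt n \<le> S n \<omega>}"
proof -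
  interpret N: standardized_iid normal_seq "\<lambda>n \<omega>. \<omega> n" \<delta>
    by (rule standardized_iid_normal_seq) (use \<delta> in auto)
  obtain f g h where H: "\<And>x. (f has_real_derivative g x) (at x)" "\<And>x. (g has_real_derivative h x) (at x)"
    "\<And>x y. \<bar>h x - h y\<bar> \<le> 3 * \<bar>x - y\<bar>" "\<And>x. \<bar>h x\<bar> \<le> 1"
    "\<And>x. 0 \<le> f x" "\<And>x. f x \<le> 1" and f: "\<And>x. x \<le> 0 \<Longrightarrow> f x = 0" "\<And>x. x \<ge> 4 \<Longrightarrow> f x = 1"
    using smooth_step_exists by blast
  have [measurable]: "f \<in> borel_measurable borel"
    by (intro borel_measurable_continuous_onI DERIV_continuous_on[where D = g])
       (auto intro: H(1) DERIV_subset)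
  obtain C where C: "\<And>u n. n \<ge> 1 \<Longrightarrow>
    \<bar>(\<integral>\<omega>. f (u + S n \<omega> / sqrt n) \<partial>M) - (\<integral>\<omega>. f (u + N.S n \<omega> / sqrt n) \<partial>normal_seq)\<bar>
    \<le> C * real n powr (- \<delta> / 2)"
    using standardized_iid_comparison[OF standardized_iid_axioms N.standardized_iid_axioms] H by metis
  have up: "(\<integral>\<omega>. f (- x + X \<omega> / sqrt n) \<partial>L) \<le> measure L {\<omega> \<in> space L. x * sqrt n \<le> X \<omega>}"
    and lo: "measure L {\<omega> \<in> space L. x * sqrt n \<le> X \<omega>} \<le> (\<integral>\<omega>. f (4 - x + X \<omega> / sqrt n) \<partial>L)"
    if n: "n \<ge> 1" and "prob_space L" and [measurable]: "X \<in> borel_measurable L"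
    for L :: "'z measure" and X and n :: nat and x
  proof -
    interpret L: prob_space L by fact
    have I: "integrable L (\<lambda>\<omega>. f (u + X \<omega> / sqrt n))" for u
      by (rule L.integrable_const_bound[of _ 1]) (use H in auto)
    have J: "integrable L (indicat_real {\<omega> \<in> space L. x * sqrt n \<le> X \<omega>})"
      by (rule L.integrable_const_bound[of _ 1]) auto
    have E: "measure L {\<omega> \<in> space L. x * sqrt n \<le> X \<omega>}
        = (\<integral>\<omega>. indicat_real {\<omega> \<in> space L. x * sqrt n \<le> X \<omega>} \<omega> \<partial>L)" by simp
    have s: "x * sqrt n \<le> X \<omega> \<longleftrightarrow> x \<le> X \<omega> / sqrt n" for \<omega>
      using n by (simp add: pos_le_divide_eq)
    show "(\<integral>\<omega>. f (- x + X \<omega> / sqrt n) \<partial>L) \<le> measure L {\<omega> \<in> space L. x * sqrt n \<le> X \<omega>}"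
      unfolding E by (rule integral_mono[OF I J]) (use H f in \<open>auto simp: indicator_def s\<close>)
    show "measure L {\<omega> \<in> space L. x * sqrt n \<le> X \<omega>} \<le> (\<integral>\<omega>. f (4 - x + X \<omega> / sqrt n) \<partial>L)"
      unfolding E by (rule integral_mono[OF J I]) (use H f in \<open>auto simp: indicator_def s\<close>)
  qed
  have N: "measure normal_seq {\<omega> \<in> space normal_seq. x * sqrt n \<le> N.S n \<omega>} = measure std_normal {x..}"
    if "n \<ge> 1" for n x
    using normal_seq_tail[OF that] by (simp add: N.S_def)
  show ?thesis
  proof (intro exI allI impI conjI)
    fix n :: nat and x :: real assume n: "n \<ge> 1"
    show "prob {\<omega> \<in> space M. x * sqrt n \<le> S n \<omega>}
      \<le> measure std_normal {x - 4..} + C * real n powr (- \<delta> / 2)"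
      using lo[OF n prob_space_axioms S_measurable, of x n] C[OF n, of "4 - x"]
        up[OF n N.prob_space_axioms N.S_measurable, of "x - 4" n] N[OF n, of "x - 4"]
      by (simp add: abs_le_iff)
    show "measure std_normal {x + 4..} - C * real n powr (- \<delta> / 2)
      \<le> prob {\<omega> \<in> space M. x * sqrt n \<le> S n \<omega>}"
      using up[OF n prob_space_axioms S_measurable, of x n] C[OF n, of "- x"]
        lo[OF n N.prob_space_axioms N.S_measurable, of "x + 4" n] N[OF n, of "x + 4"]
      by (simp add: abs_le_iff)
  qed
qed

end

section \<open>The law of the iterated logarithm\<close>

text \<open>By independence and \<open>1 - p \<le> exp (- p)\<close>, the probability that none of
  the events numbered \<open>N\<close> to \<open>N + m - 1\<close> occurs is at most the exponential
  of minus a partial sum, and divergence makes these partial sums unbounded.\<close>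

lemma (in prob_space) indep_borel_cantelli:
  fixes D :: "nat \<Rightarrow> 'a \<Rightarrow> real"
  assumes ind: "indep_vars (\<lambda>_. borel) D UNIV"
    and ns: "\<not> summable (\<lambda>k. prob {\<omega> \<in> space M. t k \<le> D k \<omega>})"
  shows "AE \<omega> in M. \<exists>\<^sub>F k in sequentially. t k \<le> D k \<omega>"
proof -
  have [measurable]: "D k \<in> borel_measurable M" for k using ind by (auto simp: indep_vars_def)
  define p where "p k = prob {\<omega> \<in> space M. t k \<le> D k \<omega>}" for k
  have compl: "prob (D k -` {..<t k} \<inter> space M) = 1 - p k" for k
  proof -
    have "prob (space M - {\<omega> \<in> space M. t k \<le> D k \<omega>}) = 1 - p k"
      unfolding p_def by (rule prob_compl) measurable
    also have "space M - {\<omega> \<in> space M. t k \<le> D k \<omega>} = D k -` {..<t k} \<inter> space M" by auto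
    finally show ?thesis .
  qed
  have null: "AE \<omega> in M. \<not> (\<forall>k\<ge>N. D k \<omega> < t k)" for N
  proof -
    let ?A = "{\<omega> \<in> space M. \<forall>k\<ge>N. D k \<omega> < t k}"
    have le: "prob ?A \<le> exp (- (\<Sum>k=N..<N+m. p k))" if "m > 0" for m
    proof -
      have "prob ?A \<le> prob (\<Inter>k\<in>{N..<N+m}. D k -` {..<t k} \<inter> space M)"
        using that by (intro finite_measure_mono) auto
      also have "\<dots> = (\<Prod>k=N..<N+m. prob (D k -` {..<t k} \<inter> space M))"
        using that by (intro indep_varsD[OF ind]) auto
      also have "\<dots> = (\<Prod>k=N..<N+m. 1 - p k)" by (simp add: compl)
      also have "\<dots> \<le> (\<Prod>k=N..<N+m. exp (- p k))"
        by (intro prod_mono) (use exp_ge_add_one_self[of "- p _"] in \<open>auto simp: p_def\<close>)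
      also have "\<dots> = exp (- (\<Sum>k=N..<N+m. p k))"
        by (simp add: exp_sum sum_negf[symmetric])
      finally show ?thesis .
    qed
    have ns': "\<not> summable (\<lambda>k. p (k + N))" using ns unfolding p_def[symmetric] by (subst summable_iff_shift)
    have "prob ?A \<le> e" if e: "e > 0" for e
    proof -
      \<comment> \<open>The sum is also made positive in order to get \<open>m > 0\<close>: the
        product formula for independent events asks for a nonempty index set.\<close>
      have "\<exists>m. (\<Sum>k<m. p (k + N)) > max (- ln e) 0"
      proof (rule ccontr)
        assume "\<not> ?thesis"
        then have "\<And>m. (\<Sum>k<m. p (k + N)) \<le> max (- ln e) 0" by (metis not_less)
        then have "summable (\<lambda>k. p (k + N))"
          by (intro bounded_imp_summable[of _ "max (- ln e) 0"]) (simp_all only: p_def measure_nonneg lessThan_Suc_atMost[symmetric])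
        with ns' show False by simp
      qed
      then obtain m where m: "(\<Sum>k<m. p (k + N)) > - ln e" "(\<Sum>k<m. p (k + N)) > 0" by auto
      then have "m > 0" by (cases m) auto
      have "(\<Sum>k=N..<N+m. p k) = (\<Sum>k<m. p (k + N))"
        using sum.shift_bounds_nat_ivl[of p 0 N m] by (simp add: lessThan_atLeast0 add.commute)
      then have "prob ?A \<le> exp (ln e)" using le[OF \<open>m > 0\<close>] m(1) by (smt (verit) exp_le_cancel_iff)
      then show ?thesis using e by simp
    qed
    then have "prob ?A = 0" using field_le_epsilon[of "prob ?A" 0] by (simp add: measure_le_0_iff)
    then show ?thesis
      by (subst (asm) prob_eq_0) auto
  qed
  have "AE \<omega> in M. \<forall>N. \<not> (\<forall>k\<ge>N. D k \<omega> < t k)" using null by (simp add: AE_all_countable)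
  then show ?thesis by eventually_elim (auto simp: frequently_sequentially not_less)
qed

context standardized_iid
begin

lemma distr_increment: "distr M borel (\<lambda>\<omega>. S (j + m) \<omega> - S j \<omega>) = distr M borel (S m)"
proof -
  have eq: "S (j + m) \<omega> - S j \<omega> = (\<Sum>i=j..<j+m. Y i \<omega>)" for m \<omega>
    by (simp add: S_def lessThan_atLeast0 sum_diff_nat_ivl)
  have "distr M borel (\<lambda>\<omega>. \<Sum>i=j..<j+m. Y i \<omega>) = distr M borel (S m)"
  proof (induction m)
    case 0 show ?case by (simp add: S_def[abs_def])
  next
    case (Suc m)
    have "indep_var borel (Y (j+m)) borel (\<lambda>\<omega>. \<Sum>i=j..<j+m. Y i \<omega>)"
      by (rule indep_vars_sum) (auto intro: indep_vars_subset[OF indep])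
    then have "distr M borel (\<lambda>x. Y (j+m) x + (\<Sum>i=j..<j+m. Y i x))
      = (distr M borel (Y (j+m)) \<star> distr M borel (\<lambda>\<omega>. \<Sum>i=j..<j+m. Y i \<omega>))"
      by (rule sum_indep_random_variable) auto
    then show ?case unfolding distr_S_Suc by (simp add: ident[of "j+m"] Suc.IH add.commute)
  qed
  then show ?thesis by (simp add: eq[abs_def])
qed

lemma prob_increment:
  assumes "A \<in> sets borel"
  shows "prob {\<omega> \<in> space M. S (j + m) \<omega> - S j \<omega> \<in> A} = prob {\<omega> \<in> space M. S m \<omega> \<in> A}"
proof -
  have "measure (distr M borel (\<lambda>\<omega>. S (j + m) \<omega> - S j \<omega>)) A = measure (distr M borel (S m)) A"
    by (simp only: distr_increment)
  then show ?thesis using assms by (simp add: measure_distr vimage_def Int_def conj_commute)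
qed

lemma S_second_moment: "integrable M (\<lambda>\<omega>. (S n \<omega>)\<^sup>2) \<and> expectation (\<lambda>\<omega>. (S n \<omega>)\<^sup>2) = n \<and>
   integrable M (S n) \<and> expectation (S n) = 0"
proof (induction n)
  case 0 show ?case by (simp add: S_def[abs_def])
next
  case (Suc n)
  have tr: "integrable M (\<lambda>\<omega>. F (Y n \<omega>)) \<longleftrightarrow> integrable M (\<lambda>\<omega>. F (Y 0 \<omega>))"
    "expectation (\<lambda>\<omega>. F (Y n \<omega>)) = expectation (\<lambda>\<omega>. F (Y 0 \<omega>))"
    if [measurable]: "F \<in> borel_measurable borel" for F :: "real \<Rightarrow> real"
    using integrable_distr_eq[of "Y n" M borel F] integrable_distr_eq[of "Y 0" M borel F]
      integral_distr[of "Y n" M borel F] integral_distr[of "Y 0" M borel F] ident[of n] by auto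
  have Yn: "integrable M (Y n)" "expectation (Y n) = 0" "integrable M (\<lambda>\<omega>. (Y n \<omega>)\<^sup>2)"
    "expectation (\<lambda>\<omega>. (Y n \<omega>)\<^sup>2) = 1"
    using tr[of "\<lambda>x. x"] tr[of "\<lambda>x. x^2"] integrable_Y mean_zero square_integrable variance_one by auto
  have "indep_var borel (Y n) borel (S n)"
    unfolding S_def[abs_def] by (rule indep_vars_sum) (auto intro: indep_vars_subset[OF indep])
  note iv = indep_var_integrable[OF this] indep_var_lebesgue_integral[OF this]
  have e: "(S (Suc n) \<omega>)\<^sup>2 = (S n \<omega>)\<^sup>2 + 2 * (Y n \<omega> * S n \<omega>) + (Y n \<omega>)\<^sup>2" for \<omega>
    by (simp add: S_def power2_eq_square algebra_simps)
  have e1: "S (Suc n) \<omega> = S n \<omega> + Y n \<omega>" for \<omega> by (simp add: S_def)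
  show ?case
    unfolding e using Suc Yn iv by (auto simp: e1[abs_def])
qed

lemma prob_S_le_minus:
  assumes "t > 0"
  shows "prob {\<omega> \<in> space M. S n \<omega> \<le> - t} \<le> n / t\<^sup>2"
proof -
  have "prob {\<omega> \<in> space M. S n \<omega> \<le> - t} \<le> prob {\<omega> \<in> space M. t \<le> \<bar>S n \<omega> - expectation (S n)\<bar>}"
    using S_second_moment[of n] by (intro finite_measure_mono) auto
  also have "\<dots> \<le> variance (S n) / t\<^sup>2"
    by (rule Chebyshev_inequality) (use S_second_moment assms in auto)
  finally show ?thesis using S_second_moment[of n] by simp
qed

text \<open>Ottaviani's inequality, by decomposing according to the first passage above the level.\<close>

lemma maximal_inequality:
  assumes n: "n \<ge> 1"
  shows "prob {\<omega> \<in> space M. \<exists>j\<le>n. a + sqrt (2 * n) \<le> S j \<omega>} \<le> 2 * prob {\<omega> \<in> space M. a \<le> S n \<omega>}"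
proof -
  define c where "c = a + sqrt (2 * n)"
  define A where "A j = {\<omega> \<in> space M. c \<le> S j \<omega> \<and> (\<forall>i<j. S i \<omega> < c)}" for j
  \<comment> \<open>\<open>A j\<close> is first passage at time \<open>j\<close>; on
    \<open>B j\<close> the walk loses less than \<open>sqrt (2 * n)\<close> afterwards and so ends
    above \<open>a\<close>. The remaining increment has variance \<open>n - j\<close>, at most
    \<open>n\<close>, so Chebyshev gives \<open>B j\<close> probability at least 1/2. This is the
    origin of the shift and of the factor 2.\<close>
  define B where "B j = {\<omega> \<in> space M. - sqrt (2 * n) < S n \<omega> - S j \<omega>}" for j
  have [measurable]: "A j \<in> events" "B j \<in> events" for j
    unfolding A_def B_def by measurable
  have disj: "disjoint_family_on A {..n}"
    unfolding disjoint_family_on_def A_def by (auto simp: not_le) (metis linorder_neqE_nat not_le)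
  have un: "{\<omega> \<in> space M. \<exists>j\<le>n. c \<le> S j \<omega>} = (\<Union>j\<in>{..n}. A j)"
  proof (intro equalityI subsetI)
    fix \<omega> assume "\<omega> \<in> {\<omega> \<in> space M. \<exists>j\<le>n. c \<le> S j \<omega>}"
    then obtain j where j: "\<omega> \<in> space M" "j \<le> n" "c \<le> S j \<omega>" by auto
    define k where "k = (LEAST j. c \<le> S j \<omega>)"
    have "c \<le> S k \<omega>" "k \<le> j" "\<forall>i<k. \<not> c \<le> S i \<omega>"
      unfolding k_def using j LeastI[of "\<lambda>j. c \<le> S j \<omega>"] Least_le[of "\<lambda>j. c \<le> S j \<omega>" j]
      by (auto dest: not_less_Least)
    then show "\<omega> \<in> (\<Union>j\<in>{..n}. A j)" using j unfolding A_def by (auto simp: not_le)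
  qed (auto simp: A_def)
  have half: "1 / 2 \<le> prob (B j)" if "j \<le> n" for j
  proof -
    have "prob (space M - B j) = prob {\<omega> \<in> space M. S (j + (n - j)) \<omega> - S j \<omega> \<in> {..- sqrt (2 * n)}}"
      using that by (intro arg_cong[where f = prob]) (auto simp: B_def)
    also have "\<dots> \<le> real (n - j) / (sqrt (2 * n))\<^sup>2"
      using prob_S_le_minus[of "sqrt (2 * n)" "n - j"] n by (subst prob_increment) auto
    also have "\<dots> \<le> n / (2 * n)" using n by (simp add: divide_right_mono)
    also have "\<dots> = 1 / 2" using n by simp
    finally show ?thesis using prob_compl[of "B j"] by simp
  qed
  have ind: "prob (A j \<inter> B j) = prob (A j) * prob (B j)" if j: "j \<le> n" for j
  proof -
    let ?P = "\<lambda>I. Pi\<^sub>M I (\<lambda>_. borel :: real measure)"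
    \<comment> \<open>\<open>A j\<close> is determined by the steps before time \<open>j\<close> and
      \<open>B j\<close> by those from \<open>j\<close> on. Both are pulled back from product spaces
      over these disjoint index blocks.\<close>
    have iv: "indep_var (?P {..<j}) (\<lambda>\<omega>. restrict (\<lambda>i. Y i \<omega>) {..<j}) (?P {j..<n}) (\<lambda>\<omega>. restrict (\<lambda>i. Y i \<omega>) {j..<n})"
      by (rule indep_var_restrict[OF indep]) auto
    let ?A = "{y \<in> space (?P {..<j}). c \<le> (\<Sum>i<j. y i) \<and> (\<forall>k\<in>{..<j}. (\<Sum>i<k. y i) < c)}"
    let ?B = "{y \<in> space (?P {j..<n}). - sqrt (2 * n) < (\<Sum>i=j..<n. y i)}"
    have m: "(\<lambda>y. y i) \<in> borel_measurable (?P I)" if "i \<in> I" for i I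
      using measurable_component_singleton[OF that] .
    have s: "(\<lambda>y. \<Sum>i\<in>J. y i) \<in> borel_measurable (?P I)" if "J \<subseteq> I" for J I
      using that by (intro borel_measurable_sum m) auto
    have "?A \<in> sets (?P {..<j})"
      by (intro sets.sets_Collect_conj sets.sets_Collect_finite_All borel_measurable_le borel_measurable_less s
          borel_measurable_const) auto
    moreover have "?B \<in> sets (?P {j..<n})"
      by (intro borel_measurable_less s borel_measurable_const) auto
    ultimately have "prob ((\<lambda>\<omega>. restrict (\<lambda>i. Y i \<omega>) {..<j}) -` ?A \<inter> space M
         \<inter> ((\<lambda>\<omega>. restrict (\<lambda>i. Y i \<omega>) {j..<n}) -` ?B \<inter> space M))
      = prob ((\<lambda>\<omega>. restrict (\<lambda>i. Y i \<omega>) {..<j}) -` ?A \<inter> space M)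
        * prob ((\<lambda>\<omega>. restrict (\<lambda>i. Y i \<omega>) {j..<n}) -` ?B \<inter> space M)"
      using indep_varD[OF iv, of ?A ?B] by (simp add: vimage_Times Int_def vimage_def ac_simps)
    moreover have "(\<lambda>\<omega>. restrict (\<lambda>i. Y i \<omega>) {..<j}) -` ?A \<inter> space M = A j"
    proof -
      have "(\<Sum>i<k. restrict (\<lambda>i. Y i \<omega>) {..<j} i) = S k \<omega>" if "k \<le> j" for k \<omega>
        unfolding S_def using that by (intro sum.cong) auto
      then show ?thesis by (auto simp: A_def space_PiM)
    qed
    moreover have "(\<lambda>\<omega>. restrict (\<lambda>i. Y i \<omega>) {j..<n}) -` ?B \<inter> space M = B j"
    proof -
      have "(\<Sum>i=j..<n. restrict (\<lambda>i. Y i \<omega>) {j..<n} i) = S n \<omega> - S j \<omega>" for \<omega>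
      proof -
        have "(\<Sum>i=j..<n. restrict (\<lambda>i. Y i \<omega>) {j..<n} i) = (\<Sum>i=j..<n. Y i \<omega>)"
          by (intro sum.cong) auto
        then show ?thesis using j by (simp add: S_def lessThan_atLeast0 sum_diff_nat_ivl)
      qed
      then show ?thesis by (auto simp: B_def space_PiM)
    qed
    ultimately show ?thesis by simp
  qed
  have "prob {\<omega> \<in> space M. \<exists>j\<le>n. c \<le> S j \<omega>} = (\<Sum>j\<le>n. prob (A j))"
    unfolding un by (rule finite_measure_finite_Union) (use disj in auto)
  also have "\<dots> \<le> (\<Sum>j\<le>n. 2 * prob (A j \<inter> B j))"
  proof (rule sum_mono)
    fix j assume "j \<in> {..n}"
    then have j: "j \<le> n" by simp
    have "prob (A j) * 1 \<le> prob (A j) * (2 * prob (B j))"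
      using half[OF j] by (intro mult_left_mono) auto
    then show "prob (A j) \<le> 2 * prob (A j \<inter> B j)" by (simp add: ind[OF j])
  qed
  also have "\<dots> = 2 * prob (\<Union>j\<in>{..n}. A j \<inter> B j)"
    unfolding sum_distrib_left[symmetric]
    by (subst finite_measure_finite_Union) (use disj in \<open>auto simp: disjoint_family_on_def\<close>)
  also have "prob (\<Union>j\<in>{..n}. A j \<inter> B j) \<le> prob {\<omega> \<in> space M. a \<le> S n \<omega>}"
    by (intro finite_measure_mono) (auto simp: A_def B_def c_def)
  finally show ?thesis by (simp add: c_def)
qed

end

section \<open>The scale and normal tails along geometric sequences\<close>

text \<open>For \<open>n < 3\<close> the iterated logarithm is negative or a default value; the
  limits concern large \<open>n\<close> only.\<close>

definition lil_scale :: "nat \<Rightarrow> real" where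
  "lil_scale n = sqrt (real n * ln (ln (real n)))"

lemma ln_ge_one: "1 \<le> ln (x::real)" if "x \<ge> 3"
  using that exp_le by (subst ln_ge_iff) auto

lemma lnln_mono: "ln (ln x) \<le> ln (ln (y::real))" if "x \<ge> 3" "x \<le> y"
  using that ln_ge_one[of x] ln_ge_one[of y] by simp

lemma lnln_nonneg: "0 \<le> ln (ln (x::real))" if "x \<ge> 3"
  using ln_ge_one[OF that] by simp

lemma lil_scale_nonneg: "n \<ge> 3 \<Longrightarrow> 0 \<le> lil_scale n"
  unfolding lil_scale_def using lnln_nonneg[of n] by simp

lemma lnln_scale_eventually:
  assumes "\<theta> > (1::real)"
  shows "\<forall>\<^sub>F n::nat in sequentially. ln (ln (\<theta> * n)) \<le> \<theta> * ln (ln n)"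
  using assms by real_asymp

lemma exp_minus_one_eventually:
  assumes "l > (0::real)"
  shows "\<forall>\<^sub>F k::nat in sequentially. exp (l / 2 * k) \<le> exp (l * k) - 1"
  using assms by real_asymp

lemma summable_exp_linear:
  assumes "l > (0::real)"
  shows "summable (\<lambda>k::nat. exp (- l * k))"
proof -
  have "summable (\<lambda>k::nat. exp (- l) ^ k)" using assms by (intro summable_geometric) auto
  then show ?thesis by (simp add: exp_of_nat_mult[symmetric] mult.commute)
qed

text \<open>Along a geometric sequence \<open>ln (ln (N k))\<close> is \<open>ln k + O(1)\<close>, so the normal tail at
  \<open>c sqrt (ln (ln (N k)))\<close> is a power of \<open>k\<close> with exponent close to \<open>-c\<^sup>2 / 2\<close>.\<close>

lemma summable_normal_tail_geometric:
  fixes N :: "nat \<Rightarrow> nat" and l :: real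
  assumes l: "l > (0::real)" and N: "\<forall>\<^sub>F k in sequentially. exp (l * k) \<le> real (N k)" and c: "c > sqrt 2"
  shows "summable (\<lambda>k. measure std_normal {c * sqrt (ln (ln (N k))) - D..})"
proof -
  obtain r where r: "sqrt 2 < r" "r < c" using dense[OF c] by blast
  have "0 \<le> sqrt (2::real)" by simp
  then have r0: "r > 0" "c > 0" using r by linarith+
  \<comment> \<open>Once \<open>v\<close> exceeds \<open>D / (c - r)\<close>, the shifted level
    \<open>c * v - D\<close> is at least \<open>r * v\<close>. The gap between \<open>c\<close> and
    \<open>r\<close> absorbs the shift, and \<open>r\<close> is still above \<open>sqrt 2\<close>,
    so the exponent \<open>r\<^sup>2 / 2\<close> exceeds 1.\<close>
  define u where "u = max 1 (D / (c - r))"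
  have ev: "\<forall>\<^sub>F k::nat in sequentially. u\<^sup>2 \<le> ln (l * k) \<and> 1 \<le> l * k \<and> real k \<ge> 1"
  proof (intro eventually_conj)
    show "\<forall>\<^sub>F k::nat in sequentially. u\<^sup>2 \<le> ln (l * k)" using l by real_asymp
    show "\<forall>\<^sub>F k::nat in sequentially. 1 \<le> l * k" using l by real_asymp
    show "\<forall>\<^sub>F k::nat in sequentially. 1 \<le> real k" by real_asymp
  qed
  show ?thesis
  proof (rule summable_comparison_test_ev)
    have "2 < r\<^sup>2" using power_strict_mono[of "sqrt 2" r 2] r by simp
    then have "summable (\<lambda>k. of_nat k powr (- (r\<^sup>2 / 2)) :: real)"
      by (subst summable_real_powr_iff) simp
    then show "summable (\<lambda>k. l powr (- (r\<^sup>2 / 2)) * real k powr (- (r\<^sup>2 / 2)))"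
      by (rule summable_mult)
    show "\<forall>\<^sub>F k in sequentially. norm (measure std_normal {c * sqrt (ln (ln (N k))) - D..})
        \<le> l powr (- (r\<^sup>2 / 2)) * real k powr (- (r\<^sup>2 / 2))"
      using N ev
    proof eventually_elim
      case (elim k)
      define v where "v = sqrt (ln (ln (N k)))"
      have "l * k \<le> ln (N k)"
        using elim(1) by (metis exp_gt_zero less_le_trans ln_ge_iff)
      then have le: "ln (l * k) \<le> ln (ln (N k))" using elim(2) by simp
      have "u\<^sup>2 \<le> ln (ln (N k))" using le elim(2) by linarith
      then have uv: "u \<le> v" unfolding v_def by (rule real_le_rsqrt)
      have "D \<le> u * (c - r)"
        using r by (simp add: u_def max_def field_simps split: if_splits) 
      also have "\<dots> \<le> v * (c - r)" using uv r by (intro mult_right_mono) auto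
      finally have rv: "r * v \<le> c * v - D" by (simp add: algebra_simps)
      have v1: "1 \<le> v" using uv by (simp add: u_def)
      have "measure std_normal {c * v - D..} \<le> exp (- (c * v - D)\<^sup>2 / 2)"
        using rv v1 r0 by (intro std_normal_tail_le) (smt (verit) mult_nonneg_nonneg)
      also have "\<dots> \<le> exp (- (r\<^sup>2 / 2) * v\<^sup>2)"
      proof -
        have "(r * v)\<^sup>2 \<le> (c * v - D)\<^sup>2" using rv v1 r0 by (intro power_mono) auto
        then show ?thesis by (simp add: power_mult_distrib)
      qed
      also have "v\<^sup>2 = ln (ln (N k))" 
        using order_trans[OF zero_le_power2 \<open>u\<^sup>2 \<le> ln (ln (N k))\<close>] by (simp add: v_def)
      also have "exp (- (r\<^sup>2 / 2) * ln (ln (N k))) \<le> exp (- (r\<^sup>2 / 2) * ln (l * k))"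
        using le by (simp add: mult_left_mono)
      also have "\<dots> = (l * k) powr (- (r\<^sup>2 / 2))" using elim(2) l by (simp add: powr_def)
      also have "\<dots> = l powr (- (r\<^sup>2 / 2)) * real k powr (- (r\<^sup>2 / 2))"
        using l by (simp add: powr_mult)
      finally show ?case by (simp add: v_def)
    qed
  qed
qed

lemma summable_powr_geometric:
  fixes N :: "nat \<Rightarrow> nat" and l :: real
  assumes l: "l > (0::real)" and N: "\<forall>\<^sub>F k in sequentially. exp (l * k) \<le> real (N k)" and d: "d > 0"
  shows "summable (\<lambda>k. real (N k) powr (- d))"
proof (rule summable_comparison_test_ev)
  show "summable (\<lambda>k::nat. exp (- (l * d) * k))" using l d by (intro summable_exp_linear) auto
  show "\<forall>\<^sub>F k in sequentially. norm (real (N k) powr - d) \<le> exp (- (l * d) * k)"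
    using N
  proof eventually_elim
    case (elim k)
    have "real (N k) powr - d \<le> exp (l * k) powr - d"
      using elim d by (intro powr_mono2') auto
    then show ?case by (simp add: exp_powr_real algebra_simps)
  qed
qed

text \<open>Below \<open>sqrt 2\<close> the tail dominates a multiple of the harmonic series: for
  large \<open>k\<close> the level plus \<open>D + 1\<close> is at most \<open>sqrt 2 * v\<close>,
  and \<open>exp (- v\<^sup>2)\<close> equals \<open>1 / (Suc k * ln q)\<close>. The extra 1 comes
  from the lower tail bound.\<close>

lemma normal_tail_geometric_ge:
  assumes q: "q \<ge> (2::nat)" and c: "0 \<le> c" "c < sqrt 2" and D: "D \<ge> 0"
  shows "\<forall>\<^sub>F k in sequentially.
     1 / (sqrt (2 * pi) * ln q) * inverse (real (Suc k)) \<le> measure std_normal {c * sqrt (ln (ln (real (q ^ Suc k)))) + D..}"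
proof -
  have lq: "ln (real q) > 0" using q by simp
  define u where "u = (D + 1) / (sqrt 2 - c)"
  have "\<forall>\<^sub>F k::nat in sequentially. u\<^sup>2 \<le> ln (Suc k * ln (real q)) \<and> 0 < ln (Suc k * ln (real q))"
  proof (rule eventually_conj)
    show "\<forall>\<^sub>F k::nat in sequentially. u\<^sup>2 \<le> ln (Suc k * ln (real q))" using lq by real_asymp
    show "\<forall>\<^sub>F k::nat in sequentially. 0 < ln (Suc k * ln (real q))" using lq by real_asymp
  qed
  then show ?thesis
  proof eventually_elim
    case (elim k)
    define v where "v = sqrt (ln (Suc k * ln (real q)))"
    have v: "v \<ge> 0" "v\<^sup>2 = ln (Suc k * ln (real q))" using elim by (auto simp: v_def)
    have "u \<le> v" unfolding v_def using elim by (intro real_le_rsqrt) auto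
    then have "D + 1 \<le> v * (sqrt 2 - c)"
      using c by (simp add: u_def pos_divide_le_eq)
    then have "c * v + D + 1 \<le> sqrt 2 * v" by (simp add: algebra_simps)
    then have "(c * v + D + 1)\<^sup>2 \<le> (sqrt 2 * v)\<^sup>2" using c v D by (intro power_mono) auto
    then have "exp (- v\<^sup>2) \<le> exp (- (c * v + D + 1)\<^sup>2 / 2)" by (simp add: power_mult_distrib)
    moreover have "exp (- v\<^sup>2) = 1 / (Suc k * ln (real q))"
      using lq unfolding v(2) by (simp add: exp_minus inverse_eq_divide del: of_nat_Suc)
    ultimately have "1 / (Suc k * ln (real q)) / sqrt (2 * pi) \<le> exp (- (c * v + D + 1)\<^sup>2 / 2) / sqrt (2 * pi)"
      by (intro divide_right_mono) auto
    also have "\<dots> \<le> measure std_normal {c * v + D..}"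
      by (rule std_normal_tail_ge) (use c v D in auto)
    also have "v = sqrt (ln (ln (real (q ^ Suc k))))"
      using q unfolding v_def by (simp add: ln_realpow del: power_Suc of_nat_Suc)
    finally show ?case by (simp add: field_simps del: of_nat_Suc)
  qed
qed

section \<open>The two halves of the law of the iterated logarithm\<close>

context standardized_iid
begin

text \<open>The maximum of the walk up to \<open>N k\<close>, about \<open>\<theta> ^ k\<close>, is
  compared with the single level \<open>c1 * lil_scale (N k)\<close>. These events have summable
  probabilities, and between consecutive block ends the scale varies by a factor of at most about
  \<theta>.\<close>

lemma S_le_lil_scale_eventually:
  assumes c: "c > sqrt 2"
  shows "AE \<omega> in M. \<forall>\<^sub>F n in sequentially. S n \<omega> \<le> c * lil_scale n"
proof -
  obtain c1 where c1: "sqrt 2 < c1" "c1 < c" using dense[OF c] by blast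
  have "0 \<le> sqrt (2::real)" by simp
  then have c0: "c1 > 0" using c1 by linarith
  \<comment> \<open>The room between \<open>c1\<close> and \<open>c\<close> is spent on the block
    ratio: \<open>sqrt \<theta>\<close> pays for replacing \<open>N k\<close> by \<open>n\<close>,
    another \<open>sqrt \<theta>\<close> for the change in the iterated logarithm.\<close>
  define \<theta> where "\<theta> = c / c1"
  have \<theta>: "\<theta> > 1" "c1 * \<theta> = c" using c1 c0 by (auto simp: \<theta>_def)
  define N where "N k = nat \<lfloor>\<theta> ^ k\<rfloor>" for k
  have N1: "N k \<ge> 1" for k using \<theta>(1) one_le_power[of \<theta> k] by (simp add: N_def le_nat_floor)
  have Nle: "real (N k) \<le> \<theta> ^ k" for k using \<theta>(1) by (simp add: N_def)
  \<comment> \<open>Half of the true growth rate leaves space for the rounding in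
    \<open>N k\<close>.\<close>
  define l where "l = ln \<theta> / 2"
  have l: "l > 0" using \<theta> by (simp add: l_def)
  have Nexp: "\<forall>\<^sub>F k in sequentially. exp (l * k) \<le> real (N k)"
    using exp_minus_one_eventually[of "ln \<theta>"]
  proof (rule eventually_mono)
    fix k :: nat assume "exp (ln \<theta> / 2 * k) \<le> exp (ln \<theta> * k) - 1"
    moreover have "exp (ln \<theta> * k) = \<theta> ^ k"
      using \<theta> by (simp add: exp_of_nat2_mult)
    moreover have "\<theta> ^ k - 1 \<le> real (N k)" unfolding N_def by linarith
    ultimately show "exp (l * k) \<le> real (N k)" by (simp add: l_def)
  qed (use \<theta> in auto)
  from tail_normal_comparison obtain C where C:
    "prob {\<omega> \<in> space M. x * sqrt n \<le> S n \<omega>}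
      \<le> measure std_normal {x - 4..} + C * real n powr (- \<delta> / 2)"
    if "n \<ge> 1" for n x by blast
  define E where "E k = {\<omega> \<in> space M. \<exists>j\<le>N k. c1 * lil_scale (N k) \<le> S j \<omega>}" for k
  have [measurable]: "E k \<in> events" for k unfolding E_def by measurable
  have PE: "prob (E k) \<le> 2 * (measure std_normal {c1 * sqrt (ln (ln (N k))) - (sqrt 2 + 4)..} + C * real (N k) powr (- (\<delta> / 2)))" for k
  proof -
    \<comment> \<open>After division by \<open>sqrt (N k)\<close> Ottaviani's shift
      \<open>sqrt (2 * N k)\<close> is the constant \<open>sqrt 2\<close>; the normal comparison
      then adds 4.\<close>
    define x where "x = c1 * sqrt (ln (ln (N k))) - sqrt 2"
    have "x * sqrt (N k) + sqrt (2 * N k) = c1 * lil_scale (N k)"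
      by (simp add: x_def lil_scale_def real_sqrt_mult algebra_simps)
    then have "prob (E k) \<le> 2 * prob {\<omega> \<in> space M. x * sqrt (N k) \<le> S (N k) \<omega>}"
      using maximal_inequality[OF N1[of k], of "x * sqrt (N k)"] by (simp add: E_def)
    also have "\<dots> \<le> 2 * (measure std_normal {x - 4..} + C * real (N k) powr (- \<delta> / 2))"
      using C[OF N1] by (intro mult_left_mono) auto
    finally show ?thesis by (simp add: x_def algebra_simps)
  qed
  have "summable (\<lambda>k. prob (E k))"
  proof (rule summable_comparison_test)
    show "summable (\<lambda>k. 2 * (measure std_normal {c1 * sqrt (ln (ln (N k))) - (sqrt 2 + 4)..} + C * real (N k) powr (- (\<delta> / 2))))"
      using \<delta> by (intro summable_mult summable_add summable_normal_tail_geometric[OF l Nexp c1(1)] summable_powr_geometric[OF l Nexp]) auto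
  qed (use PE in auto)
  then have "AE \<omega> in M. \<forall>\<^sub>F k in sequentially. \<omega> \<in> space M - E k"
    by (intro borel_cantelli_AE1) (auto simp: emeasure_eq_measure)
  then show ?thesis
  proof (rule AE_mp, intro AE_I2 impI)
    fix \<omega> assume \<omega>: "\<omega> \<in> space M" and "\<forall>\<^sub>F k in sequentially. \<omega> \<in> space M - E k"
    then obtain K where K0: "\<forall>k\<ge>K. \<omega> \<in> space M - E k"
      unfolding eventually_sequentially by blast
    have K: "S j \<omega> < c1 * lil_scale (N k)" if "k \<ge> K" "j \<le> N k" for j k
    proof -
      have "\<omega> \<notin> E k" using K0 that(1) by blast
      then have "\<not> c1 * lil_scale (N k) \<le> S j \<omega>" using \<omega> that(2) unfolding E_def by blast
      then show ?thesis by simp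
    qed
    have "\<forall>\<^sub>F n::nat in sequentially. real n > \<theta> ^ K"
      by (rule eventually_compose_filterlim[OF eventually_gt_at_top filterlim_real_sequentially])
    then show "\<forall>\<^sub>F n in sequentially. S n \<omega> \<le> c * lil_scale n"
      using eventually_ge_at_top[of 3] lnln_scale_eventually[OF \<theta>(1)]
    proof eventually_elim
      case (elim n)
      \<comment> \<open>Minimality of \<open>k\<close> gives
        \<open>\<theta> ^ k \<le> \<theta> * n\<close>, so the block that covers \<open>n\<close>
        overshoots it by at most the factor \<theta>.\<close>
      define k where "k = (LEAST k. real n \<le> \<theta> ^ k)"
      obtain k0 where "real n \<le> \<theta> ^ k0" using real_arch_pow[OF \<theta>(1), of n] less_imp_le by blast
      then have nk: "real n \<le> \<theta> ^ k" unfolding k_def by (rule LeastI)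
      have "K < k"
      proof (rule ccontr)
        assume "\<not> K < k"
        then have "\<theta> ^ k \<le> \<theta> ^ K" using \<theta> by (intro power_increasing) auto
        then show False using elim nk by linarith
      qed
      then obtain i where i: "k = Suc i" by (cases k) auto
      have "\<not> real n \<le> \<theta> ^ i" using not_less_Least[of i "\<lambda>k. real n \<le> \<theta> ^ k"] i unfolding k_def by auto
      then have "\<theta> ^ k \<le> \<theta> * n" using \<theta> by (simp add: i)
      then have Nn: "real (N k) \<le> \<theta> * n" using Nle[of k] by linarith
      have nN: "n \<le> N k" using nk by (simp add: N_def le_nat_floor)
      then have "3 \<le> real (N k)" using elim(2) by simp
      then have "real (N k) * ln (ln (N k)) \<le> (\<theta> * n) * ln (ln (\<theta> * n))"
        using Nn lnln_mono[of "N k" "\<theta> * n"] lnln_nonneg[of "N k"] \<theta> by (intro mult_mono) auto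
      also have "\<dots> \<le> (\<theta> * n) * (\<theta> * ln (ln n))" using elim \<theta> by (intro mult_left_mono) auto
      finally have "lil_scale (N k) \<le> sqrt (\<theta>\<^sup>2 * (n * ln (ln n)))"
        unfolding lil_scale_def by (intro real_sqrt_le_mono) (simp add: power2_eq_square ac_simps)
      also have "\<dots> = \<theta> * lil_scale n" using \<theta> by (simp add: lil_scale_def real_sqrt_mult)
      finally have "c1 * lil_scale (N k) \<le> c1 * (\<theta> * lil_scale n)" using c0 by (intro mult_left_mono) auto
      also have "\<dots> = c * lil_scale n" using \<theta>(2) by (simp add: mult.assoc[symmetric])
      finally show ?case using K[of k n] \<open>K < k\<close> nN by simp
    qed
  qed
qed

lemma standardized_iid_uminus: "standardized_iid M (\<lambda>n \<omega>. - Y n \<omega>) \<delta>"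
proof
  show "indep_vars (\<lambda>_. borel) (\<lambda>n \<omega>. - Y n \<omega>) UNIV"
    by (rule indep_vars_compose2[OF indep, where Y = "\<lambda>_ x. - x"]) auto
  fix n
  have "distr (distr M borel (Y n)) borel uminus = distr (distr M borel (Y 0)) borel uminus"
    by (simp only: ident[of n])
  then show "distr M borel (\<lambda>\<omega>. - Y n \<omega>) = distr M borel (\<lambda>\<omega>. - Y 0 \<omega>)"
    by (simp add: distr_distr comp_def)
qed (use mean_zero square_integrable variance_one moment \<delta> in auto)

lemma S_uminus: "standardized_iid.S (\<lambda>n \<omega>. - Y n \<omega>) n \<omega> = - S n \<omega>"
  using standardized_iid.S_def[OF standardized_iid_uminus] by (simp add: S_def sum_negf)

text \<open>The increments over \<open>{q ^ k..<q ^ Suc k}\<close> are independent and infinitely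
  often large. The walk at the start of the block is bounded below by the upper half applied to the
  negated steps, and for large \<open>q\<close> it is small on the scale of the end of the
  block.\<close>

lemma S_ge_lil_scale_frequently:
  assumes c: "0 < c" "c < sqrt 2"
  shows "AE \<omega> in M. \<exists>\<^sub>F n in sequentially. c * lil_scale n \<le> S n \<omega>"
proof -
  obtain c2 where c2: "c < c2" "c2 < sqrt 2" using dense[OF c(2)] by blast
  \<comment> \<open>Two demands on \<open>q\<close>: \<open>2 / sqrt q < c2 - c\<close> pays for the
    walk before the block, and \<open>c2 * sqrt (q / (q - 1)) < sqrt 2\<close> compensates for the
    block being shorter than \<open>q ^ Suc k\<close>, keeping the normalized level
    \<open>c3\<close> below the critical one.\<close>
  have "(\<lambda>q::nat. 2 / sqrt q) \<longlonglongrightarrow> 0" by real_asymp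
  then have ev1: "\<forall>\<^sub>F q::nat in sequentially. 2 / sqrt q < c2 - c" by (rule order_tendstoD) (use c2 in auto)
  have "(\<lambda>q::nat. c2 * sqrt (q / (q - 1))) \<longlonglongrightarrow> c2" by real_asymp
  then have ev2: "\<forall>\<^sub>F q::nat in sequentially. c2 * sqrt (q / (real q - 1)) < sqrt 2"
    by (rule order_tendstoD) (use c2 in auto)
  obtain q :: nat where q: "2 / sqrt q < c2 - c" "c2 * sqrt (q / (real q - 1)) < sqrt 2" "q \<ge> 2"
    using eventually_happens[OF eventually_conj[OF ev1 eventually_conj[OF ev2 eventually_ge_at_top[of 2]]]]
    by auto
  define c3 where "c3 = c2 * sqrt (q / (real q - 1))"
  define m where "m k = q ^ k * (q - 1)" for k
  have m: "q ^ k + m k = q ^ Suc k" "m k \<ge> 1" for k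
    using q(3) by (cases q; simp add: m_def)+
  define D where "D k \<omega> = (\<Sum>i=q^k..<q^Suc k. Y i \<omega>)" for k \<omega>
  have D: "D k \<omega> = S (q ^ k + m k) \<omega> - S (q ^ k) \<omega>" for k \<omega>
    using q(3) unfolding m D_def S_def lessThan_atLeast0 by (intro sum_diff_nat_ivl[symmetric]) auto
  have "disjoint_family (\<lambda>k. {q ^ k..<q ^ Suc k})"
    unfolding disjoint_family_on_def
  proof (intro ballI impI)
    fix a b :: nat assume "a \<noteq> b"
    then show "{q ^ a..<q ^ Suc a} \<inter> {q ^ b..<q ^ Suc b} = {}"
    proof (induction a b rule: linorder_wlog)
      case (le a b)
      then have "q ^ Suc a \<le> q ^ b" using q(3) by (intro power_increasing) auto
      then show ?case by auto
    qed auto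
  qed
  then have "indep_vars (\<lambda>k. PiM {q ^ k..<q ^ Suc k} (\<lambda>_. borel)) (\<lambda>k \<omega>. restrict (\<lambda>i. Y i \<omega>) {q ^ k..<q ^ Suc k}) UNIV"
    by (intro indep_vars_restrict[OF indep]) auto
  then have "indep_vars (\<lambda>_. borel) (\<lambda>k \<omega>. \<Sum>i=q^k..<q^Suc k. restrict (\<lambda>i. Y i \<omega>) {q ^ k..<q ^ Suc k} i) UNIV"
    by (rule indep_vars_compose2[where Y = "\<lambda>k y. \<Sum>i=q^k..<q^Suc k. y i"])
       (intro borel_measurable_sum measurable_component_singleton, auto)
  also have "(\<lambda>k \<omega>. \<Sum>i=q^k..<q^Suc k. restrict (\<lambda>i. Y i \<omega>) {q ^ k..<q ^ Suc k} i) = D"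
    unfolding D_def by (intro ext sum.cong) auto
  finally have Dind: "indep_vars (\<lambda>_. borel) D UNIV" .
  from tail_normal_comparison obtain C where C:
    "measure std_normal {x + 4..} - C * real n powr (- \<delta> / 2)
      \<le> prob {\<omega> \<in> space M. x * sqrt n \<le> S n \<omega>}"
    if "n \<ge> 1" for n x by blast
  have PD: "measure std_normal {c3 * sqrt (ln (ln (real (q ^ Suc k)))) + 4..}
     \<le> prob {\<omega> \<in> space M. c2 * lil_scale (q ^ Suc k) \<le> D k \<omega>} + C * real (m k) powr (- (\<delta> / 2))" for k
  proof -
    define x where "x = c3 * sqrt (ln (ln (real (q ^ Suc k))))"
    have "x * sqrt (m k) = c2 * lil_scale (q ^ Suc k)"
    proof -
      have "sqrt (q / (real q - 1)) * sqrt (m k) = sqrt (real (q ^ Suc k))"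
        unfolding real_sqrt_mult[symmetric] using q(3) by (simp add: m_def of_nat_diff)
      then show ?thesis by (simp add: x_def c3_def lil_scale_def real_sqrt_mult ac_simps del: power_Suc of_nat_power)
    qed
    then have "prob {\<omega> \<in> space M. c2 * lil_scale (q ^ Suc k) \<le> D k \<omega>} = prob {\<omega> \<in> space M. x * sqrt (m k) \<le> S (m k) \<omega>}"
      using prob_increment[of "{x * sqrt (m k)..}" "q^k" "m k"] by (simp add: D)
    then show ?thesis using C[OF m(2)[of k], of x] by (simp add: x_def)
  qed
  have "\<not> summable (\<lambda>k. prob {\<omega> \<in> space M. c2 * lil_scale (q ^ Suc k) \<le> D k \<omega>})"
  proof
    assume s: "summable (\<lambda>k. prob {\<omega> \<in> space M. c2 * lil_scale (q ^ Suc k) \<le> D k \<omega>})"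
    have "summable (\<lambda>k. real (m k) powr - (\<delta> / 2))"
    proof (rule summable_powr_geometric[of "ln q"])
      show "\<forall>\<^sub>F k in sequentially. exp (ln (real q) * k) \<le> real (m k)"
      proof (intro always_eventually allI)
        fix k
        have "q ^ k * 1 \<le> m k" unfolding m_def using q(3) by (intro mult_left_mono) auto
        then have "real (q ^ k) \<le> real (m k)" by simp
        then show "exp (ln (real q) * k) \<le> real (m k)" using q(3) by (simp add: exp_of_nat2_mult)
      qed
    qed (use q(3) \<delta> in auto)
    then have "summable (\<lambda>k. prob {\<omega> \<in> space M. c2 * lil_scale (q ^ Suc k) \<le> D k \<omega>} + C * real (m k) powr (- (\<delta> / 2)))"
      using s by (intro summable_add summable_mult)
    then have "summable (\<lambda>k. 1 / (sqrt (2 * pi) * ln q) * inverse (real (Suc k)))"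
    proof (rule summable_comparison_test_ev[rotated])
      have four: "(0::real) \<le> 4" by simp
      have "0 \<le> c3" "c3 < sqrt 2" using q c c2 by (auto simp: c3_def)
      show "\<forall>\<^sub>F k in sequentially. norm (1 / (sqrt (2 * pi) * ln q) * inverse (real (Suc k)))
          \<le> prob {\<omega> \<in> space M. c2 * lil_scale (q ^ Suc k) \<le> D k \<omega>} + C * real (m k) powr (- (\<delta> / 2))"
        using normal_tail_geometric_ge[OF q(3) \<open>0 \<le> c3\<close> \<open>c3 < sqrt 2\<close> four]
      proof (rule eventually_mono)
        fix k assume "1 / (sqrt (2 * pi) * ln q) * inverse (real (Suc k))
          \<le> measure std_normal {c3 * sqrt (ln (ln (real (q ^ Suc k)))) + 4..}"
        also have "\<dots> \<le> prob {\<omega> \<in> space M. c2 * lil_scale (q ^ Suc k) \<le> D k \<omega>} + C * real (m k) powr (- (\<delta> / 2))"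
          by (rule PD)
        also have "1 / (sqrt (2 * pi) * ln q) * inverse (real (Suc k)) = norm (1 / (sqrt (2 * pi) * ln q) * inverse (real (Suc k)))"
          using q(3) by (simp add: abs_mult)
        finally show "norm (1 / (sqrt (2 * pi) * ln q) * inverse (real (Suc k)))
          \<le> prob {\<omega> \<in> space M. c2 * lil_scale (q ^ Suc k) \<le> D k \<omega>} + C * real (m k) powr (- (\<delta> / 2))" .
      qed
    qed
    then have "summable (\<lambda>k. inverse (real (Suc k)))"
      using q(3) by (subst (asm) summable_cmult_iff) auto
    then have "summable (\<lambda>k. inverse (real k))"
      by (rule summable_Suc_iff[of "\<lambda>k. inverse (real k)", THEN iffD1])
    then show False using not_summable_harmonic[where ?'a = real] by simp
  qed
  from indep_borel_cantelli[OF Dind this]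
  have "AE \<omega> in M. \<exists>\<^sub>F k in sequentially. c2 * lil_scale (q ^ Suc k) \<le> D k \<omega>" .
  \<comment> \<open>The 2 stands for any constant above \<open>sqrt 2\<close>.\<close>
  moreover have "AE \<omega> in M. \<forall>\<^sub>F n in sequentially. - S n \<omega> \<le> 2 * lil_scale n"
    using standardized_iid.S_le_lil_scale_eventually[OF standardized_iid_uminus, of 2]
    by (simp add: S_uminus real_less_lsqrt)
  ultimately show ?thesis
  proof eventually_elim
    case (elim \<omega>)
    have sub: "filterlim (\<lambda>k. q ^ k) at_top sequentially"
      using q(3) by (intro filterlim_subseq) (auto simp: strict_mono_def intro: power_strict_increasing)
    have "\<forall>\<^sub>F k in sequentially. - S (q ^ k) \<omega> \<le> 2 * lil_scale (q ^ k)"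
      using elim(2) sub by (rule eventually_compose_filterlim)
    then have "\<forall>\<^sub>F k in sequentially. - S (q ^ k) \<omega> \<le> 2 * lil_scale (q ^ k) \<and> k \<ge> 2"
      by (intro eventually_conj eventually_ge_at_top)
    with elim(1) have "\<exists>\<^sub>F k in sequentially. c2 * lil_scale (q ^ Suc k) \<le> D k \<omega>
        \<and> (- S (q ^ k) \<omega> \<le> 2 * lil_scale (q ^ k) \<and> k \<ge> 2)"
      by (rule frequently_eventually_frequently)
    then have "\<exists>\<^sub>F k in sequentially. c * lil_scale (q ^ Suc k) \<le> S (q ^ Suc k) \<omega>"
    proof (rule frequently_mono[rotated], intro allI impI)
      fix k assume k: "c2 * lil_scale (q ^ Suc k) \<le> D k \<omega> \<and> (- S (q ^ k) \<omega> \<le> 2 * lil_scale (q ^ k) \<and> k \<ge> 2)"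
      have "(2::nat) ^ 2 \<le> q ^ k"
        using q(3) k by (intro order_trans[OF power_increasing[of 2 k 2] power_mono]) auto
      then have "3 \<le> q ^ k" by simp
      then have q4: "3 \<le> real (q ^ k)" by linarith
      have "real (q ^ k) \<le> real (q ^ Suc k)" using q(3) by simp
      from lnln_mono[OF q4 this] have "real (q ^ k) * ln (ln (real (q ^ k))) \<le> real (q ^ Suc k) * ln (ln (real (q ^ Suc k))) / q"
        using q(3) by (simp add: mult_left_mono)
      then have "lil_scale (q ^ k) \<le> lil_scale (q ^ Suc k) / sqrt q"
        unfolding lil_scale_def real_sqrt_divide[symmetric] by (rule real_sqrt_le_mono)
      then have "2 * lil_scale (q ^ k) \<le> 2 / sqrt q * lil_scale (q ^ Suc k)" by simp
      moreover have q3: "3 \<le> q ^ Suc k"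
        using q4 \<open>real (q ^ k) \<le> real (q ^ Suc k)\<close> by linarith
      ultimately have "2 * lil_scale (q ^ k) \<le> 2 / sqrt q * lil_scale (q ^ Suc k)" by simp
      also have "\<dots> \<le> (c2 - c) * lil_scale (q ^ Suc k)"
        using q(1) q3 by (intro mult_right_mono lil_scale_nonneg) simp_all
      finally have "2 * lil_scale (q ^ k) \<le> c2 * lil_scale (q ^ Suc k) - c * lil_scale (q ^ Suc k)"
        by (simp add: algebra_simps)
      then show "c * lil_scale (q ^ Suc k) \<le> S (q ^ Suc k) \<omega>"
        using k D[of k \<omega>] unfolding m by linarith
    qed
    moreover have "filterlim (\<lambda>k. q ^ Suc k) at_top sequentially"
      using sub by (rule filterlim_compose[OF _ filterlim_Suc])
    ultimately show "\<exists>\<^sub>F n in sequentially. c * lil_scale n \<le> S n \<omega>"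
      unfolding frequently_def using eventually_compose_filterlim by blast
  qed
qed

theorem law_of_iterated_logarithm:
  "AE \<omega> in M. limsup (\<lambda>n. ereal (S n \<omega> / lil_scale n)) = ereal (sqrt 2)"
proof -
  have "AE \<omega> in M. \<forall>j. \<forall>\<^sub>F n in sequentially. S n \<omega> \<le> (sqrt 2 + 1 / Suc j) * lil_scale n"
    unfolding AE_all_countable by (intro allI S_le_lil_scale_eventually) simp
  moreover have "AE \<omega> in M. \<forall>j. \<exists>\<^sub>F n in sequentially. (sqrt 2 - 1 / Suc j) * lil_scale n \<le> S n \<omega>"
    unfolding AE_all_countable
  proof (intro allI S_ge_lil_scale_frequently)
    fix j
    have "1 / real (Suc j) \<le> 1" by simp
    also have "1 < sqrt (2::real)" by simp
    finally show "0 < sqrt 2 - 1 / real (Suc j)" by simp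
  qed simp
  ultimately show ?thesis
  proof eventually_elim
    case (elim \<omega>)
    have pos: "\<forall>\<^sub>F n in sequentially. lil_scale n > 0"
      unfolding lil_scale_def by real_asymp
    have L: "(\<lambda>j. 1 / real (Suc j)) \<longlonglongrightarrow> 0" by real_asymp
    have lim: "(\<lambda>j. ereal (sqrt 2 + 1 / Suc j)) \<longlonglongrightarrow> ereal (sqrt 2)" "(\<lambda>j. ereal (sqrt 2 - 1 / Suc j)) \<longlonglongrightarrow> ereal (sqrt 2)"
      using tendsto_add[OF tendsto_const L, of "sqrt 2"] tendsto_diff[OF tendsto_const L, of "sqrt 2"]
      unfolding lim_ereal by simp_all
    have up: "limsup (\<lambda>n. ereal (S n \<omega> / lil_scale n)) \<le> ereal (sqrt 2 + 1 / Suc j)" for j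
      by (rule Limsup_bounded, rule eventually_mono[OF eventually_conj[OF spec[OF elim(1), of j] pos]])
         (auto simp: pos_divide_le_eq)
    have lo: "ereal (sqrt 2 - 1 / Suc j) \<le> limsup (\<lambda>n. ereal (S n \<omega> / lil_scale n))" for j
    proof (rule ccontr)
      assume "\<not> ?thesis"
      then have "\<forall>\<^sub>F n in sequentially. ereal (S n \<omega> / lil_scale n) < ereal (sqrt 2 - 1 / Suc j)"
        by (intro Limsup_lessD) (simp add: not_le)
      from eventually_conj[OF this pos]
      have "\<forall>\<^sub>F n in sequentially. \<not> (sqrt 2 - 1 / Suc j) * lil_scale n \<le> S n \<omega>"
        by (rule eventually_mono) (auto simp: pos_divide_less_eq not_le)
      with elim(2) show False unfolding frequently_def by blast
    qed
    show ?case
      by (rule antisym) (use LIMSEQ_le_const[OF lim(1)] LIMSEQ_le_const2[OF lim(2)] up lo in blast)+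
  qed
qed

end

section \<open>Quenched moment formulas\<close>

text \<open>Markov's inequality and the first Borel-Cantelli lemma in one: an almost surely finite
  series has terms tending to 0. The threshold 1 is general enough because deterministic factors can
  be put into \<open>f\<close>.\<close>

lemma (in prob_space) nn_integral_borel_cantelli:
  fixes f :: "nat \<Rightarrow> 'a \<Rightarrow> ennreal"
  assumes [measurable]: "\<And>n. f n \<in> borel_measurable M" and fin: "(\<Sum>n. \<integral>\<^sup>+\<omega>. f n \<omega> \<partial>M) < \<infinity>"
  shows "AE \<omega> in M. (\<Sum>n. f n \<omega>) \<noteq> \<infinity>" and "AE \<omega> in M. \<forall>\<^sub>F n in sequentially. f n \<omega> < 1"
proof -
  have "(\<integral>\<^sup>+\<omega>. (\<Sum>n. f n \<omega>) \<partial>M) \<noteq> \<infinity>" using fin by (simp add: nn_integral_suminf)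
  then show *: "AE \<omega> in M. (\<Sum>n. f n \<omega>) \<noteq> \<infinity>" by (intro nn_integral_PInf_AE) auto
  show "AE \<omega> in M. \<forall>\<^sub>F n in sequentially. f n \<omega> < 1"
    using *
  proof eventually_elim
    case (elim \<omega>)
    have nt: "f n \<omega> \<noteq> \<infinity>" for n
      using elim ennreal_suminf_lessD[of "\<lambda>n. f n \<omega>" \<infinity>] by (auto simp: less_top)
    then have e: "f n \<omega> = ennreal (enn2real (f n \<omega>))" for n by (simp add: less_top)
    have "summable (\<lambda>n. enn2real (f n \<omega>))"
      by (rule summable_suminf_not_top) (use elim e in auto)
    then have "(\<lambda>n. enn2real (f n \<omega>)) \<longlonglongrightarrow> 0" by (rule summable_LIMSEQ_zero)
    then have "\<forall>\<^sub>F n in sequentially. enn2real (f n \<omega>) < 1" by (rule order_tendstoD) simp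
    then show ?case
      by eventually_elim (metis e ennreal_less_one_iff)
  qed
qed

lemma nn_integral_eqI_countable_partition:
  fixes K :: "'a \<Rightarrow> 'c"
  assumes C: "countable C" "\<And>\<omega>. \<omega> \<in> space M \<Longrightarrow> K \<omega> \<in> C"
    and K: "\<And>c. c \<in> C \<Longrightarrow> {\<omega> \<in> space M. K \<omega> = c} \<in> sets M"
    and f: "f \<in> borel_measurable M" "g \<in> borel_measurable M"
    and eq: "\<And>c. c \<in> C \<Longrightarrow> (\<integral>\<^sup>+\<omega>. f \<omega> * indicator {\<omega> \<in> space M. K \<omega> = c} \<omega> \<partial>M)
        = (\<integral>\<^sup>+\<omega>. g \<omega> * indicator {\<omega> \<in> space M. K \<omega> = c} \<omega> \<partial>M)"
  shows "(\<integral>\<^sup>+\<omega>. f \<omega> \<partial>M) = (\<integral>\<^sup>+\<omega>. g \<omega> \<partial>M)"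
proof -
  define B where "B n = {\<omega> \<in> space M. to_nat_on C (K \<omega>) = n}" for n
  have B: "B n = (if \<exists>c\<in>C. to_nat_on C c = n then {\<omega> \<in> space M. K \<omega> = from_nat_into C n} else {})" for n
    using C by (auto simp: B_def)
  have *: "from_nat_into C n \<in> C" if "\<exists>c\<in>C. to_nat_on C c = n" for n
    using that C(1) by auto
  have m: "B n \<in> sets M" for n using K * by (auto simp: B)
  have dis: "disjoint_family B" by (auto simp: disjoint_family_on_def B_def)
  have un: "(\<integral>\<^sup>+\<omega>. u \<omega> \<partial>M) = (\<Sum>n. \<integral>\<^sup>+\<omega>\<in>B n. u \<omega> \<partial>M)" if "u \<in> borel_measurable M" for u
  proof -
    have "(\<integral>\<^sup>+\<omega>. u \<omega> \<partial>M) = (\<integral>\<^sup>+\<omega>\<in>(\<Union>n. B n). u \<omega> \<partial>M)"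
      by (intro nn_integral_cong) (auto simp: B_def)
    then show ?thesis using nn_integral_disjoint_family[of u M B] that m dis by auto
  qed
  have "(\<integral>\<^sup>+\<omega>\<in>B n. f \<omega> \<partial>M) = (\<integral>\<^sup>+\<omega>\<in>B n. g \<omega> \<partial>M)" for n
    using eq[OF *] by (auto simp: B)
  then show ?thesis using f by (simp add: un)
qed

text \<open>The mean of \<open>h\<close> under \<open>q\<close> is taken in \<open>ennreal\<close>,
  so sums and integrals can be interchanged freely before finiteness is known.\<close>

definition offspring_nn :: "nat pmf \<Rightarrow> (nat \<Rightarrow> ennreal) \<Rightarrow> ennreal" where
  "offspring_nn q h = (\<Sum>a. ennreal (pmf q a) * h a)"

section \<open>Integration against environment-measurable weights\<close>

context branching_process_iid_env
begin

lemmas offspring_law_measurable [measurable]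

lemma env_measurable [measurable]: "\<xi> n \<in> measurable M E"
  using env_indep by (auto simp: indep_vars_def)

abbreviation F where "F \<equiv> env_algebra M E \<xi>"

lemma space_F [simp]: "space F = space M"
  by (simp add: env_algebra_def)

lemma subalgebra_F: "subalgebra M F"
proof -
  have "(\<lambda>\<omega> n. \<xi> n \<omega>) \<in> measurable M (Pi\<^sub>M UNIV (\<lambda>_. E))"
    using measurable_space[OF env_measurable] by (intro measurable_PiM_single') (auto simp: space_PiM)
  then have "sets F \<subseteq> sets M"
    unfolding env_algebra_def by (intro sets_image_in_sets) auto
  then show ?thesis by (simp add: subalgebra_def)
qed

sublocale F: finite_measure_subalgebra M F
  by unfold_locales (rule subalgebra_F)

lemma env_measurable_F [measurable]: "\<xi> n \<in> measurable F E"
proof -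
  have "(\<lambda>\<omega>. (\<lambda>\<omega> n. \<xi> n \<omega>) \<omega> n) \<in> measurable F E"
    unfolding env_algebra_def
    by (rule measurable_compose[OF measurable_vimage_algebra1 measurable_component_singleton])
       (use measurable_space[OF env_measurable] in \<open>auto simp: space_PiM\<close>)
  then show ?thesis by simp
qed

lemma F_measurable_imp [measurable_dest]: "f \<in> measurable F N \<Longrightarrow> f \<in> measurable M N"
  by (rule measurable_from_subalg[OF subalgebra_F])

lemma Z_measurable [measurable]: "Z n \<in> measurable M (count_space UNIV)"
proof (induction n)
  case 0
  have "(\<lambda>\<omega>. 1) \<in> measurable M (count_space (UNIV :: nat set))" by simp
  then show ?case by (rule measurable_cong[THEN iffD2, rotated]) (simp add: Z_0)
next
  case (Suc n)
  have "(\<lambda>\<omega>. \<Sum>i\<in>{1..z}. X n i \<omega>) \<in> measurable M (count_space UNIV)" for z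
  proof (induction z)
    case (Suc z)
    have X: "X n (Suc z) \<in> measurable M (count_space UNIV)" by (rule offspring_measurable) simp
    have "(\<lambda>\<omega>. a + X n (Suc z) \<omega>) \<in> measurable M (count_space UNIV)" for a
      by (rule measurable_compose[OF X]) simp
    from measurable_compose_countable[OF this Suc] show ?case by simp
  qed simp
  then have "(\<lambda>\<omega>. \<Sum>i\<in>{1..Z n \<omega>}. X n i \<omega>) \<in> measurable M (count_space UNIV)"
    by (rule measurable_compose_countable[OF _ Suc])
  then show ?case by (rule measurable_cong[THEN iffD2, rotated]) (simp add: Z_Suc)
qed

lemma compose_Z_measurable:
  assumes "\<And>z. G z \<in> measurable M N"
  shows "(\<lambda>\<omega>. G (Z n \<omega>) \<omega>) \<in> measurable M N"
  using assms by (rule measurable_compose_countable[OF _ Z_measurable])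

lemma offspring_nn_measurable_env:
  "(\<lambda>e. offspring_nn (p e) h) \<in> borel_measurable E"
  unfolding offspring_nn_def by measurable

lemma offspring_nn_measurable [measurable]:
  "(\<lambda>\<omega>. offspring_nn (p (\<xi> n \<omega>)) h) \<in> borel_measurable F"
  using offspring_nn_measurable_env by measurable

text \<open>The defining property of conditional probability, with weights that may be infinite.
  \<open>real_cond_exp\<close> is a difference of two nonnegative conditional expectations; for an
  indicator the second vanishes and the first is at most 1 almost everywhere, so nothing is lost in
  the conversion to reals and back.\<close>

lemma nn_integral_quenched_prob:
  assumes A [measurable]: "A \<in> events" and g [measurable]: "g \<in> borel_measurable F"
  shows "(\<integral>\<^sup>+\<omega>. g \<omega> * ennreal (quenched_prob M E \<xi> A \<omega>) \<partial>M) = (\<integral>\<^sup>+\<omega>. g \<omega> * indicator A \<omega> \<partial>M)"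
proof -
  let ?N = "nn_cond_exp M F (\<lambda>\<omega>. ennreal (indicat_real A \<omega>))"
  have "AE \<omega> in M. nn_cond_exp M F (\<lambda>\<omega>. 0) \<omega> = 0"
    using F.nn_cond_exp_F_meas[of "\<lambda>\<omega>. 0"] by (auto elim: AE_mp)
  moreover have "AE \<omega> in M. ?N \<omega> \<le> nn_cond_exp M F (\<lambda>\<omega>. 1) \<omega>"
    by (rule F.nn_cond_exp_mono) (auto simp: indicator_def)
  moreover have "AE \<omega> in M. nn_cond_exp M F (\<lambda>\<omega>. 1) \<omega> = 1"
    using F.nn_cond_exp_F_meas[of "\<lambda>\<omega>. 1"] by (auto elim: AE_mp)
  ultimately have "AE \<omega> in M. ennreal (quenched_prob M E \<xi> A \<omega>) = ?N \<omega>"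
  proof eventually_elim
    case (elim \<omega>)
    have "(\<lambda>\<omega>. ennreal (- indicat_real A \<omega>)) = (\<lambda>\<omega>. 0)" by (auto simp: indicator_def ennreal_neg)
    moreover have "?N \<omega> \<noteq> \<top>" using elim by (metis ennreal_one_less_top leD)
    ultimately show ?case using elim by (simp add: quenched_prob_def real_cond_exp_def less_top)
  qed
  then have "(\<integral>\<^sup>+\<omega>. g \<omega> * ennreal (quenched_prob M E \<xi> A \<omega>) \<partial>M) = (\<integral>\<^sup>+\<omega>. g \<omega> * ?N \<omega> \<partial>M)"
    by (intro nn_integral_cong_AE) auto
  also have "\<dots> = (\<integral>\<^sup>+\<omega>. g \<omega> * ennreal (indicat_real A \<omega>) \<partial>M)"
    by (rule F.nn_cond_exp_intg) auto
  finally show ?thesis by (simp add: ennreal_indicator)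
qed

text \<open>The indices start at 1 to match the independence assumption; \<open>Z 0\<close> is
  constant, which is why the value of \<open>Z n\<close> on a history is treated separately for
  \<open>n = 0\<close>.\<close>

definition history :: "nat \<Rightarrow> (nat \<Rightarrow> nat) \<Rightarrow> 'w set" where
  "history n z = {\<omega> \<in> space M. \<forall>j\<in>{1..n}. Z j \<omega> = z j}"

lemma history_measurable [measurable]: "history n z \<in> events"
  unfolding history_def by measurable

lemma offspring_event_measurable:
  assumes "finite I" "I \<subseteq> {1..}"
  shows "{\<omega> \<in> space M. \<forall>i\<in>I. X n i \<omega> = k i} \<in> events"
proof -
  have "{\<omega> \<in> space M. X n i \<omega> = k i} \<in> events" if "i \<in> I" for i
    using measurable_sets[OF offspring_measurable[of i n], of "{k i}"] that assms(2)
    by (auto simp: vimage_def Int_def conj_commute)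
  then show ?thesis using assms(1) by (intro sets.sets_Collect_finite_All) auto
qed

text \<open>Conditionally on the environment the two events are independent and the second has a
  known law. That law is environment-measurable, so it joins the weight and the first event can be
  integrated back.\<close>

lemma quenched_points:
  assumes I: "finite I" "I \<subseteq> {1..}" and g [measurable]: "g \<in> borel_measurable F"
  shows "(\<integral>\<^sup>+\<omega>. g \<omega> * indicator (history n z) \<omega> * indicator {\<omega> \<in> space M. \<forall>i\<in>I. X n i \<omega> = k i} \<omega> \<partial>M)
    = (\<integral>\<^sup>+\<omega>. g \<omega> * indicator (history n z) \<omega> * (\<Prod>i\<in>I. ennreal (pmf (p (\<xi> n \<omega>)) (k i))) \<partial>M)"
proof -
  let ?X = "{\<omega> \<in> space M. \<forall>i\<in>I. X n i \<omega> = k i}"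
  let ?P = "\<lambda>\<omega>. \<Prod>i\<in>I. pmf (p (\<xi> n \<omega>)) (k i)"
  have [measurable]: "?X \<in> events" by (rule offspring_event_measurable[OF I])
  have int: "history n z \<inter> ?X = {\<omega>' \<in> space M. (\<forall>j\<in>{1..n}. Z j \<omega>' = z j) \<and> (\<forall>i\<in>I. X n i \<omega>' = k i)}"
    by (auto simp: history_def)
  have "(\<integral>\<^sup>+\<omega>. g \<omega> * indicator (history n z) \<omega> * indicator ?X \<omega> \<partial>M)
    = (\<integral>\<^sup>+\<omega>. g \<omega> * indicator (history n z \<inter> ?X) \<omega> \<partial>M)"
    by (intro nn_integral_cong) (auto simp: indicator_def)
  also have "\<dots> = (\<integral>\<^sup>+\<omega>. g \<omega> * ennreal (quenched_prob M E \<xi> (history n z \<inter> ?X) \<omega>) \<partial>M)"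
    by (rule nn_integral_quenched_prob[symmetric]) auto
  also have "\<dots> = (\<integral>\<^sup>+\<omega>. (g \<omega> * ennreal (?P \<omega>)) * ennreal (quenched_prob M E \<xi> (history n z) \<omega>) \<partial>M)"
  proof (rule nn_integral_cong_AE)
    show "AE \<omega> in M. g \<omega> * ennreal (quenched_prob M E \<xi> (history n z \<inter> ?X) \<omega>)
      = (g \<omega> * ennreal (?P \<omega>)) * ennreal (quenched_prob M E \<xi> (history n z) \<omega>)"
      using quenched_indep[OF I, of n z k] quenched_iid[OF I, of n k]
      unfolding int
    proof eventually_elim
      case (elim \<omega>)
      have "0 \<le> ?P \<omega>" by (intro prod_nonneg) auto
      then show ?case unfolding elim history_def by (simp add: ennreal_mult' ennreal_mult'' ac_simps)
    qed
  qed
  also have "\<dots> = (\<integral>\<^sup>+\<omega>. (g \<omega> * ennreal (?P \<omega>)) * indicator (history n z) \<omega> \<partial>M)"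
    by (rule nn_integral_quenched_prob) auto
  finally show ?thesis by (simp add: prod_ennreal ac_simps)
qed

text \<open>The set \<open>J\<close> with prescribed values is the generalization that carries the
  induction: expanding \<open>h (X n i \<omega>)\<close> over its possible values \<open>a\<close>
  moves \<open>i\<close> from \<open>I\<close> to \<open>J\<close> with value \<open>a\<close>. When
  \<open>I\<close> is exhausted only point events remain.\<close>

lemma quenched_prod_history_aux:
  assumes "finite I" "I \<subseteq> {1..}" "finite J" "J \<subseteq> {1..}" "I \<inter> J = {}"
    and g [measurable]: "g \<in> borel_measurable F"
  shows "(\<integral>\<^sup>+\<omega>. g \<omega> * indicator (history n z) \<omega> * indicator {\<omega> \<in> space M. \<forall>i\<in>J. X n i \<omega> = k i} \<omega>
        * (\<Prod>i\<in>I. h (X n i \<omega>)) \<partial>M)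
    = (\<integral>\<^sup>+\<omega>. g \<omega> * indicator (history n z) \<omega> * (\<Prod>i\<in>J. ennreal (pmf (p (\<xi> n \<omega>)) (k i)))
        * offspring_nn (p (\<xi> n \<omega>)) h ^ card I \<partial>M)"
  using assms
proof (induction I arbitrary: J k rule: finite_induct)
  case empty
  then show ?case using quenched_points[of J g n z k] by simp
next
  case (insert i I)
  have i: "i \<ge> 1" "i \<notin> J" using insert.prems by auto
  note [measurable] = offspring_measurable[OF i(1)]
  have Ih: "(\<lambda>\<omega>. \<Prod>i\<in>I. h (X n i \<omega>)) \<in> borel_measurable M"
    using insert.prems by (intro borel_measurable_prod_ennreal measurable_compose[OF offspring_measurable]) auto
  note [measurable] = Ih offspring_event_measurable[OF insert.prems(2,3), of n k]
  let ?J = "\<lambda>k J. {\<omega> \<in> space M. \<forall>i\<in>J. X n i \<omega> = k i}"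
  let ?q = "\<lambda>\<omega> a. ennreal (pmf (p (\<xi> n \<omega>)) a)"
  have "(\<integral>\<^sup>+\<omega>. g \<omega> * indicator (history n z) \<omega> * indicator (?J k J) \<omega> * (\<Prod>i\<in>insert i I. h (X n i \<omega>)) \<partial>M)
    = (\<integral>\<^sup>+\<omega>. (\<Sum>a. h a * (g \<omega> * indicator (history n z) \<omega> * indicator (?J k J) \<omega> *
          indicator {\<omega> \<in> space M. X n i \<omega> = a} \<omega> * (\<Prod>i\<in>I. h (X n i \<omega>)))) \<partial>M)"
  proof (intro nn_integral_cong)
    fix \<omega> assume \<omega>: "\<omega> \<in> space M"
    show "g \<omega> * indicator (history n z) \<omega> * indicator (?J k J) \<omega> * (\<Prod>i\<in>insert i I. h (X n i \<omega>))
      = (\<Sum>a. h a * (g \<omega> * indicator (history n z) \<omega> * indicator (?J k J) \<omega> *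
          indicator {\<omega> \<in> space M. X n i \<omega> = a} \<omega> * (\<Prod>i\<in>I. h (X n i \<omega>))))"
      using \<omega> insert.hyps by (subst suminf_finite[of "{X n i \<omega>}"]) (auto simp: indicator_def ac_simps)
  qed
  also have "\<dots> = (\<Sum>a. h a * (\<integral>\<^sup>+\<omega>. g \<omega> * indicator (history n z) \<omega> * indicator (?J k J) \<omega> *
          indicator {\<omega> \<in> space M. X n i \<omega> = a} \<omega> * (\<Prod>i\<in>I. h (X n i \<omega>)) \<partial>M))"
    by (subst nn_integral_suminf) (auto intro!: arg_cong[where f = suminf] nn_integral_cmult)
  also have "\<dots> = (\<Sum>a. h a * (\<integral>\<^sup>+\<omega>. g \<omega> * indicator (history n z) \<omega> * indicator (?J (k(i := a)) (insert i J)) \<omega>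
         * (\<Prod>i\<in>I. h (X n i \<omega>)) \<partial>M))"
  proof -
    have "(\<forall>j\<in>insert i J. X n j \<omega> = (k(i := a)) j) \<longleftrightarrow> X n i \<omega> = a \<and> (\<forall>j\<in>J. X n j \<omega> = k j)" for a \<omega>
      using i(2) by (metis fun_upd_apply insert_iff)
    then have "(\<integral>\<^sup>+\<omega>. g \<omega> * indicator (history n z) \<omega> * indicator (?J k J) \<omega> *
          indicator {\<omega> \<in> space M. X n i \<omega> = a} \<omega> * (\<Prod>i\<in>I. h (X n i \<omega>)) \<partial>M)
      = (\<integral>\<^sup>+\<omega>. g \<omega> * indicator (history n z) \<omega> * indicator (?J (k(i := a)) (insert i J)) \<omega>
         * (\<Prod>i\<in>I. h (X n i \<omega>)) \<partial>M)" for a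
      by (intro nn_integral_cong) (simp add: indicator_def)
    then show ?thesis by simp
  qed
  also have "\<dots> = (\<Sum>a. h a * (\<integral>\<^sup>+\<omega>. g \<omega> * indicator (history n z) \<omega> *
         (\<Prod>j\<in>insert i J. ?q \<omega> ((k(i := a)) j)) * offspring_nn (p (\<xi> n \<omega>)) h ^ card I \<partial>M))"
    using insert.prems insert.hyps by (subst insert.IH) auto
  also have "\<dots> = (\<Sum>a. h a * (\<integral>\<^sup>+\<omega>. g \<omega> * indicator (history n z) \<omega> *
         (?q \<omega> a * (\<Prod>j\<in>J. ?q \<omega> (k j))) * offspring_nn (p (\<xi> n \<omega>)) h ^ card I \<partial>M))"
  proof (intro arg_cong[where f = suminf] ext arg_cong2[where f = "(*)"] refl nn_integral_cong)
    fix a \<omega>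
    have "(\<Prod>j\<in>J. ?q \<omega> ((k(i := a)) j)) = (\<Prod>j\<in>J. ?q \<omega> (k j))"
      using i(2) by (intro prod.cong) auto
    then show "(\<Prod>j\<in>insert i J. ?q \<omega> ((k(i := a)) j)) = ?q \<omega> a * (\<Prod>j\<in>J. ?q \<omega> (k j))"
      using i(2) insert.prems(2) by simp
  qed
  also have "\<dots> = (\<integral>\<^sup>+\<omega>. (\<Sum>a. h a * (g \<omega> * indicator (history n z) \<omega> *
         (?q \<omega> a * (\<Prod>j\<in>J. ?q \<omega> (k j))) * offspring_nn (p (\<xi> n \<omega>)) h ^ card I)) \<partial>M)"
    by (subst nn_integral_suminf) (auto intro!: arg_cong[where f = suminf] nn_integral_cmult[symmetric])
  also have "\<dots> = (\<integral>\<^sup>+\<omega>. (\<Sum>a. (g \<omega> * indicator (history n z) \<omega> *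
         (\<Prod>j\<in>J. ?q \<omega> (k j)) * offspring_nn (p (\<xi> n \<omega>)) h ^ card I) * (?q \<omega> a * h a)) \<partial>M)"
    by (intro nn_integral_cong arg_cong[where f = suminf] ext) (simp add: ac_simps)
  also have "\<dots> = (\<integral>\<^sup>+\<omega>. g \<omega> * indicator (history n z) \<omega> *
         (\<Prod>j\<in>J. ?q \<omega> (k j)) * offspring_nn (p (\<xi> n \<omega>)) h ^ card (insert i I) \<partial>M)"
    unfolding ennreal_suminf_cmult offspring_nn_def[symmetric] using insert.hyps by (simp add: ac_simps)
  finally show ?case .
qed

lemma quenched_prod_history:
  assumes "finite I" "I \<subseteq> {1..}" and g: "g \<in> borel_measurable F"
  shows "(\<integral>\<^sup>+\<omega>. g \<omega> * indicator (history n z) \<omega> * (\<Prod>i\<in>I. h (X n i \<omega>)) \<partial>M)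
    = (\<integral>\<^sup>+\<omega>. g \<omega> * indicator (history n z) \<omega> * offspring_nn (p (\<xi> n \<omega>)) h ^ card I \<partial>M)"
proof -
  have "(\<integral>\<^sup>+\<omega>. g \<omega> * indicator (history n z) \<omega> * (\<Prod>i\<in>I. h (X n i \<omega>)) \<partial>M)
    = (\<integral>\<^sup>+\<omega>. g \<omega> * indicator (history n z) \<omega> * indicator {\<omega> \<in> space M. \<forall>i\<in>{}. X n i \<omega> = k i} \<omega>
        * (\<Prod>i\<in>I. h (X n i \<omega>)) \<partial>M)" for k
    by (intro nn_integral_cong) (simp add: indicator_def)
  then show ?thesis
    using quenched_prod_history_aux[OF assms(1,2) finite.emptyI _ _ g, of n z _ h] by simp
qed

text \<open>The history \<open>(Z 1, \<dots>, Z n)\<close> takes countably many values, so an identity may be checked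
  on each of them, where \<open>Z n\<close> is a constant.\<close>

lemma nn_integral_eqI_history:
  assumes f: "f \<in> borel_measurable M" "g \<in> borel_measurable M"
    and eq: "\<And>z. (\<integral>\<^sup>+\<omega>. f \<omega> * indicator (history n z) \<omega> \<partial>M) = (\<integral>\<^sup>+\<omega>. g \<omega> * indicator (history n z) \<omega> \<partial>M)"
  shows "(\<integral>\<^sup>+\<omega>. f \<omega> \<partial>M) = (\<integral>\<^sup>+\<omega>. g \<omega> \<partial>M)"
proof (rule nn_integral_eqI_countable_partition[where K = "\<lambda>\<omega>. restrict (\<lambda>j. Z j \<omega>) {1..n}" and C = "PiE {1..n} (\<lambda>_. UNIV)"])
  have h: "{\<omega> \<in> space M. restrict (\<lambda>j. Z j \<omega>) {1..n} = c} = history n c" if "c \<in> PiE {1..n} (\<lambda>_. UNIV)" for c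
    unfolding history_def
  proof (intro Collect_cong conj_cong refl iffI)
    fix \<omega> assume "restrict (\<lambda>j. Z j \<omega>) {1..n} = c" then show "\<forall>j\<in>{1..n}. Z j \<omega> = c j" by auto
  next
    fix \<omega> assume "\<forall>j\<in>{1..n}. Z j \<omega> = c j" then show "restrict (\<lambda>j. Z j \<omega>) {1..n} = c"
      using that by (intro ext) (auto simp: PiE_def extensional_def restrict_def)
  qed
  show "countable (PiE {1..n} (\<lambda>_. UNIV :: nat set))" by (intro countable_PiE) auto
  fix c assume "c \<in> PiE {1..n} (\<lambda>_. UNIV :: nat set)"
  from h[OF this] eq
  show "{\<omega> \<in> space M. restrict (\<lambda>j. Z j \<omega>) {1..n} = c} \<in> sets M"
    "(\<integral>\<^sup>+\<omega>. f \<omega> * indicator {\<omega> \<in> space M. restrict (\<lambda>j. Z j \<omega>) {1..n} = c} \<omega> \<partial>M)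
      = (\<integral>\<^sup>+\<omega>. g \<omega> * indicator {\<omega> \<in> space M. restrict (\<lambda>j. Z j \<omega>) {1..n} = c} \<omega> \<partial>M)" by auto
qed (use f in auto)

lemma Z_on_history: "\<omega> \<in> history n z \<Longrightarrow> Z n \<omega> = (if n = 0 then 1 else z n)"
  unfolding history_def using Z_0 by (cases n) auto

text \<open>On each history the random number of factors and the weight
  \<open>g (Z n \<omega>)\<close> are fixed, so the formula for a fixed index set applies. A weight
  depending on \<open>Z n\<close> is what the exponential Chebyshev bound will use.\<close>

lemma quenched_prod:
  assumes g: "\<And>z. g z \<in> borel_measurable F"
  shows "(\<integral>\<^sup>+\<omega>. g (Z n \<omega>) \<omega> * (\<Prod>i\<in>{1..Z n \<omega>}. h (X n i \<omega>)) \<partial>M)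
    = (\<integral>\<^sup>+\<omega>. g (Z n \<omega>) \<omega> * offspring_nn (p (\<xi> n \<omega>)) h ^ Z n \<omega> \<partial>M)"
proof (rule nn_integral_eqI_history[of _ _ n])
  fix z :: "nat \<Rightarrow> nat"
  let ?z = "if n = 0 then 1 else z n"
  have "(\<integral>\<^sup>+\<omega>. g (Z n \<omega>) \<omega> * (\<Prod>i\<in>{1..Z n \<omega>}. h (X n i \<omega>)) * indicator (history n z) \<omega> \<partial>M)
    = (\<integral>\<^sup>+\<omega>. g ?z \<omega> * indicator (history n z) \<omega> * (\<Prod>i\<in>{1..?z}. h (X n i \<omega>)) \<partial>M)"
    by (intro nn_integral_cong) (auto simp: indicator_def Z_on_history)
  also have "\<dots> = (\<integral>\<^sup>+\<omega>. g ?z \<omega> * indicator (history n z) \<omega> * offspring_nn (p (\<xi> n \<omega>)) h ^ card {1..?z} \<partial>M)"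
    by (rule quenched_prod_history) (use g in auto)
  also have "\<dots> = (\<integral>\<^sup>+\<omega>. g (Z n \<omega>) \<omega> * offspring_nn (p (\<xi> n \<omega>)) h ^ Z n \<omega> * indicator (history n z) \<omega> \<partial>M)"
    by (intro nn_integral_cong) (auto simp: indicator_def Z_on_history)
  finally show "(\<integral>\<^sup>+\<omega>. g (Z n \<omega>) \<omega> * (\<Prod>i\<in>{1..Z n \<omega>}. h (X n i \<omega>)) * indicator (history n z) \<omega> \<partial>M)
    = (\<integral>\<^sup>+\<omega>. g (Z n \<omega>) \<omega> * offspring_nn (p (\<xi> n \<omega>)) h ^ Z n \<omega> * indicator (history n z) \<omega> \<partial>M)" .
next
  note [measurable] = g
  show "(\<lambda>\<omega>. g (Z n \<omega>) \<omega> * (\<Prod>i\<in>{1..Z n \<omega>}. h (X n i \<omega>))) \<in> borel_measurable M"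
    by (rule compose_Z_measurable)
      (intro borel_measurable_times_ennreal borel_measurable_prod_ennreal measurable_compose[OF offspring_measurable] F_measurable_imp g, auto)
  show "(\<lambda>\<omega>. g (Z n \<omega>) \<omega> * offspring_nn (p (\<xi> n \<omega>)) h ^ Z n \<omega>) \<in> borel_measurable M"
    by (rule compose_Z_measurable) measurable
qed

lemma quenched_sum:
  assumes g: "\<And>z. g z \<in> borel_measurable F"
  shows "(\<integral>\<^sup>+\<omega>. g (Z n \<omega>) \<omega> * (\<Sum>i\<in>{1..Z n \<omega>}. h (X n i \<omega>)) \<partial>M)
    = (\<integral>\<^sup>+\<omega>. g (Z n \<omega>) \<omega> * (of_nat (Z n \<omega>) * offspring_nn (p (\<xi> n \<omega>)) h) \<partial>M)"
proof (rule nn_integral_eqI_history[of _ _ n])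
  fix z :: "nat \<Rightarrow> nat"
  note [measurable] = g
  let ?z = "if n = 0 then 1 else z n"
  have "(\<integral>\<^sup>+\<omega>. g (Z n \<omega>) \<omega> * (\<Sum>i\<in>{1..Z n \<omega>}. h (X n i \<omega>)) * indicator (history n z) \<omega> \<partial>M)
    = (\<integral>\<^sup>+\<omega>. (\<Sum>i\<in>{1..?z}. g ?z \<omega> * indicator (history n z) \<omega> * h (X n i \<omega>)) \<partial>M)"
    by (intro nn_integral_cong) (auto simp: indicator_def Z_on_history sum_distrib_left)
  also have "\<dots> = (\<Sum>i\<in>{1..?z}. (\<integral>\<^sup>+\<omega>. g ?z \<omega> * indicator (history n z) \<omega> * h (X n i \<omega>) \<partial>M))"
  proof (rule nn_integral_sum)
    fix i assume "i \<in> {1..?z}"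
    then have [measurable]: "X n i \<in> measurable M (count_space UNIV)" by (intro offspring_measurable) auto
    show "(\<lambda>\<omega>. g ?z \<omega> * indicator (history n z) \<omega> * h (X n i \<omega>)) \<in> borel_measurable M"
      by measurable
  qed
  also have "\<dots> = (\<Sum>i\<in>{1..?z}. (\<integral>\<^sup>+\<omega>. g ?z \<omega> * indicator (history n z) \<omega> * offspring_nn (p (\<xi> n \<omega>)) h \<partial>M))"
    by (rule sum.cong[OF refl]) (use quenched_prod_history[of "{_}", OF _ _ g] in simp)
  also have "\<dots> = of_nat ?z * (\<integral>\<^sup>+\<omega>. g ?z \<omega> * indicator (history n z) \<omega> * offspring_nn (p (\<xi> n \<omega>)) h \<partial>M)"
    by simp
  also have "\<dots> = (\<integral>\<^sup>+\<omega>. of_nat ?z * (g ?z \<omega> * indicator (history n z) \<omega> * offspring_nn (p (\<xi> n \<omega>)) h) \<partial>M)"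
    by (rule nn_integral_cmult[symmetric]) measurable
  also have "\<dots> = (\<integral>\<^sup>+\<omega>. g (Z n \<omega>) \<omega> * (of_nat (Z n \<omega>) * offspring_nn (p (\<xi> n \<omega>)) h) * indicator (history n z) \<omega> \<partial>M)"
    by (intro nn_integral_cong) (auto simp: indicator_def Z_on_history ac_simps)
  finally show "(\<integral>\<^sup>+\<omega>. g (Z n \<omega>) \<omega> * (\<Sum>i\<in>{1..Z n \<omega>}. h (X n i \<omega>)) * indicator (history n z) \<omega> \<partial>M)
    = (\<integral>\<^sup>+\<omega>. g (Z n \<omega>) \<omega> * (of_nat (Z n \<omega>) * offspring_nn (p (\<xi> n \<omega>)) h) * indicator (history n z) \<omega> \<partial>M)" .
next
  note [measurable] = g
  show "(\<lambda>\<omega>. g (Z n \<omega>) \<omega> * (\<Sum>i\<in>{1..Z n \<omega>}. h (X n i \<omega>))) \<in> borel_measurable M"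
    by (rule compose_Z_measurable)
      (intro borel_measurable_times_ennreal borel_measurable_sum measurable_compose[OF offspring_measurable] F_measurable_imp g, auto)
  show "(\<lambda>\<omega>. g (Z n \<omega>) \<omega> * (of_nat (Z n \<omega>) * offspring_nn (p (\<xi> n \<omega>)) h)) \<in> borel_measurable M"
    by (rule compose_Z_measurable) measurable
qed

end

section \<open>Branching processes and the product of the means\<close>

lemma offspring_nn_mono: "(\<And>a. pmf q a \<noteq> 0 \<Longrightarrow> h a \<le> h' a) \<Longrightarrow> offspring_nn q h \<le> offspring_nn q h'"
  unfolding offspring_nn_def
proof (rule suminf_le)
  fix a assume "\<And>a. pmf q a \<noteq> 0 \<Longrightarrow> h a \<le> h' a"
  then show "ennreal (pmf q a) * h a \<le> ennreal (pmf q a) * h' a"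
    by (cases "pmf q a = 0") (auto intro: mult_left_mono)
qed auto

lemma offspring_nn_add: "offspring_nn q (\<lambda>a. h a + h' a) = offspring_nn q h + offspring_nn q h'"
  unfolding offspring_nn_def by (simp add: distrib_left suminf_add[symmetric])

lemma offspring_nn_cmult: "offspring_nn q (\<lambda>a. c * h a) = c * offspring_nn q h"
  unfolding offspring_nn_def ennreal_suminf_cmult[symmetric] by (simp add: ac_simps)

lemma offspring_nn_one: "offspring_nn q (\<lambda>_. 1) = 1"
proof -
  have "offspring_nn q (\<lambda>_. 1) = (\<integral>\<^sup>+a. ennreal (pmf q a) \<partial>count_space UNIV)"
    by (simp only: offspring_nn_def nn_integral_count_space_nat mult_1_right)
  also have "\<dots> = emeasure q UNIV" by (rule nn_integral_pmf)
  finally show ?thesis using measure_pmf.emeasure_space_1[of q] by simp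
qed

lemma offspring_nn_mean:
  assumes "summable (\<lambda>k. real k * pmf q k)"
  shows "offspring_nn q (\<lambda>k. ennreal (real k)) = ennreal (offspring_mean q)"
proof -
  have "offspring_nn q (\<lambda>k. ennreal (real k)) = (\<Sum>k. ennreal (real k * pmf q k))"
    unfolding offspring_nn_def by (simp add: ennreal_mult' ac_simps)
  also have "\<dots> = ennreal (offspring_mean q)"
    unfolding offspring_mean_def by (rule suminf_ennreal2) (use assms in auto)
  finally show ?thesis .
qed

lemma summable_mean_iff:
  "summable (\<lambda>k. real k * pmf q k) \<longleftrightarrow> offspring_nn q (\<lambda>k. ennreal (real k)) \<noteq> \<top>"
proof
  assume "offspring_nn q (\<lambda>k. ennreal (real k)) \<noteq> \<top>"
  moreover have "offspring_nn q (\<lambda>k. ennreal (real k)) = (\<Sum>k. ennreal (real k * pmf q k))"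
    unfolding offspring_nn_def by (simp add: ennreal_mult' ac_simps)
  ultimately show "summable (\<lambda>k. real k * pmf q k)"
    by (intro summable_suminf_not_top) auto
qed (simp add: offspring_nn_mean)

lemma offspring_mean_ge_one:
  assumes "summable (\<lambda>k. real k * pmf q k)" "pmf q 0 = 0"
  shows "1 \<le> offspring_mean q"
proof -
  have "offspring_nn q (\<lambda>_. 1) \<le> offspring_nn q (\<lambda>k. ennreal (real k))"
    using assms(2) by (intro offspring_nn_mono) (metis One_nat_def Suc_leI ennreal_1 ennreal_leI neq0_conv of_nat_1 of_nat_mono)
  then show ?thesis unfolding offspring_nn_one offspring_nn_mean[OF assms(1)]
    by (metis ennreal_1 ennreal_le_iff2 not_one_le_zero)
qed

text \<open>The AM-HM inequality, obtained by summing the tangent bound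
  \<open>1 / x \<ge> 2 / A - x / A\<^sup>2\<close> at the arithmetic mean \<open>A\<close>.\<close>

lemma harmonic_le_arithmetic:
  fixes x :: "nat \<Rightarrow> real"
  assumes n: "n \<ge> 1" and x: "\<And>i. i \<in> {1..n} \<Longrightarrow> x i > 0"
  shows "1 / (\<Sum>i\<in>{1..n}. x i) \<le> 1 / (real n)\<^sup>2 * (\<Sum>i\<in>{1..n}. 1 / x i)"
proof -
  define s where "s = (\<Sum>i\<in>{1..n}. x i)"
  have s: "s > 0" unfolding s_def using n x by (intro sum_pos) auto
  define A where "A = s / n"
  have A: "A > 0" using s n by (simp add: A_def)
  have "(\<Sum>i\<in>{1..n}. 2 / A - x i / A\<^sup>2) \<le> (\<Sum>i\<in>{1..n}. 1 / x i)"
  proof (rule sum_mono)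
    fix i assume "i \<in> {1..n}"
    then have xi: "x i > 0" by (rule x)
    have "2 * A * x i - (x i)\<^sup>2 \<le> A\<^sup>2"
      using zero_le_power2[of "x i - A"] by (simp add: power2_eq_square algebra_simps)
    then have "(2 * A * x i - (x i)\<^sup>2) / (A\<^sup>2 * x i) \<le> A\<^sup>2 / (A\<^sup>2 * x i)"
      using xi A by (intro divide_right_mono) auto
    moreover have "(2 * A * x i - (x i)\<^sup>2) / (A\<^sup>2 * x i) = 2 / A - x i / A\<^sup>2"
      using xi A by (simp add: field_simps power2_eq_square)
    moreover have "A\<^sup>2 / (A\<^sup>2 * x i) = 1 / x i" using A by simp
    ultimately show "2 / A - x i / A\<^sup>2 \<le> 1 / x i" by simp
  qed
  also have "(\<Sum>i\<in>{1..n}. 2 / A - x i / A\<^sup>2) = n * (2 / A) - s / A\<^sup>2"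
    by (simp add: sum_subtractf sum_divide_distrib[symmetric] s_def)
  also have "\<dots> = (real n)\<^sup>2 * (1 / s)"
    using s n by (simp add: A_def field_simps power2_eq_square)
  finally have "(real n)\<^sup>2 * (1 / s) / (real n)\<^sup>2 \<le> (\<Sum>i\<in>{1..n}. 1 / x i) / (real n)\<^sup>2"
    by (rule divide_right_mono) simp
  then show ?thesis using n by (simp add: s_def)
qed

lemma exp_minus_le_quadratic:
  assumes "x \<ge> (0::real)"
  shows "exp (- x) \<le> 1 - x + x\<^sup>2 / 2"
proof -
  \<comment> \<open>The two quadratics multiply to 1 + x^4 / 4, so the Taylor lower bound for
    \<open>exp x\<close> turns into an upper bound for its reciprocal.\<close>
  have "1 \<le> 1 + (x * x)\<^sup>2 / 4" by simp
  also have "\<dots> = (1 - x + x\<^sup>2 / 2) * (1 + x + x\<^sup>2 / 2)"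
    by (simp add: power2_eq_square field_simps)
  also have "\<dots> \<le> (1 - x + x\<^sup>2 / 2) * exp x"
  proof (rule mult_left_mono)
    have "0 \<le> ((1 - x)\<^sup>2 + 1) / 2" by simp
    also have "\<dots> = 1 - x + x\<^sup>2 / 2" by (simp add: power2_eq_square field_simps)
    finally show "0 \<le> 1 - x + x\<^sup>2 / 2" .
  qed (rule exp_lower_Taylor_quadratic[OF assms])
  finally show ?thesis by (simp add: exp_minus field_simps)
qed

lemma suminf_ennreal_finite:
  fixes u :: "nat \<Rightarrow> real"
  assumes "summable u" "\<And>n. 0 \<le> u n" "\<And>n. f n \<le> ennreal (u n)"
  shows "(\<Sum>n. f n) < \<infinity>"
proof -
  have "(\<Sum>n. f n) \<le> (\<Sum>n. ennreal (u n))" by (intro suminf_le assms(3)) auto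
  also have "\<dots> = ennreal (\<Sum>n. u n)" by (rule suminf_ennreal2) (use assms in auto)
  finally show ?thesis by (simp add: le_less_trans)
qed

section \<open>Exponential growth and the polynomial upper bound\<close>

text \<open>Positivity of the drift enters as \<open>nondegenerate\<close>: without deaths,
  exponential growth follows as soon as the offspring law is not almost surely the point mass at
  1.\<close>

locale supercritical_branching = branching_process_iid_env M E \<xi> p X Z
  for M :: "'w measure" and E :: "'e measure" and \<xi> p X Z +
  assumes mean_finite: "AE \<omega> in M. summable (\<lambda>k. real k * pmf (p (\<xi> 0 \<omega>)) k)"
    and no_death: "AE \<omega> in M. pmf (p (\<xi> 0 \<omega>)) 0 = 0"
    and nondegenerate: "\<not> (AE \<omega> in M. pmf (p (\<xi> 0 \<omega>)) 1 = 1)"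
    and Z_log_Z: "integrable M (\<lambda>\<omega>. real (Z 1 \<omega>) / offspring_mean (p (\<xi> 0 \<omega>)) * ln (real (Z 1 \<omega>)))"
begin

definition m :: "nat \<Rightarrow> 'w \<Rightarrow> real" where "m n \<omega> = offspring_mean (p (\<xi> n \<omega>))"

lemma offspring_mean_measurable [measurable]: "(\<lambda>e. offspring_mean (p e)) \<in> borel_measurable E"
  unfolding offspring_mean_def by measurable

lemma m_measurable [measurable]: "m n \<in> borel_measurable F"
  unfolding m_def by measurable

lemma AE_env_shift:
  assumes "{e \<in> space E. Q e} \<in> sets E" "AE \<omega> in M. Q (\<xi> 0 \<omega>)"
  shows "AE \<omega> in M. Q (\<xi> n \<omega>)"
  using assms(2) AE_distr_iff[OF env_measurable assms(1), of n] AE_distr_iff[OF env_measurable assms(1), of 0]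
  by (simp only: env_ident[of n])

lemma nn_integral_env_shift:
  assumes "u \<in> borel_measurable E"
  shows "(\<integral>\<^sup>+\<omega>. u (\<xi> n \<omega>) \<partial>M) = (\<integral>\<^sup>+\<omega>. u (\<xi> 0 \<omega>) \<partial>M)"
proof -
  have "(\<integral>\<^sup>+e. u e \<partial>distr M E (\<xi> n)) = (\<integral>\<^sup>+\<omega>. u (\<xi> n \<omega>) \<partial>M)" for n
    using assms by (intro nn_integral_distr) auto
  from this[of n] this[of 0] show ?thesis by (simp only: env_ident[of n])
qed

lemma env_regular:
  "AE \<omega> in M. \<forall>n. summable (\<lambda>k. real k * pmf (p (\<xi> n \<omega>)) k) \<and> pmf (p (\<xi> n \<omega>)) 0 = 0 \<and> 1 \<le> m n \<omega>"
proof -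
  have "AE \<omega> in M. summable (\<lambda>k. real k * pmf (p (\<xi> n \<omega>)) k) \<and> pmf (p (\<xi> n \<omega>)) 0 = 0" for n
  proof (rule AE_env_shift)
    note [measurable] = offspring_nn_measurable_env
    show "{e \<in> space E. summable (\<lambda>k. real k * pmf (p e) k) \<and> pmf (p e) 0 = 0} \<in> sets E"
      unfolding summable_mean_iff by measurable
  qed (use mean_finite no_death in auto)
  then have "AE \<omega> in M. \<forall>n. summable (\<lambda>k. real k * pmf (p (\<xi> n \<omega>)) k) \<and> pmf (p (\<xi> n \<omega>)) 0 = 0"
    by (simp add: AE_all_countable)
  then show ?thesis by eventually_elim (auto simp: m_def intro: offspring_mean_ge_one)
qed

text \<open>The expected number of childless individuals in generation \<open>n\<close> is the
  integral of \<open>Z n\<close> times the probability of no offspring, which is 0. Positivity of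
  every \<open>Z n\<close> then follows by induction along the path.\<close>

lemma no_extinction:
  "AE \<omega> in M. \<forall>n. 1 \<le> Z n \<omega> \<and> (\<forall>i\<in>{1..Z n \<omega>}. 1 \<le> X n i \<omega>)"
proof -
  let ?h = "\<lambda>a::nat. if a = 0 then 1 else (0::ennreal)"
  have "AE \<omega> in M. (\<Sum>i\<in>{1..Z n \<omega>}. ?h (X n i \<omega>)) = 0" for n
  proof -
    have "offspring_nn (p (\<xi> n \<omega>)) ?h = ennreal (pmf (p (\<xi> n \<omega>)) 0)" for \<omega>
      unfolding offspring_nn_def by (subst suminf_finite[of "{0}"]) auto
    then have "(\<integral>\<^sup>+\<omega>. 1 * (\<Sum>i\<in>{1..Z n \<omega>}. ?h (X n i \<omega>)) \<partial>M)
      = (\<integral>\<^sup>+\<omega>. 1 * (of_nat (Z n \<omega>) * ennreal (pmf (p (\<xi> n \<omega>)) 0)) \<partial>M)"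
      using quenched_sum[of "\<lambda>_ _. 1" n ?h] by simp
    also have "\<dots> = (\<integral>\<^sup>+\<omega>. 0 \<partial>M)"
      using env_regular by (intro nn_integral_cong_AE) (auto elim: AE_mp)
    finally have "(\<integral>\<^sup>+\<omega>. (\<Sum>i\<in>{1..Z n \<omega>}. ?h (X n i \<omega>)) \<partial>M) = 0" by simp
    moreover have "(\<lambda>\<omega>. \<Sum>i\<in>{1..Z n \<omega>}. ?h (X n i \<omega>)) \<in> borel_measurable M"
      by (rule compose_Z_measurable)
        (intro borel_measurable_sum measurable_compose[OF offspring_measurable], auto)
    ultimately show ?thesis by (subst (asm) nn_integral_0_iff_AE) auto
  qed
  then have "AE \<omega> in M. \<forall>n. (\<Sum>i\<in>{1..Z n \<omega>}. ?h (X n i \<omega>)) = 0"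
    by (simp add: AE_all_countable)
  then show ?thesis
  proof (rule AE_mp, intro AE_I2 impI)
    fix \<omega> assume \<omega>: "\<omega> \<in> space M" and z: "\<forall>n. (\<Sum>i\<in>{1..Z n \<omega>}. ?h (X n i \<omega>)) = 0"
    have X: "\<forall>i\<in>{1..Z n \<omega>}. 1 \<le> X n i \<omega>" for n
    proof
      fix i assume "i \<in> {1..Z n \<omega>}"
      then have "?h (X n i \<omega>) = 0" using z by (simp only: sum_eq_0_iff finite_atLeastAtMost)
      then show "1 \<le> X n i \<omega>" by (auto split: if_splits)
    qed
    have "1 \<le> Z n \<omega>" for n
    proof (induction n)
      case (Suc n)
      have "X n 1 \<omega> \<le> (\<Sum>i\<in>{1..Z n \<omega>}. X n i \<omega>)"
        using Suc by (intro member_le_sum) auto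
      moreover have "1 \<le> X n 1 \<omega>" using X[of n] Suc by auto
      ultimately show ?case using Z_Suc[OF \<omega>, of n] by simp
    qed (simp add: Z_0[OF \<omega>])
    with X show "\<forall>n. 1 \<le> Z n \<omega> \<and> (\<forall>i\<in>{1..Z n \<omega>}. 1 \<le> X n i \<omega>)" by blast
  qed
qed

text \<open>An upper bound for the quenched mean of the reciprocal of an offspring number:
  \<open>1 / a\<close> is 1 at \<open>a = 1\<close> and at most 1/2 for
  \<open>a \<ge> 2\<close>.\<close>

definition growth_factor :: "nat \<Rightarrow> 'w \<Rightarrow> ennreal" where
  "growth_factor n \<omega> = ennreal (1 / 2 + pmf (p (\<xi> n \<omega>)) 1 / 2)"

lemma growth_factor_measurable [measurable]: "growth_factor n \<in> borel_measurable F"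
  unfolding growth_factor_def by measurable

lemma growth_factor_eq: "growth_factor n \<omega> = offspring_nn (p (\<xi> n \<omega>)) (\<lambda>a. ennreal (1 / 2) + (if a = 1 then ennreal (1 / 2) else 0))"
proof -
  have "offspring_nn q (\<lambda>a. if a = 1 then ennreal (1 / 2) else 0) = ennreal (pmf q 1 / 2)" for q
    unfolding offspring_nn_def
    by (subst suminf_finite[of "{1}"]) (auto simp: ennreal_mult'[symmetric] simp del: ennreal_half)
  then show ?thesis
    using offspring_nn_cmult[of "p (\<xi> n \<omega>)" "ennreal (1 / 2)" "\<lambda>_. 1"]
    by (simp add: offspring_nn_add offspring_nn_one growth_factor_def ennreal_plus[symmetric] del: ennreal_half ennreal_plus)
qed

text \<open>By AM-HM, \<open>1 / Z (Suc n)\<close> is at most the sum of the reciprocal offspring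
  numbers over \<open>(Z n)\<^sup>2\<close>; averaging that sum leaves \<open>1 / Z n\<close> times
  a growth factor. The weight \<open>g\<close> is general so that the induction can absorb this
  factor.\<close>

lemma inverse_Z_moment:
  assumes "g \<in> borel_measurable F"
  shows "(\<integral>\<^sup>+\<omega>. g \<omega> * ennreal (1 / Z n \<omega>) \<partial>M) \<le> (\<integral>\<^sup>+\<omega>. g \<omega> * (\<Prod>j<n. growth_factor j \<omega>) \<partial>M)"
  using assms
proof (induction n arbitrary: g)
  case 0
  show ?case by (intro nn_integral_mono) (simp add: Z_0)
next
  case (Suc n)
  note [measurable] = Suc.prems
  let ?h = "\<lambda>a::nat. ennreal (1 / 2) + (if a = 1 then ennreal (1 / 2) else 0)"
  have "(\<integral>\<^sup>+\<omega>. g \<omega> * ennreal (1 / Z (Suc n) \<omega>) \<partial>M)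
    \<le> (\<integral>\<^sup>+\<omega>. g \<omega> * ennreal (1 / (real (Z n \<omega>))\<^sup>2) * (\<Sum>i\<in>{1..Z n \<omega>}. ?h (X n i \<omega>)) \<partial>M)"
  proof (rule nn_integral_mono_AE)
    have "AE \<omega> in M. \<omega> \<in> space M" by simp
    with no_extinction show "AE \<omega> in M. g \<omega> * ennreal (1 / Z (Suc n) \<omega>)
       \<le> g \<omega> * ennreal (1 / (real (Z n \<omega>))\<^sup>2) * (\<Sum>i\<in>{1..Z n \<omega>}. ?h (X n i \<omega>))"
    proof eventually_elim
      case (elim \<omega>)
      then have z: "1 \<le> Z n \<omega>" and x: "\<And>i. i \<in> {1..Z n \<omega>} \<Longrightarrow> 1 \<le> X n i \<omega>" by auto
      have "1 / real (Z (Suc n) \<omega>) = 1 / (\<Sum>i\<in>{1..Z n \<omega>}. real (X n i \<omega>))"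
        using elim by (simp add: Z_Suc)
      also have "\<dots> \<le> 1 / (real (Z n \<omega>))\<^sup>2 * (\<Sum>i\<in>{1..Z n \<omega>}. 1 / real (X n i \<omega>))"
        using x by (intro harmonic_le_arithmetic z) force
      finally have "ennreal (1 / real (Z (Suc n) \<omega>))
          \<le> ennreal (1 / (real (Z n \<omega>))\<^sup>2) * (\<Sum>i\<in>{1..Z n \<omega>}. ennreal (1 / real (X n i \<omega>)))"
        by (subst sum_ennreal) (auto simp: ennreal_mult'[symmetric] intro!: ennreal_leI)
      also have "\<dots> \<le> ennreal (1 / (real (Z n \<omega>))\<^sup>2) * (\<Sum>i\<in>{1..Z n \<omega>}. ?h (X n i \<omega>))"
      proof (intro mult_left_mono sum_mono)
        fix i assume "i \<in> {1..Z n \<omega>}"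
        from x[OF this] show "ennreal (1 / real (X n i \<omega>)) \<le> ?h (X n i \<omega>)"
          by (cases "X n i \<omega> = 1") (auto simp: ennreal_plus[symmetric] field_simps simp del: ennreal_plus ennreal_half intro!: ennreal_leI)
      qed simp
      finally show ?case by (simp add: mult.assoc mult_left_mono)
    qed
  qed
  also have "\<dots> = (\<integral>\<^sup>+\<omega>. g \<omega> * ennreal (1 / (real (Z n \<omega>))\<^sup>2) * (of_nat (Z n \<omega>) * growth_factor n \<omega>) \<partial>M)"
    unfolding growth_factor_eq by (rule quenched_sum[of "\<lambda>z \<omega>. g \<omega> * ennreal (1 / (real z)\<^sup>2)"]) measurable
  also have "\<dots> = (\<integral>\<^sup>+\<omega>. g \<omega> * growth_factor n \<omega> * ennreal (1 / Z n \<omega>) \<partial>M)"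
  proof (rule nn_integral_cong_AE)
    show "AE \<omega> in M. g \<omega> * ennreal (1 / (real (Z n \<omega>))\<^sup>2) * (of_nat (Z n \<omega>) * growth_factor n \<omega>)
       = g \<omega> * growth_factor n \<omega> * ennreal (1 / Z n \<omega>)"
      using no_extinction
    proof eventually_elim
      case (elim \<omega>)
      have "ennreal (1 / (real (Z n \<omega>))\<^sup>2) * of_nat (Z n \<omega>) = ennreal (1 / Z n \<omega>)"
        unfolding ennreal_of_nat_eq_real_of_nat using elim[rule_format, of n]
        by (subst ennreal_mult'[symmetric]) (auto simp: power2_eq_square)
      then show ?case by (metis (no_types, lifting) mult.assoc mult.commute)
    qed
  qed
  also have "\<dots> \<le> (\<integral>\<^sup>+\<omega>. (g \<omega> * growth_factor n \<omega>) * (\<Prod>j<n. growth_factor j \<omega>) \<partial>M)"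
    by (rule Suc.IH) measurable
  finally show ?case by (simp add: ac_simps)
qed

lemma exponential_growth:
  obtains c where "c > 1" "AE \<omega> in M. \<forall>\<^sub>F n in sequentially. c ^ n \<le> real (Z n \<omega>)"
proof -
  define \<rho> where "\<rho> = expectation (\<lambda>\<omega>. 1 / 2 + pmf (p (\<xi> 0 \<omega>)) 1 / 2)"
  have [measurable]: "(\<lambda>\<omega>. pmf (p (\<xi> 0 \<omega>)) 1) \<in> borel_measurable M" by measurable
  have int: "integrable M (\<lambda>\<omega>. pmf (p (\<xi> 0 \<omega>)) 1)"
    by (rule integrable_const_bound[of _ 1]) (auto simp: pmf_le_1)
  have \<rho>: "\<rho> = 1 / 2 + expectation (\<lambda>\<omega>. pmf (p (\<xi> 0 \<omega>)) 1) / 2"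
    unfolding \<rho>_def using int by (simp add: prob_space)
  have "expectation (\<lambda>\<omega>. 1 - pmf (p (\<xi> 0 \<omega>)) 1) \<noteq> 0"
  proof
    assume "expectation (\<lambda>\<omega>. 1 - pmf (p (\<xi> 0 \<omega>)) 1) = 0"
    then have "AE \<omega> in M. 1 - pmf (p (\<xi> 0 \<omega>)) 1 = 0"
      using int by (subst (asm) integral_nonneg_eq_0_iff_AE) (auto simp: pmf_le_1)
    then have "AE \<omega> in M. pmf (p (\<xi> 0 \<omega>)) 1 = 1" by eventually_elim simp
    with nondegenerate show False by simp
  qed
  moreover have "expectation (\<lambda>\<omega>. 1 - pmf (p (\<xi> 0 \<omega>)) 1) \<ge> 0"
    by (intro integral_nonneg_AE) (auto simp: pmf_le_1)
  ultimately have "\<rho> < 1" using int by (simp add: \<rho> prob_space)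
  have \<rho>0: "\<rho> > 0" unfolding \<rho> by (simp add: add_pos_nonneg)
  have ints: "(\<integral>\<^sup>+\<omega>. growth_factor 0 \<omega> \<partial>M) = ennreal \<rho>"
    unfolding growth_factor_def \<rho>_def using int by (intro nn_integral_eq_integral) auto
  have prod: "(\<integral>\<^sup>+\<omega>. (\<Prod>j<n. growth_factor j \<omega>) \<partial>M) = ennreal (\<rho> ^ n)" for n
  proof -
    have "indep_vars (\<lambda>_. borel) growth_factor {..<n}"
      unfolding growth_factor_def[abs_def]
      by (rule indep_vars_compose2[OF indep_vars_subset[OF env_indep], of _ "\<lambda>_ e. ennreal (1 / 2 + pmf (p e) 1 / 2)"]) auto
    then have "(\<integral>\<^sup>+\<omega>. (\<Prod>j<n. growth_factor j \<omega>) \<partial>M) = (\<Prod>j<n. \<integral>\<^sup>+\<omega>. growth_factor j \<omega> \<partial>M)"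
      by (intro indep_vars_nn_integral) auto
    also have "\<dots> = (\<Prod>j<n. \<integral>\<^sup>+\<omega>. growth_factor 0 \<omega> \<partial>M)"
      unfolding growth_factor_def by (intro prod.cong refl nn_integral_env_shift) measurable
    finally show ?thesis using \<rho>0 by (simp add: ints ennreal_power)
  qed
  \<comment> \<open>Any such \<open>c\<close> makes the expectation of \<open>c ^ n / Z n\<close> at
    most the geometric term \<open>(c * \<rho>) ^ n\<close>.\<close>
  obtain c where c: "1 < c" "c < 1 / \<rho>" using dense[of 1 "1 / \<rho>"] \<rho>0 \<open>\<rho> < 1\<close> by auto
  have c\<rho>: "c * \<rho> < 1" "0 \<le> c * \<rho>" using c \<rho>0 by (auto simp: field_simps)
  have "AE \<omega> in M. \<forall>\<^sub>F n in sequentially. ennreal (c ^ n) * ennreal (1 / Z n \<omega>) < 1"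
  proof (rule nn_integral_borel_cantelli(2))
    have "(\<integral>\<^sup>+\<omega>. ennreal (c ^ n) * ennreal (1 / Z n \<omega>) \<partial>M) \<le> ennreal ((c * \<rho>) ^ n)" for n
    proof -
      have "(\<integral>\<^sup>+\<omega>. ennreal (c ^ n) * ennreal (1 / Z n \<omega>) \<partial>M) \<le> (\<integral>\<^sup>+\<omega>. ennreal (c ^ n) * (\<Prod>j<n. growth_factor j \<omega>) \<partial>M)"
        by (rule inverse_Z_moment) auto
      also have "\<dots> = ennreal (c ^ n) * ennreal (\<rho> ^ n)"
        unfolding prod[symmetric] by (rule nn_integral_cmult) measurable
      finally show ?thesis using c \<rho>0 by (simp add: ennreal_mult'[symmetric] power_mult_distrib)
    qed
    then show "(\<Sum>n. \<integral>\<^sup>+\<omega>. ennreal (c ^ n) * ennreal (1 / Z n \<omega>) \<partial>M) < \<infinity>"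
      using c\<rho> by (intro suminf_ennreal_finite[of "\<lambda>n. (c * \<rho>) ^ n"] summable_geometric) auto
  qed measurable
  with no_extinction have "AE \<omega> in M. \<forall>\<^sub>F n in sequentially. c ^ n \<le> real (Z n \<omega>)"
  proof eventually_elim
    case (elim \<omega>)
    show ?case using elim(2)
    proof eventually_elim
      case (elim n)
      have "1 \<le> Z n \<omega>" using \<open>\<forall>n. 1 \<le> Z n \<omega> \<and> _ n\<close> by blast
      then show ?case using elim c by (simp add: ennreal_mult'[symmetric] field_simps)
    qed
  qed
  with c(1) that show thesis by blast
qed

lemma mean_Z:
  assumes "g \<in> borel_measurable F"
  shows "(\<integral>\<^sup>+\<omega>. g \<omega> * of_nat (Z n \<omega>) \<partial>M) = (\<integral>\<^sup>+\<omega>. g \<omega> * (\<Prod>j<n. ennreal (m j \<omega>)) \<partial>M)"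
  using assms
proof (induction n arbitrary: g)
  case 0
  show ?case by (intro nn_integral_cong) (simp add: Z_0)
next
  case (Suc n)
  note [measurable] = Suc.prems
  have "(\<integral>\<^sup>+\<omega>. g \<omega> * of_nat (Z (Suc n) \<omega>) \<partial>M) = (\<integral>\<^sup>+\<omega>. g \<omega> * (\<Sum>i\<in>{1..Z n \<omega>}. ennreal (real (X n i \<omega>))) \<partial>M)"
    by (intro nn_integral_cong) (simp add: Z_Suc ennreal_of_nat_eq_real_of_nat[symmetric])
  also have "\<dots> = (\<integral>\<^sup>+\<omega>. g \<omega> * (of_nat (Z n \<omega>) * offspring_nn (p (\<xi> n \<omega>)) (\<lambda>k. ennreal (real k))) \<partial>M)"
    by (rule quenched_sum[of "\<lambda>_. g"]) measurable
  also have "\<dots> = (\<integral>\<^sup>+\<omega>. (g \<omega> * ennreal (m n \<omega>)) * of_nat (Z n \<omega>) \<partial>M)"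
  proof (rule nn_integral_cong_AE)
    show "AE \<omega> in M. g \<omega> * (of_nat (Z n \<omega>) * offspring_nn (p (\<xi> n \<omega>)) (\<lambda>k. ennreal (real k)))
       = (g \<omega> * ennreal (m n \<omega>)) * of_nat (Z n \<omega>)"
      using env_regular by eventually_elim (simp add: offspring_nn_mean m_def ac_simps)
  qed
  also have "\<dots> = (\<integral>\<^sup>+\<omega>. (g \<omega> * ennreal (m n \<omega>)) * (\<Prod>j<n. ennreal (m j \<omega>)) \<partial>M)"
    by (rule Suc.IH) measurable
  finally show ?case by (simp add: ac_simps)
qed

lemma normalized_mean_le_one:
  "(\<integral>\<^sup>+\<omega>. ennreal (1 / (\<Prod>j<n. m j \<omega>)) * of_nat (Z n \<omega>) \<partial>M) \<le> 1"
proof -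
  have "(\<integral>\<^sup>+\<omega>. ennreal (1 / (\<Prod>j<n. m j \<omega>)) * of_nat (Z n \<omega>) \<partial>M)
    = (\<integral>\<^sup>+\<omega>. ennreal (1 / (\<Prod>j<n. m j \<omega>)) * (\<Prod>j<n. ennreal (m j \<omega>)) \<partial>M)"
    by (rule mean_Z) measurable
  also have "\<dots> = (\<integral>\<^sup>+\<omega>. 1 \<partial>M)"
  proof (rule nn_integral_cong_AE)
    show "AE \<omega> in M. ennreal (1 / (\<Prod>j<n. m j \<omega>)) * (\<Prod>j<n. ennreal (m j \<omega>)) = 1"
      using env_regular
    proof eventually_elim
      case (elim \<omega>)
      then have m: "1 \<le> m j \<omega>" for j by auto
      have "0 < (\<Prod>j<n. m j \<omega>)" using m by (intro prod_pos) (smt (verit))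
      moreover have "(\<Prod>j<n. ennreal (m j \<omega>)) = ennreal (\<Prod>j<n. m j \<omega>)"
        using m by (intro prod_ennreal) (smt (verit))
      moreover have "\<forall>j\<in>{..<n}. m j \<omega> \<noteq> 0" using m by (metis not_one_le_zero)
      ultimately show ?case by (simp add: ennreal_mult'[symmetric])
    qed
  qed
  finally show ?thesis by (simp add: emeasure_space_1)
qed

text \<open>Dividing the normalized population by \<open>(n + 1)\<^sup>2\<close> makes its
  expectations summable. A polynomial factor suffices, since its logarithm is negligible on the
  final scale.\<close>

lemma Z_le_eventually:
  "AE \<omega> in M. \<forall>\<^sub>F n in sequentially. real (Z n \<omega>) \<le> (real n + 1)\<^sup>2 * (\<Prod>j<n. m j \<omega>)"
proof -
  have "AE \<omega> in M. \<forall>\<^sub>F n in sequentially.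
      ennreal (1 / (real n + 1)\<^sup>2) * (ennreal (1 / (\<Prod>j<n. m j \<omega>)) * of_nat (Z n \<omega>)) < 1"
  proof (rule nn_integral_borel_cantelli(2))
    have sum: "summable (\<lambda>n. 1 / (real n + 1)\<^sup>2)"
    proof -
      have "summable (\<lambda>n. inverse (real (Suc n) ^ 2))"
        using inverse_power_summable[of 2, where ?'a = real] by (subst summable_Suc_iff[of "\<lambda>n. inverse (real n ^ 2)"]) simp
      then show ?thesis by (simp add: inverse_eq_divide add.commute)
    qed
    have "(\<integral>\<^sup>+\<omega>. ennreal (1 / (real n + 1)\<^sup>2) * (ennreal (1 / (\<Prod>j<n. m j \<omega>)) * of_nat (Z n \<omega>)) \<partial>M)
      \<le> ennreal (1 / (real n + 1)\<^sup>2)" for n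
    proof -
      have "(\<integral>\<^sup>+\<omega>. ennreal (1 / (real n + 1)\<^sup>2) * (ennreal (1 / (\<Prod>j<n. m j \<omega>)) * of_nat (Z n \<omega>)) \<partial>M)
        = ennreal (1 / (real n + 1)\<^sup>2) * (\<integral>\<^sup>+\<omega>. ennreal (1 / (\<Prod>j<n. m j \<omega>)) * of_nat (Z n \<omega>) \<partial>M)"
        by (rule nn_integral_cmult) measurable
      also have "\<dots> \<le> ennreal (1 / (real n + 1)\<^sup>2) * 1"
        by (intro mult_left_mono normalized_mean_le_one) auto
      finally show ?thesis by simp
    qed
    with sum show "(\<Sum>n. \<integral>\<^sup>+\<omega>. ennreal (1 / (real n + 1)\<^sup>2) * (ennreal (1 / (\<Prod>j<n. m j \<omega>)) * of_nat (Z n \<omega>)) \<partial>M) < \<infinity>"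
      by (intro suminf_ennreal_finite[of "\<lambda>n. 1 / (real n + 1)\<^sup>2"]) auto
  qed measurable
  with env_regular show ?thesis
  proof eventually_elim
    case (elim \<omega>)
    have m: "1 \<le> m j \<omega>" for j using elim by auto
    show ?case using elim(2)
    proof eventually_elim
      case (elim n)
      have P: "0 < (\<Prod>j<n. m j \<omega>)" using m by (intro prod_pos) (smt (verit))
      have "(1 / (real n + 1)\<^sup>2) * ((1 / (\<Prod>j<n. m j \<omega>)) * real (Z n \<omega>)) < 1"
        using elim P by (simp add: ennreal_of_nat_eq_real_of_nat ennreal_mult'[symmetric] ennreal_mult''[symmetric])
      then show ?case using P by (simp add: field_simps)
    qed
  qed
qed

end

section \<open>The deterministic recursion and truncated offspring laws\<close>

lemma ln_one_minus_ge:
  assumes "0 \<le> x" "x \<le> (1/2::real)"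
  shows "- 2 * x \<le> ln (1 - x)"
proof -
  have "ln (1 / (1 - x)) \<le> 1 / (1 - x) - 1" using assms by (intro ln_le_minus_one) auto
  also have "\<dots> = x / (1 - x)" using assms by (simp add: field_simps)
  also have "\<dots> \<le> 2 * x" using assms mult_left_mono[of "1/2" "1 - x" "2 * x"] by (simp add: pos_divide_le_eq)
  finally show ?thesis using assms by (simp add: ln_div)
qed

text \<open>Once \<open>d n\<close> and \<open>e n\<close> are below 1/2, one step lowers
  \<open>ln (z n) - (\<Sum>j<n. ln (m j))\<close> by at most \<open>2 * (e n + d n)\<close>.
  Summability bounds the total loss from the starting index on.\<close>

lemma ln_product_lower_bound:
  fixes z m d e :: "nat \<Rightarrow> real"
  assumes z: "\<And>n. z n > 0" and m: "\<And>n. m n > 0"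
    and d: "\<And>n. 0 \<le> d n" "summable d" and e: "\<And>n. 0 \<le> e n" "summable e"
    and step: "\<forall>\<^sub>F n in sequentially. (1 - e n) * (1 - d n) * m n * z n \<le> z (Suc n)"
  obtains K where "\<forall>\<^sub>F n in sequentially. - K \<le> ln (z n) - (\<Sum>j<n. ln (m j))"
proof -
  have "\<forall>\<^sub>F n in sequentially. d n < 1/2"
    using summable_LIMSEQ_zero[OF d(2)] by (rule order_tendstoD) simp
  moreover have "\<forall>\<^sub>F n in sequentially. e n < 1/2"
    using summable_LIMSEQ_zero[OF e(2)] by (rule order_tendstoD) simp
  ultimately have "\<forall>\<^sub>F n in sequentially. (1 - e n) * (1 - d n) * m n * z n \<le> z (Suc n) \<and> d n < 1/2 \<and> e n < 1/2"
    using step by eventually_elim simp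
  then obtain N where N: "\<And>n. n \<ge> N \<Longrightarrow> (1 - e n) * (1 - d n) * m n * z n \<le> z (Suc n)"
    "\<And>n. n \<ge> N \<Longrightarrow> d n < 1/2" "\<And>n. n \<ge> N \<Longrightarrow> e n < 1/2"
    unfolding eventually_sequentially by blast
  define w where "w n = ln (z n) - (\<Sum>j<n. ln (m j))" for n
  have one: "w n - 2 * e n - 2 * d n \<le> w (Suc n)" if "n \<ge> N" for n
  proof -
    have "ln ((1 - e n) * (1 - d n) * m n * z n) \<le> ln (z (Suc n))"
      using N[OF that] z[of n] m[of n] by (intro ln_mono) auto
    moreover have "ln ((1 - e n) * (1 - d n) * m n * z n) = ln (1 - e n) + ln (1 - d n) + ln (m n) + ln (z n)"
      using N(2,3)[OF that] z[of n] m[of n] by (simp add: ln_mult)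
    moreover have "- 2 * e n \<le> ln (1 - e n)" "- 2 * d n \<le> ln (1 - d n)"
      using N(2,3)[OF that] d(1)[of n] e(1)[of n] ln_one_minus_ge[of "e n"] ln_one_minus_ge[of "d n"] by auto
    ultimately show ?thesis by (simp add: w_def)
  qed
  \<comment> \<open>The sum starts at 0 although the losses start at \<open>N\<close>; the
    additional terms are nonnegative and only weaken the bound.\<close>
  have "w N - 2 * (\<Sum>j<N + k. e j + d j) \<le> w (N + k)" for k
  proof (induction k)
    case 0 show ?case using d(1) e(1) by (simp add: sum_nonneg)
  next
    case (Suc k)
    then show ?case using one[of "N + k"] by simp
  qed
  moreover have "(\<Sum>j<N + k. e j + d j) \<le> (\<Sum>j. e j + d j)" for k
    using d e by (intro sum_le_suminf summable_add) auto
  ultimately have lo: "w N - 2 * (\<Sum>j. e j + d j) \<le> w (N + k)" for k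
    using order_trans[of "w N - 2 * (\<Sum>j. e j + d j)" "w N - 2 * (\<Sum>j<N + k. e j + d j)"] by simp
  have "\<forall>\<^sub>F n in sequentially. - (2 * (\<Sum>j. e j + d j) - w N) \<le> ln (z n) - (\<Sum>j<n. ln (m j))"
    unfolding eventually_sequentially
  proof (intro exI allI impI)
    fix n assume "n \<ge> N"
    then obtain k where "n = N + k" using le_Suc_ex by blast
    then show "- (2 * (\<Sum>j. e j + d j) - w N) \<le> ln (z n) - (\<Sum>j<n. ln (m j))"
      using lo[of k] by (simp add: w_def)
  qed
  then show thesis by (rule that)
qed

definition low_part :: "real \<Rightarrow> nat \<Rightarrow> real" where "low_part t k = (if real k \<le> t then real k else 0)"
definition high_part :: "real \<Rightarrow> nat \<Rightarrow> real" where "high_part t k = (if real k \<le> t then 0 else real k)"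
definition truncated_mean :: "real \<Rightarrow> nat pmf \<Rightarrow> real" where
  "truncated_mean t q = enn2real (offspring_nn q (\<lambda>k. ennreal (low_part t k)))"

lemma part_bounds: "0 \<le> low_part t k" "low_part t k \<le> real k" "t \<ge> 0 \<Longrightarrow> low_part t k \<le> t" "0 \<le> high_part t k"
  by (auto simp: low_part_def high_part_def)

lemma truncated_mean_nn:
  assumes "t \<ge> 0"
  shows "offspring_nn q (\<lambda>k. ennreal (low_part t k)) = ennreal (truncated_mean t q)"
proof -
  have "offspring_nn q (\<lambda>k. ennreal (low_part t k)) \<le> offspring_nn q (\<lambda>k. ennreal t * 1)"
    by (rule offspring_nn_mono) (use part_bounds(3)[OF assms] in \<open>auto intro: ennreal_leI\<close>)
  also have "\<dots> < \<top>" unfolding offspring_nn_cmult offspring_nn_one by simp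
  finally show ?thesis by (simp add: truncated_mean_def)
qed

lemma truncated_mean_nonneg: "0 \<le> truncated_mean t q"
  by (simp add: truncated_mean_def)

text \<open>For \<open>0 \<le> b \<le> t\<close> the quadratic term in the bound for
  \<open>exp (- \<epsilon> * b / t)\<close> becomes linear through
  \<open>b\<^sup>2 \<le> t * b\<close>. The exponential is thus at most
  \<open>1 - \<kappa> * b\<close>; taking means and using \<open>1 - y \<le> exp (- y)\<close> gives
  the claim with the mean alone.\<close>

lemma truncated_laplace:
  assumes t: "t > 0" and \<epsilon>: "0 < \<epsilon>" "\<epsilon> \<le> 1"
  shows "offspring_nn q (\<lambda>k. ennreal (exp (- (\<epsilon> / t) * low_part t k)))
    \<le> ennreal (exp (- ((\<epsilon> - \<epsilon>\<^sup>2 / 2) / t) * truncated_mean t q))"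
proof -
  define \<kappa> where "\<kappa> = (\<epsilon> - \<epsilon>\<^sup>2 / 2) / t"
  have "\<epsilon>\<^sup>2 \<le> \<epsilon>" using \<epsilon> by (simp add: power2_eq_square mult_left_le)
  then have \<kappa>: "\<kappa> \<ge> 0" using t \<epsilon> by (auto simp: \<kappa>_def)
  have "exp (- (\<epsilon> / t) * low_part t k) + \<kappa> * low_part t k \<le> 1" for k
  proof -
    define b where "b = low_part t k"
    have b: "0 \<le> b" "b \<le> t" using part_bounds(1,3)[of t k] t by (auto simp: b_def)
    have "exp (- (\<epsilon> / t * b)) \<le> 1 - \<epsilon> / t * b + (\<epsilon> / t * b)\<^sup>2 / 2"
      using t \<epsilon> b by (intro exp_minus_le_quadratic) auto
    moreover have "(\<epsilon> / t * b)\<^sup>2 / 2 \<le> \<epsilon>\<^sup>2 / 2 / t * b"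
    proof -
      have "b\<^sup>2 \<le> t * b" using b by (simp add: power2_eq_square mult_right_mono)
      then have "(\<epsilon> / t)\<^sup>2 * b\<^sup>2 / 2 \<le> (\<epsilon> / t)\<^sup>2 * (t * b) / 2" by (intro divide_right_mono mult_left_mono) auto
      also have "\<dots> = \<epsilon>\<^sup>2 / 2 / t * b" using t by (simp add: field_simps power2_eq_square)
      finally show ?thesis by (simp only: power_mult_distrib)
    qed
    moreover have "\<kappa> * b = \<epsilon> / t * b - \<epsilon>\<^sup>2 / 2 / t * b"
      by (simp add: \<kappa>_def diff_divide_distrib left_diff_distrib)
    ultimately have "exp (- (\<epsilon> / t * b)) + \<kappa> * b \<le> 1" by linarith
    then show ?thesis unfolding b_def[symmetric] mult_minus_left .
  qed
  then have "offspring_nn q (\<lambda>k. ennreal (exp (- (\<epsilon> / t) * low_part t k)) + ennreal \<kappa> * ennreal (low_part t k)) \<le> offspring_nn q (\<lambda>_. 1)"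
    using \<kappa> part_bounds(1)[of t]
    by (intro offspring_nn_mono) (simp add: ennreal_mult'[symmetric] ennreal_plus[symmetric] del: ennreal_plus)
  then have le: "offspring_nn q (\<lambda>k. ennreal (exp (- (\<epsilon> / t) * low_part t k))) + ennreal (\<kappa> * truncated_mean t q) \<le> 1"
    using \<kappa> t truncated_mean_nonneg
    by (simp add: offspring_nn_add offspring_nn_cmult offspring_nn_one truncated_mean_nn ennreal_mult')
  define H where "H = offspring_nn q (\<lambda>k. ennreal (exp (- (\<epsilon> / t) * low_part t k)))"
  have "H \<le> 1" by (rule order_trans[OF _ le[folded H_def]]) simp
  then have H: "H = ennreal (enn2real H)" by (metis ennreal_enn2real ennreal_one_less_top le_less_trans)
  have "ennreal (enn2real H + \<kappa> * truncated_mean t q) \<le> ennreal 1"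
    using le \<kappa> truncated_mean_nonneg[of t q] unfolding H_def[symmetric] by (subst ennreal_plus) (simp_all add: H[symmetric])
  then have "enn2real H \<le> 1 + - (\<kappa> * truncated_mean t q)" by (simp add: ennreal_le_iff2)
  also have "\<dots> \<le> exp (- (\<kappa> * truncated_mean t q))" by (rule exp_ge_add_one_self)
  finally have "H \<le> ennreal (exp (- (\<kappa> * truncated_mean t q)))" by (subst H) (rule ennreal_leI)
  then show ?thesis unfolding H_def \<kappa>_def by (simp only: mult_minus_left)
qed

lemma mean_split:
  assumes "summable (\<lambda>k. real k * pmf q k)" "t \<ge> 0"
  shows "offspring_nn q (\<lambda>k. ennreal (high_part t k)) = ennreal (offspring_mean q - truncated_mean t q)"
    and "truncated_mean t q \<le> offspring_mean q"
proof -
  have "(\<lambda>k. ennreal (real k)) = (\<lambda>k. ennreal (high_part t k) + ennreal (low_part t k))"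
    by (auto simp: high_part_def low_part_def)
  then have e: "ennreal (offspring_mean q) = offspring_nn q (\<lambda>k. ennreal (high_part t k)) + ennreal (truncated_mean t q)"
    using offspring_nn_mean[OF assms(1)] by (simp add: offspring_nn_add truncated_mean_nn[OF assms(2)])
  then have "offspring_nn q (\<lambda>k. ennreal (high_part t k)) = ennreal (offspring_mean q) - ennreal (truncated_mean t q)"
    by simp
  then show "offspring_nn q (\<lambda>k. ennreal (high_part t k)) = ennreal (offspring_mean q - truncated_mean t q)"
    by (simp only: ennreal_minus[OF truncated_mean_nonneg])
  have "ennreal (truncated_mean t q) \<le> ennreal (offspring_mean q)" unfolding e by simp
  moreover have "0 \<le> offspring_mean q" unfolding offspring_mean_def by (intro suminf_nonneg assms) auto
  ultimately show "truncated_mean t q \<le> offspring_mean q" by simp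
qed

text \<open>A value \<open>k\<close> survives above the level \<open>b ^ n\<close> for at most
  \<open>1 + ln k / ln b\<close> values of \<open>n\<close>, and contributes \<open>k\<close> each
  time. This count is the source of the logarithm in the moment condition.\<close>

lemma suminf_high_part_geometric_le:
  assumes b: "b > 1" and k: "k \<ge> 1"
  shows "(\<Sum>n. ennreal (high_part (b ^ n) k)) \<le> ennreal (real k + real k * ln (real k) / ln b)"
proof -
  define r where "r = nat \<lceil>ln (real k) / ln b\<rceil>"
  have lb: "ln b > 0" using b by simp
  have z: "high_part (b ^ n) k = 0" if "n \<ge> r" for n
  proof -
    have "ln (real k) / ln b \<le> real n" using that unfolding r_def by linarith
    then have "ln (real k) \<le> ln (b ^ n)" using lb b by (simp add: pos_divide_le_eq ln_realpow)
    then have "real k \<le> b ^ n" using k b by simp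
    then show ?thesis by (simp add: high_part_def)
  qed
  have "(\<Sum>n. ennreal (high_part (b ^ n) k)) = (\<Sum>n<r. ennreal (high_part (b ^ n) k))"
    using z by (intro suminf_finite) auto
  also have "\<dots> = ennreal (\<Sum>n<r. high_part (b ^ n) k)" by (rule sum_ennreal) (rule part_bounds)
  also have "\<dots> \<le> ennreal (real k + real k * ln (real k) / ln b)"
  proof (rule ennreal_leI)
    have "(\<Sum>n<r. high_part (b ^ n) k) \<le> (\<Sum>n<r. real k)" by (intro sum_mono) (auto simp: high_part_def)
    also have "\<dots> = real r * real k" by simp
    also have "real r \<le> 1 + ln (real k) / ln b"
    proof -
      have "0 \<le> ln (real k) / ln b" using k lb by simp
      then show ?thesis unfolding r_def by linarith
    qed
    then have "real r * real k \<le> (1 + ln (real k) / ln b) * real k" by (intro mult_right_mono) auto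
    finally show "(\<Sum>n<r. high_part (b ^ n) k) \<le> real k + real k * ln (real k) / ln b"
      by (simp add: algebra_simps)
  qed
  finally show ?thesis .
qed

section \<open>The pathwise lower bound\<close>

context supercritical_branching
begin

lemma truncated_mean_measurable [measurable]:
  "(\<lambda>\<omega>. truncated_mean t (p (\<xi> n \<omega>))) \<in> borel_measurable F"
  unfolding truncated_mean_def by measurable

text \<open>This is where the \<open>Z log Z\<close> condition enters.\<close>

lemma truncation_loss_summable:
  assumes b: "b > 1"
  shows "AE \<omega> in M. summable (\<lambda>n. 1 - truncated_mean (b ^ n) (p (\<xi> n \<omega>)) / m n \<omega>)"
proof -
  define D where "D n \<omega> = ennreal (1 / m n \<omega>) * offspring_nn (p (\<xi> n \<omega>)) (\<lambda>k. ennreal (high_part (b ^ n) k))" for n \<omega>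
  have [measurable]: "D n \<in> borel_measurable F" for n unfolding D_def by measurable
  \<comment> \<open>The environments are identically distributed, so generation \<open>n\<close> may
    be replaced by generation 0, whose single individual has \<open>Z 1\<close> offspring. All terms
    now involve the same variable, and the sum over \<open>n\<close> can be taken pointwise.\<close>
  have D: "(\<integral>\<^sup>+\<omega>. D n \<omega> \<partial>M) = (\<integral>\<^sup>+\<omega>. ennreal (1 / m 0 \<omega>) * ennreal (high_part (b ^ n) (Z 1 \<omega>)) \<partial>M)" for n
  proof -
    note [measurable] = offspring_nn_measurable_env
    let ?h = "\<lambda>k. ennreal (high_part (b ^ n) k)"
    have "(\<integral>\<^sup>+\<omega>. D n \<omega> \<partial>M) = (\<integral>\<^sup>+\<omega>. ennreal (1 / m 0 \<omega>) * offspring_nn (p (\<xi> 0 \<omega>)) ?h \<partial>M)"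
      unfolding D_def m_def
      by (rule nn_integral_env_shift[of "\<lambda>e. ennreal (1 / offspring_mean (p e)) * offspring_nn (p e) ?h"]) measurable
    also have "\<dots> = (\<integral>\<^sup>+\<omega>. ennreal (1 / m 0 \<omega>) * (of_nat (Z 0 \<omega>) * offspring_nn (p (\<xi> 0 \<omega>)) ?h) \<partial>M)"
      by (intro nn_integral_cong) (simp add: Z_0)
    also have "\<dots> = (\<integral>\<^sup>+\<omega>. ennreal (1 / m 0 \<omega>) * (\<Sum>i\<in>{1..Z 0 \<omega>}. ?h (X 0 i \<omega>)) \<partial>M)"
      by (rule quenched_sum[of "\<lambda>_ \<omega>. ennreal (1 / m 0 \<omega>)", symmetric]) measurable
    also have "\<dots> = (\<integral>\<^sup>+\<omega>. ennreal (1 / m 0 \<omega>) * ?h (Z 1 \<omega>) \<partial>M)"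
      using Z_Suc[of _ 0] by (intro nn_integral_cong) (simp add: Z_0)
    finally show ?thesis .
  qed
  have "(\<Sum>n. \<integral>\<^sup>+\<omega>. D n \<omega> \<partial>M) = (\<integral>\<^sup>+\<omega>. (\<Sum>n. ennreal (1 / m 0 \<omega>) * ennreal (high_part (b ^ n) (Z 1 \<omega>))) \<partial>M)"
    unfolding D by (rule nn_integral_suminf[symmetric]) measurable
  also have "\<dots> \<le> (\<integral>\<^sup>+\<omega>. ennreal (1 / m 0 \<omega>) * of_nat (Z 1 \<omega>)
      + ennreal (1 / ln b) * ennreal (real (Z 1 \<omega>) / m 0 \<omega> * ln (real (Z 1 \<omega>))) \<partial>M)"
  proof (rule nn_integral_mono_AE)
    show "AE \<omega> in M. (\<Sum>n. ennreal (1 / m 0 \<omega>) * ennreal (high_part (b ^ n) (Z 1 \<omega>)))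
      \<le> ennreal (1 / m 0 \<omega>) * of_nat (Z 1 \<omega>)
      + ennreal (1 / ln b) * ennreal (real (Z 1 \<omega>) / m 0 \<omega> * ln (real (Z 1 \<omega>)))"
      using env_regular no_extinction
    proof eventually_elim
      case (elim \<omega>)
      have m: "1 \<le> m 0 \<omega>" and z: "1 \<le> Z 1 \<omega>" using elim by auto
      have lz: "0 \<le> ln (real (Z 1 \<omega>))" "ln b > 0" using z b by auto
      have "(\<Sum>n. ennreal (1 / m 0 \<omega>) * ennreal (high_part (b ^ n) (Z 1 \<omega>)))
        = ennreal (1 / m 0 \<omega>) * (\<Sum>n. ennreal (high_part (b ^ n) (Z 1 \<omega>)))" by simp
      also have "\<dots> \<le> ennreal (1 / m 0 \<omega>) * ennreal (real (Z 1 \<omega>) + real (Z 1 \<omega>) * ln (real (Z 1 \<omega>)) / ln b)"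
        by (intro mult_left_mono suminf_high_part_geometric_le b z) auto
      also have "\<dots> = ennreal (1 / m 0 \<omega> * real (Z 1 \<omega>) + (1 / ln b) * (real (Z 1 \<omega>) / m 0 \<omega> * ln (real (Z 1 \<omega>))))"
        using m by (subst ennreal_mult'[symmetric]) (auto simp: field_simps)
      also have "\<dots> = ennreal (1 / m 0 \<omega> * real (Z 1 \<omega>)) + ennreal ((1 / ln b) * (real (Z 1 \<omega>) / m 0 \<omega> * ln (real (Z 1 \<omega>))))"
        using m lz by (intro ennreal_plus) auto
      also have "\<dots> = ennreal (1 / m 0 \<omega>) * ennreal (real (Z 1 \<omega>))
      + ennreal (1 / ln b) * ennreal (real (Z 1 \<omega>) / m 0 \<omega> * ln (real (Z 1 \<omega>)))"
        using m lz by (intro arg_cong2[where f = "(+)"] ennreal_mult') auto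
      finally show ?case by (simp only: ennreal_of_nat_eq_real_of_nat)
    qed
  qed
  also have "\<dots> = (\<integral>\<^sup>+\<omega>. ennreal (1 / m 0 \<omega>) * of_nat (Z 1 \<omega>) \<partial>M)
      + ennreal (1 / ln b) * (\<integral>\<^sup>+\<omega>. ennreal (real (Z 1 \<omega>) / m 0 \<omega> * ln (real (Z 1 \<omega>))) \<partial>M)"
    by (subst nn_integral_add, measurable, subst nn_integral_cmult, measurable)
  also have "\<dots> < \<infinity>"
  proof -
    have "(\<integral>\<^sup>+\<omega>. ennreal (1 / m 0 \<omega>) * of_nat (Z 1 \<omega>) \<partial>M) \<le> 1"
      using normalized_mean_le_one[of 1] by simp
    then have "(\<integral>\<^sup>+\<omega>. ennreal (1 / m 0 \<omega>) * of_nat (Z 1 \<omega>) \<partial>M) < \<infinity>"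
      by (rule le_less_trans) simp
    moreover have "(\<integral>\<^sup>+\<omega>. ennreal (real (Z 1 \<omega>) / m 0 \<omega> * ln (real (Z 1 \<omega>))) \<partial>M)
        \<le> (\<integral>\<^sup>+\<omega>. ennreal (norm (real (Z 1 \<omega>) / m 0 \<omega> * ln (real (Z 1 \<omega>)))) \<partial>M)"
      by (intro nn_integral_mono ennreal_leI) (simp only: real_norm_def abs_ge_self)
    moreover have "\<dots> < \<infinity>" using Z_log_Z unfolding m_def integrable_iff_bounded by blast
    ultimately show ?thesis by (simp add: ennreal_mult_less_top le_less_trans)
  qed
  finally have "(\<Sum>n. \<integral>\<^sup>+\<omega>. D n \<omega> \<partial>M) < \<infinity>" .
  then have "AE \<omega> in M. (\<Sum>n. D n \<omega>) \<noteq> \<infinity>"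
    by (intro nn_integral_borel_cantelli(1)) measurable
  with env_regular show ?thesis
  proof eventually_elim
    case (elim \<omega>)
    have D': "D n \<omega> = ennreal (1 - truncated_mean (b ^ n) (p (\<xi> n \<omega>)) / m n \<omega>)"
      and le: "0 \<le> 1 - truncated_mean (b ^ n) (p (\<xi> n \<omega>)) / m n \<omega>" for n
    proof -
      have r: "summable (\<lambda>k. real k * pmf (p (\<xi> n \<omega>)) k)" "1 \<le> m n \<omega>" using elim by auto
      have "b ^ n \<ge> 0" using b by simp
      note sp = mean_split[OF r(1) this, folded m_def]
      show "0 \<le> 1 - truncated_mean (b ^ n) (p (\<xi> n \<omega>)) / m n \<omega>" using sp(2) r(2) by simp
      show "D n \<omega> = ennreal (1 - truncated_mean (b ^ n) (p (\<xi> n \<omega>)) / m n \<omega>)"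
        unfolding D_def sp(1) using r(2) by (subst ennreal_mult'[symmetric]) (auto simp: diff_divide_distrib)
    qed
    show ?case using elim(2) le unfolding D' by (intro summable_suminf_not_top) auto
  qed
qed

text \<open>Exponential Chebyshev for the truncated sum, with parameter
  \<open>\<epsilon> n / b ^ n\<close> inverse to the truncation level. The condition on
  \<open>Z n\<close> supplies enough summands, and the condition on the truncated mean keeps their
  average away from 0.\<close>

lemma offspring_sum_ge_eventually:
  assumes b: "b > 1"
  shows "AE \<omega> in M. \<forall>\<^sub>F n in sequentially. \<not> ((b\<^sup>2) ^ n \<le> real (Z n \<omega>) \<and> 1 / 2 \<le> truncated_mean (b ^ n) (p (\<xi> n \<omega>))
     \<and> real (Z (Suc n) \<omega>) < (1 - 1 / (real n + 2)\<^sup>2) * real (Z n \<omega>) * truncated_mean (b ^ n) (p (\<xi> n \<omega>)))"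
proof -
  \<comment> \<open>The relative error must be summable, yet decay slowly enough for
    \<open>b ^ n * (\<epsilon> n)\<^sup>2\<close> to grow; an inverse square does both. The offset 2
    keeps it below 1.\<close>
  define \<epsilon> where "\<epsilon> n = 1 / (real n + 2)\<^sup>2" for n
  have \<epsilon>: "0 < \<epsilon> n" "\<epsilon> n \<le> 1" for n
  proof -
    have "1 \<le> (real n + 2)\<^sup>2" by (intro one_le_power) simp
    then show "0 < \<epsilon> n" "\<epsilon> n \<le> 1" by (auto simp: \<epsilon>_def)
  qed
  define a where "a n \<omega> = truncated_mean (b ^ n) (p (\<xi> n \<omega>))" for n \<omega>
  have [measurable]: "a n \<in> borel_measurable F" for n unfolding a_def by measurable
  have a0: "0 \<le> a n \<omega>" for n \<omega> by (simp add: a_def truncated_mean_nonneg)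
  have t: "b ^ n > 0" for n using b by simp
  define B where "B n = {\<omega> \<in> space M. (b\<^sup>2) ^ n \<le> real (Z n \<omega>) \<and> 1 / 2 \<le> a n \<omega>
     \<and> real (Z (Suc n) \<omega>) < (1 - \<epsilon> n) * real (Z n \<omega>) * a n \<omega>}" for n
  have [measurable]: "B n \<in> events" for n unfolding B_def by measurable
  \<comment> \<open>The Chebyshev exponent is the product of \<open>Z n\<close> and the truncated
    mean, times \<open>(\<epsilon> n)\<^sup>2 / (2 * b ^ n)\<close>. With
    \<open>Z n \<ge> (b\<^sup>2) ^ n\<close> and truncated mean at least 1/2 it is at least
    \<open>b ^ n * (\<epsilon> n)\<^sup>2 / 4\<close>.\<close>
  define u where "u n = exp (- (b ^ n * (\<epsilon> n)\<^sup>2 / 4))" for n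
  have PB: "(\<integral>\<^sup>+\<omega>. indicator (B n) \<omega> \<partial>M) \<le> ennreal (u n)" for n
  proof -
    \<comment> \<open>The Chebyshev factor and the first two conditions of \<open>B n\<close> depend
      on \<open>Z n\<close> and the environment only, so together they form an admissible
      weight.\<close>
    define g where "g z \<omega> = (if (b\<^sup>2) ^ n \<le> real z \<and> 1 / 2 \<le> a n \<omega> then ennreal (exp (\<epsilon> n / b ^ n * ((1 - \<epsilon> n) * real z * a n \<omega>))) else 0)" for z \<omega>
    have [measurable]: "g z \<in> borel_measurable F" for z unfolding g_def by measurable
    let ?h = "\<lambda>k. ennreal (exp (- (\<epsilon> n / b ^ n) * low_part (b ^ n) k))"
    have "(\<integral>\<^sup>+\<omega>. indicator (B n) \<omega> \<partial>M) \<le> (\<integral>\<^sup>+\<omega>. g (Z n \<omega>) \<omega> * (\<Prod>i\<in>{1..Z n \<omega>}. ?h (X n i \<omega>)) \<partial>M)"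
    proof (rule nn_integral_mono)
      fix \<omega>
      show "indicator (B n) \<omega> \<le> g (Z n \<omega>) \<omega> * (\<Prod>i\<in>{1..Z n \<omega>}. ?h (X n i \<omega>))"
      proof (cases "\<omega> \<in> B n")
        case True
        define s where "s = (\<Sum>i\<in>{1..Z n \<omega>}. low_part (b ^ n) (X n i \<omega>))"
        have "s \<le> (\<Sum>i\<in>{1..Z n \<omega>}. real (X n i \<omega>))"
          unfolding s_def by (intro sum_mono part_bounds)
        also have "\<dots> = real (Z (Suc n) \<omega>)" using True by (simp add: Z_Suc B_def)
        also have "\<dots> \<le> (1 - \<epsilon> n) * real (Z n \<omega>) * a n \<omega>" using True by (simp add: B_def)
        finally have "\<epsilon> n / b ^ n * s \<le> \<epsilon> n / b ^ n * ((1 - \<epsilon> n) * real (Z n \<omega>) * a n \<omega>)"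
          using \<epsilon>[of n] t[of n] by (intro mult_left_mono) auto
        then have "1 \<le> exp (\<epsilon> n / b ^ n * ((1 - \<epsilon> n) * real (Z n \<omega>) * a n \<omega>)) * exp (- (\<epsilon> n / b ^ n) * s)"
          unfolding exp_add[symmetric] by (simp add: algebra_simps)
        moreover have "(\<Prod>i\<in>{1..Z n \<omega>}. ?h (X n i \<omega>)) = ennreal (exp (- (\<epsilon> n / b ^ n) * s))"
          by (subst prod_ennreal) (auto simp: s_def exp_sum[symmetric] sum_distrib_left)
        ultimately show ?thesis using True
          by (simp add: g_def B_def ennreal_mult'[symmetric])
      qed simp
    qed
    also have "\<dots> = (\<integral>\<^sup>+\<omega>. g (Z n \<omega>) \<omega> * offspring_nn (p (\<xi> n \<omega>)) ?h ^ Z n \<omega> \<partial>M)"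
      by (rule quenched_prod) measurable
    also have "\<dots> \<le> (\<integral>\<^sup>+\<omega>. ennreal (u n) \<partial>M)"
    proof (rule nn_integral_mono)
      fix \<omega>
      show "g (Z n \<omega>) \<omega> * offspring_nn (p (\<xi> n \<omega>)) ?h ^ Z n \<omega> \<le> ennreal (u n)"
      proof (cases "(b\<^sup>2) ^ n \<le> real (Z n \<omega>) \<and> 1 / 2 \<le> a n \<omega>")
        case True
        define z where "z = real (Z n \<omega>)"
        define \<kappa> where "\<kappa> = (\<epsilon> n - (\<epsilon> n)\<^sup>2 / 2) / b ^ n"
        have "offspring_nn (p (\<xi> n \<omega>)) ?h ^ Z n \<omega> \<le> ennreal (exp (- \<kappa> * a n \<omega>)) ^ Z n \<omega>"
          unfolding \<kappa>_def a_def by (rule power_mono[OF truncated_laplace[OF t \<epsilon>] zero_le])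
        also have "\<dots> = ennreal (exp (- \<kappa> * a n \<omega> * z))"
          by (simp add: ennreal_power exp_of_nat_mult[symmetric] z_def ac_simps)
        finally have "g (Z n \<omega>) \<omega> * offspring_nn (p (\<xi> n \<omega>)) ?h ^ Z n \<omega>
          \<le> ennreal (exp (\<epsilon> n / b ^ n * ((1 - \<epsilon> n) * z * a n \<omega>))) * ennreal (exp (- \<kappa> * a n \<omega> * z))"
          using True by (simp add: g_def z_def mult_left_mono)
        \<comment> \<open>The first-order terms cancel: \<open>(\<epsilon> - \<epsilon>\<^sup>2) -
          (\<epsilon> - \<epsilon>\<^sup>2 / 2) = - \<epsilon>\<^sup>2 / 2\<close>.\<close>
        also have "\<dots> = ennreal (exp (- (z * a n \<omega> * ((\<epsilon> n)\<^sup>2 / (2 * b ^ n)))))"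
          using b by (simp add: ennreal_mult'[symmetric] exp_add[symmetric] \<kappa>_def field_simps power2_eq_square)
        also have "\<dots> \<le> ennreal (u n)"
        proof (rule ennreal_leI)
          have "(b\<^sup>2) ^ n * (1 / 2) \<le> z * a n \<omega>"
            using True by (intro mult_mono) (auto simp: z_def)
          then have "(b\<^sup>2) ^ n * (1 / 2) * ((\<epsilon> n)\<^sup>2 / (2 * b ^ n)) \<le> z * a n \<omega> * ((\<epsilon> n)\<^sup>2 / (2 * b ^ n))"
            using t[of n] by (intro mult_right_mono) auto
          moreover have "(b\<^sup>2) ^ n * (1 / 2) * ((\<epsilon> n)\<^sup>2 / (2 * b ^ n)) = b ^ n * (\<epsilon> n)\<^sup>2 / 4"
            using b by (simp add: power2_eq_square power_mult_distrib)
          ultimately show "exp (- (z * a n \<omega> * ((\<epsilon> n)\<^sup>2 / (2 * b ^ n)))) \<le> u n"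
            unfolding u_def by (simp only: exp_le_cancel_iff neg_le_iff_le)
        qed
        finally show ?thesis .
      next
        case False
        then show ?thesis by (auto simp: g_def)
      qed
    qed
    finally show ?thesis by (simp add: emeasure_space_1)
  qed
  have "summable u"
  proof (rule summable_comparison_test_ev)
    show "summable (\<lambda>n. inverse (real n ^ 2))" by (rule inverse_power_summable) simp
    have "\<forall>\<^sub>F n in sequentially. exp (- (b ^ n * (1 / (real n + 2)\<^sup>2)\<^sup>2 / 4)) \<le> inverse (real n ^ 2)"
      using b by real_asymp
    then show "\<forall>\<^sub>F n in sequentially. norm (u n) \<le> inverse (real n ^ 2)"
      by (simp add: u_def \<epsilon>_def)
  qed
  then have "(\<Sum>n. \<integral>\<^sup>+\<omega>. indicator (B n) \<omega> \<partial>M) < \<infinity>"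
    by (rule suminf_ennreal_finite) (use PB in \<open>auto simp: u_def\<close>)
  then have "AE \<omega> in M. \<forall>\<^sub>F n in sequentially. indicator (B n) \<omega> < (1::ennreal)"
    by (intro nn_integral_borel_cantelli(2)) measurable
  then show ?thesis
  proof (rule AE_mp, intro AE_I2 impI)
    fix \<omega> assume "\<omega> \<in> space M" "\<forall>\<^sub>F n in sequentially. indicator (B n) \<omega> < (1::ennreal)"
    from this(2) show "\<forall>\<^sub>F n in sequentially. \<not> ((b\<^sup>2) ^ n \<le> real (Z n \<omega>) \<and> 1 / 2 \<le> truncated_mean (b ^ n) (p (\<xi> n \<omega>))
     \<and> real (Z (Suc n) \<omega>) < (1 - 1 / (real n + 2)\<^sup>2) * real (Z n \<omega>) * truncated_mean (b ^ n) (p (\<xi> n \<omega>)))"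
    proof eventually_elim
      case (elim n)
      then have "\<omega> \<notin> B n" by (metis indicator_simps(1) less_irrefl)
      then show ?case using \<open>\<omega> \<in> space M\<close> unfolding B_def a_def \<epsilon>_def by blast
    qed
  qed
qed

theorem log_Z_close_to_log_mean:
  "AE \<omega> in M. \<exists>K. \<forall>\<^sub>F n in sequentially. - K \<le> ln (real (Z n \<omega>)) - (\<Sum>j<n. ln (m j \<omega>))
     \<and> ln (real (Z n \<omega>)) - (\<Sum>j<n. ln (m j \<omega>)) \<le> 2 * ln (real n + 1)"
proof -
  obtain c where c: "c > 1" "AE \<omega> in M. \<forall>\<^sub>F n in sequentially. c ^ n \<le> real (Z n \<omega>)"
    by (rule exponential_growth)
  \<comment> \<open>With this base the growth bound \<open>c ^ n\<close> is the square of the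
    truncation level \<open>b ^ n\<close>.\<close>
  define b where "b = sqrt c"
  have b: "b > 1" "b\<^sup>2 = c" using c(1) by (auto simp: b_def)
  show ?thesis
    using c(2) env_regular no_extinction Z_le_eventually truncation_loss_summable[OF b(1)] offspring_sum_ge_eventually[OF b(1)]
  proof eventually_elim
    case (elim \<omega>)
    define a where "a n = truncated_mean (b ^ n) (p (\<xi> n \<omega>))" for n
    define d where "d n = 1 - a n / m n \<omega>" for n
    have m: "1 \<le> m n \<omega>" for n using elim(2) by auto
    have z: "1 \<le> real (Z n \<omega>)" for n using elim(3) by simp
    have m0: "m n \<omega> > 0" and z0: "real (Z n \<omega>) > 0" for n using m[of n] z[of n] by linarith+
    have d0: "0 \<le> d n" for n
    proof -
      have "summable (\<lambda>k. real k * pmf (p (\<xi> n \<omega>)) k)" "b ^ n \<ge> 0" using elim(2) b(1) by auto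
      from mean_split(2)[OF this, folded m_def] show ?thesis using m0[of n] by (simp add: d_def a_def)
    qed
    have ds: "summable d" using elim(5) by (simp add: d_def[abs_def] a_def)
    have es: "summable (\<lambda>n. 1 / (real n + 2)\<^sup>2)"
    proof -
      have "summable (\<lambda>n. inverse (real (n + 2) ^ 2))"
        by (rule summable_ignore_initial_segment) (rule inverse_power_summable, simp)
      then show ?thesis by (simp add: inverse_eq_divide add.commute)
    qed
    have am: "a n = (1 - d n) * m n \<omega>" for n using m0[of n] by (simp add: d_def)
    have "\<forall>\<^sub>F n in sequentially. d n < 1 / 2"
      using summable_LIMSEQ_zero[OF ds] by (rule order_tendstoD) simp
    with elim(1,6) have step: "\<forall>\<^sub>F n in sequentially. (1 - 1 / (real n + 2)\<^sup>2) * (1 - d n) * m n \<omega> * real (Z n \<omega>) \<le> real (Z (Suc n) \<omega>)"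
    proof eventually_elim
      case (elim n)
      \<comment> \<open>Since \<open>m n \<omega> \<ge> 1\<close>, a relative truncation loss below
        1/2 leaves a truncated mean of at least 1/2. Both side conditions of the exceptional event
        now hold, so its last condition must fail.\<close>
      have "1 / 2 * 1 \<le> (1 - d n) * m n \<omega>" using elim(3) m[of n] by (intro mult_mono) auto
      then have "1 / 2 \<le> a n" by (simp add: am)
      then have "(1 - 1 / (real n + 2)\<^sup>2) * real (Z n \<omega>) * a n \<le> real (Z (Suc n) \<omega>)"
        using elim(1,2) b(2) by (auto simp: a_def not_less)
      then show ?case unfolding am by (simp only: ac_simps)
    qed
    have e0: "0 \<le> 1 / (real n + 2)\<^sup>2" for n by simp
    obtain K where K: "\<forall>\<^sub>F n in sequentially. - K \<le> ln (real (Z n \<omega>)) - (\<Sum>j<n. ln (m j \<omega>))"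
      by (rule ln_product_lower_bound[OF z0 m0 d0 ds e0 es step])
    moreover have "\<forall>\<^sub>F n in sequentially. ln (real (Z n \<omega>)) - (\<Sum>j<n. ln (m j \<omega>)) \<le> 2 * ln (real n + 1)"
      using elim(4)
    proof eventually_elim
      case (elim n)
      have P: "0 < (\<Prod>j<n. m j \<omega>)" by (intro prod_pos) (use m0 in auto)
      have "ln (real (Z n \<omega>)) \<le> ln ((real n + 1)\<^sup>2 * (\<Prod>j<n. m j \<omega>))"
        using elim z0[of n] by (intro ln_mono) auto
      also have "\<dots> = 2 * ln (real n + 1) + (\<Sum>j<n. ln (m j \<omega>))"
      proof -
        have "ln (\<Prod>j<n. m j \<omega>) = (\<Sum>j<n. ln (m j \<omega>))"
          by (rule ln_prod) (simp_all add: m0 m0[THEN less_imp_neq, THEN not_sym])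
        then show ?thesis using P m0[THEN less_imp_neq, THEN not_sym] by (simp add: ln_mult ln_realpow)
      qed
      finally show ?case by simp
    qed
    ultimately show ?case by (intro exI[of _ K] eventually_conj)
  qed
qed

end

section \<open>The limit theorem\<close>

lemma limsup_affine_perturbation:
  fixes s R l :: "nat \<Rightarrow> real"
  assumes R: "(\<lambda>n. R n / l n) \<longlonglongrightarrow> 0" and s: "limsup (\<lambda>n. ereal (s n / l n)) = ereal c" and \<sigma>: "\<sigma> > 0"
  shows "limsup (\<lambda>n. ereal ((\<sigma> * s n + R n) / l n)) = ereal (c * \<sigma>)"
proof -
  have "(\<lambda>n. ereal ((\<sigma> * s n + R n) / l n)) = (\<lambda>n. ereal (R n / l n) + ereal \<sigma> * ereal (s n / l n))"
    by (simp add: add_divide_distrib add.commute)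
  moreover have "limsup (\<lambda>n. ereal (R n / l n) + ereal \<sigma> * ereal (s n / l n)) = 0 + limsup (\<lambda>n. ereal \<sigma> * ereal (s n / l n))"
    using R by (intro ereal_limsup_lim_add) (auto simp: zero_ereal_def)
  moreover have "limsup (\<lambda>n. ereal \<sigma> * ereal (s n / l n)) = ereal \<sigma> * ereal c"
    using \<sigma> by (subst limsup_ereal_mult_left) (auto simp only: s less_imp_le)
  ultimately show ?thesis by (simp add: mult.commute)
qed

lemma log_error_negligible:
  assumes lo: "\<forall>\<^sub>F n in sequentially. - K \<le> R n" and up: "\<forall>\<^sub>F n in sequentially. R n \<le> 2 * ln (real n + 1)"
  shows "(\<lambda>n. R n / lil_scale n) \<longlonglongrightarrow> 0"
proof (rule tendsto_sandwich)
  have pos: "\<forall>\<^sub>F n in sequentially. lil_scale n > 0" unfolding lil_scale_def by real_asymp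
  show "\<forall>\<^sub>F n in sequentially. - K / lil_scale n \<le> R n / lil_scale n"
    using lo pos by eventually_elim (intro divide_right_mono, auto)
  show "\<forall>\<^sub>F n in sequentially. R n / lil_scale n \<le> 2 * ln (real n + 1) / lil_scale n"
    using up pos by eventually_elim (intro divide_right_mono, auto)
  show "(\<lambda>n. - K / lil_scale n) \<longlonglongrightarrow> 0" "(\<lambda>n. 2 * ln (real n + 1) / lil_scale n) \<longlonglongrightarrow> 0"
    unfolding lil_scale_def by real_asymp+
qed

lemma offspring_mean_eq_one:
  assumes "pmf q 1 = 1"
  shows "offspring_mean q = 1"
proof -
  have "pmf q k = 0" if "k \<noteq> 1" for k
  proof -
    have "pmf q 1 + pmf q k = measure q {1, k}"
      using that by (subst measure_measure_pmf_finite) auto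
    also have "\<dots> \<le> 1" by (rule measure_pmf.prob_le_1)
    finally show ?thesis using assms pmf_nonneg[of q k] by linarith
  qed
  then have "offspring_mean q = (\<Sum>k\<in>{1}. real k * pmf q k)"
    unfolding offspring_mean_def by (intro suminf_finite) auto
  then show ?thesis using assms by simp
qed

theorem theorem2p1:
  fixes M :: "'w measure" and E :: "'e measure"
    and \<xi> :: "nat \<Rightarrow> 'w \<Rightarrow> 'e" and p :: "'e \<Rightarrow> nat pmf"
    and X :: "nat \<Rightarrow> nat \<Rightarrow> 'w \<Rightarrow> nat" and Z :: "nat \<Rightarrow> 'w \<Rightarrow> nat"
    and m :: "nat \<Rightarrow> 'w \<Rightarrow> real" and L :: "'w \<Rightarrow> real" and \<mu> \<sigma> \<delta> :: real
  assumes bp: "branching_process_iid_env M E \<xi> p X Z"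
    and m: "\<And>n \<omega>. m n \<omega> = offspring_mean (p (\<xi> n \<omega>))"
    and L: "\<And>\<omega>. L \<omega> = ln (m 0 \<omega>)"
    and \<mu>: "\<mu> = (\<integral>\<omega>. L \<omega> \<partial>M)"
    and \<sigma>: "\<sigma> = sqrt (\<integral>\<omega>. (L \<omega> - \<mu>)\<^sup>2 \<partial>M)"
    \<comment> \<open>The next assumption says \<open>m 0 < \<infinity>\<close> a.s.; without it the real-valued series in \<open>m\<close> would be a
        junk value.\<close>
    and mean_finite: "AE \<omega> in M. summable (\<lambda>k. real k * pmf (p (\<xi> 0 \<omega>)) k)"
    and L_integrable: "integrable M L"
    and supercritical: "\<mu> > 0"
    and no_death: "AE \<omega> in M. pmf (p (\<xi> 0 \<omega>)) 0 = 0"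
    and variance_finite: "integrable M (\<lambda>\<omega>. (L \<omega> - \<mu>)\<^sup>2)"
    and \<sigma>_pos: "\<sigma> > 0"
    and Z_log_Z: "integrable M (\<lambda>\<omega>. real (Z 1 \<omega>) / m 0 \<omega> * ln (real (Z 1 \<omega>)))"
    and \<delta>: "0 < \<delta>" "\<delta> < 1"
    and moment: "integrable M (\<lambda>\<omega>. L \<omega> powr (2 + \<delta>))"
  shows "(AE \<omega> in M. limsup (\<lambda>n. ereal ((ln (real (Z n \<omega>)) - real n * \<mu>)
             / sqrt (real n * ln (ln (real n))))) = ereal (sqrt 2 * \<sigma>)) \<and>
         (AE \<omega> in M. liminf (\<lambda>n. ereal ((ln (real (Z n \<omega>)) - real n * \<mu>)
             / sqrt (real n * ln (ln (real n))))) = ereal (- sqrt 2 * \<sigma>))"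
proof -
  interpret branching_process_iid_env M E \<xi> p X Z by (rule bp)
  interpret B: supercritical_branching M E \<xi> p X Z
  proof
    show "\<not> (AE \<omega> in M. pmf (p (\<xi> 0 \<omega>)) 1 = 1)"
    proof
      assume "AE \<omega> in M. pmf (p (\<xi> 0 \<omega>)) 1 = 1"
      then have "AE \<omega> in M. L \<omega> = 0" by eventually_elim (simp only: L m offspring_mean_eq_one ln_one)
      then have "\<mu> = 0" unfolding \<mu> by (rule integral_eq_zero_AE)
      with supercritical show False by simp
    qed
  qed (use mean_finite no_death Z_log_Z in \<open>simp_all add: m\<close>)
  have m_eq: "B.m = m" by (intro ext) (simp add: B.m_def m)
  define G where "G e = (ln (offspring_mean (p e)) - \<mu>) / \<sigma>" for e
  have [measurable]: "G \<in> borel_measurable E" unfolding G_def by measurable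
  define Y where "Y n \<omega> = G (\<xi> n \<omega>)" for n \<omega>
  have Y: "Y n \<omega> = (ln (m n \<omega>) - \<mu>) / \<sigma>" for n \<omega> by (simp add: Y_def G_def m)
  have Y0: "Y 0 \<omega> = (L \<omega> - \<mu>) / \<sigma>" for \<omega> by (simp add: Y L)
  have L_nonneg: "AE \<omega> in M. 0 \<le> L \<omega>"
    using B.env_regular unfolding m_eq by eventually_elim (simp add: L)
  have var: "(\<integral>\<omega>. (L \<omega> - \<mu>)\<^sup>2 \<partial>M) = \<sigma>\<^sup>2" unfolding \<sigma> by simp
  have L_meas [measurable]: "L \<in> borel_measurable M" using L_integrable by simp
  interpret Y: standardized_iid M Y \<delta>
  proof
    show "indep_vars (\<lambda>_. borel) Y UNIV"
      unfolding Y_def[abs_def] by (rule indep_vars_compose2[OF env_indep]) simp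
    show "distr M borel (Y n) = distr M borel (Y 0)" for n
    proof -
      have "distr M borel (Y n) = distr (distr M E (\<xi> n)) borel G" for n
        unfolding Y_def[abs_def] by (subst distr_distr) (auto simp: comp_def)
      then show ?thesis by (simp only: env_ident[of n])
    qed
    show "expectation (Y 0) = 0"
      using L_integrable by (simp add: Y0[abs_def] \<mu>[symmetric] prob_space)
    show "integrable M (\<lambda>\<omega>. (Y 0 \<omega>)\<^sup>2)"
      using variance_finite by (simp add: Y0 power_divide)
    show "expectation (\<lambda>\<omega>. (Y 0 \<omega>)\<^sup>2) = 1"
      using \<sigma>_pos by (simp add: Y0 power_divide var)
    have "integrable M (\<lambda>\<omega>. \<bar>L \<omega> - \<mu>\<bar> powr (2 + \<delta>))"
    proof (rule Bochner_Integration.integrable_bound)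
      show "integrable M (\<lambda>\<omega>. L \<omega> powr (2 + \<delta>) + \<mu> powr (2 + \<delta>))"
        using moment by simp
      show "AE \<omega> in M. norm (\<bar>L \<omega> - \<mu>\<bar> powr (2 + \<delta>)) \<le> norm (L \<omega> powr (2 + \<delta>) + \<mu> powr (2 + \<delta>))"
        using L_nonneg
      proof eventually_elim
        case (elim \<omega>)
        \<comment> \<open>Both \<open>L \<omega>\<close> and \<open>\<mu>\<close> are nonnegative,
          so their distance is at most their maximum.\<close>
        have "\<bar>L \<omega> - \<mu>\<bar> powr (2 + \<delta>) \<le> max (L \<omega>) \<mu> powr (2 + \<delta>)"
          using elim supercritical \<delta> by (intro powr_mono2) auto
        also have "\<dots> \<le> L \<omega> powr (2 + \<delta>) + \<mu> powr (2 + \<delta>)" by (simp add: max_def)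
        finally show ?case by simp
      qed
    qed measurable
    then have "integrable M (\<lambda>\<omega>. \<bar>L \<omega> - \<mu>\<bar> powr (2 + \<delta>) / \<sigma> powr (2 + \<delta>))" by simp
    then show "integrable M (\<lambda>\<omega>. \<bar>Y 0 \<omega>\<bar> powr (2 + \<delta>))"
      using \<sigma>_pos by (simp add: Y0 powr_divide)
  qed (use \<delta> in auto)
  \<comment> \<open>The centring \<open>n * \<mu>\<close> is absorbed by the standardized walk; the
    bracket is the logarithm of the normalized population.\<close>
  have dec: "ln (real (Z n \<omega>)) - real n * \<mu> = \<sigma> * Y.S n \<omega> + (ln (real (Z n \<omega>)) - (\<Sum>j<n. ln (m j \<omega>)))" for n \<omega>
    using \<sigma>_pos by (simp add: Y.S_def Y sum_divide_distrib[symmetric] sum_subtractf)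
  have R: "AE \<omega> in M. (\<lambda>n. (ln (real (Z n \<omega>)) - (\<Sum>j<n. ln (m j \<omega>))) / lil_scale n) \<longlonglongrightarrow> 0"
    using B.log_Z_close_to_log_mean unfolding m_eq
  proof eventually_elim
    case (elim \<omega>)
    then obtain K where K: "\<forall>\<^sub>F n in sequentially. - K \<le> ln (real (Z n \<omega>)) - (\<Sum>j<n. ln (m j \<omega>))
     \<and> ln (real (Z n \<omega>)) - (\<Sum>j<n. ln (m j \<omega>)) \<le> 2 * ln (real n + 1)" by blast
    show ?case
      by (rule log_error_negligible[of K]) (rule eventually_mono[OF K], simp)+
  qed
  have "AE \<omega> in M. limsup (\<lambda>n. ereal ((ln (real (Z n \<omega>)) - real n * \<mu>) / lil_scale n)) = ereal (sqrt 2 * \<sigma>)"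
    using Y.law_of_iterated_logarithm R
  proof eventually_elim
    case (elim \<omega>)
    show ?case unfolding dec by (rule limsup_affine_perturbation[OF elim(2,1) \<sigma>_pos])
  qed
  moreover have "AE \<omega> in M. liminf (\<lambda>n. ereal ((ln (real (Z n \<omega>)) - real n * \<mu>) / lil_scale n)) = ereal (- sqrt 2 * \<sigma>)"
    using standardized_iid.law_of_iterated_logarithm[OF Y.standardized_iid_uminus] R
  proof eventually_elim
    case (elim \<omega>)
    let ?R = "\<lambda>n. ln (real (Z n \<omega>)) - (\<Sum>j<n. ln (m j \<omega>))"
    \<comment> \<open>The negated decomposition again has the form handled for the limsup, with the
      walk of the negated steps and the error \<open>- ?R n\<close>.\<close>
    have "(\<lambda>n. - ?R n / lil_scale n) \<longlonglongrightarrow> 0" using tendsto_minus[OF elim(2)] by (simp add: minus_divide_left)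
    from limsup_affine_perturbation[OF this elim(1)[unfolded Y.S_uminus] \<sigma>_pos]
    have "limsup (\<lambda>n. ereal ((\<sigma> * - Y.S n \<omega> + - ?R n) / lil_scale n)) = ereal (sqrt 2 * \<sigma>)" .
    also have "(\<lambda>n. ereal ((\<sigma> * - Y.S n \<omega> + - ?R n) / lil_scale n))
      = (\<lambda>n. - ereal ((ln (real (Z n \<omega>)) - real n * \<mu>) / lil_scale n))"
      unfolding dec by (simp add: minus_divide_left)
    finally have "- liminf (\<lambda>n. ereal ((ln (real (Z n \<omega>)) - real n * \<mu>) / lil_scale n)) = ereal (sqrt 2 * \<sigma>)"
      unfolding ereal_Limsup_uminus .
    then show ?case by (simp add: ereal_uminus_eq_reorder)
  qed
  ultimately show ?thesis unfolding lil_scale_def by blast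
qed

end
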